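(* Let $\mathcal{H}_A,\mathcal{H}_B$ be finite-dimensional complex Hilbert spaces. Let $\Phi:\mathcal{B}(\mathcal{H}_B)\to\mathcal{B}(\mathcal{H}_B)$ be a channel in the Heisenberg picture (unital and completely positive) whose Schrödinger dual $\Phi^*$ admits a full-rank fixed point. Let $E:\mathcal{B}(\mathcal{H}_B)\to\mathrm{Fix}(\Phi)$ be the conditional expectation onto the fixed point algebra given by the ergodic projection of $\Phi$, let $E^*$ denote its dual, let $\{P_i\}_{i=1}^k$ be the block projections of $\mathrm{Fix}(\Phi)$ and $(d_1,\dots,d_k)$ its block dimensions. Then there exists a measurement $\mathcal{M}_B$ on $\mathcal{H}_B$ such that, for every Hermitian operator $X_{AB}\in\mathcal{B}(\mathcal{H}_A\otimes\mathcal{H}_B)$ satisfying $$(\mathrm{id}_A\otimes E^* )(X_{AB})=X_{AB}\qquad\text{and}\qquad \mathrm{tr}[(1_A\otimes P_i)X_{AB}]=0\quad(1\le i\le k),$$ one has $$\lVert X_{AB}\rVert_1\le 2\,d_{\max}\,\lVert(\mathrm{id}_A\otimes\mathcal{M}_B)(X_{AB})\rVert_1,\qquad d_{\max}:=\max_{1\le i\le k}d_i.$$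
   Context: The Hilbert–Schmidt dual is defined by $\mathrm{tr}[\Phi^*(\rho)a]=\mathrm{tr}[\rho\,\Phi(a)]$. $\mathrm{Fix}(\Phi)=\{X:\Phi(X)=X\}$ is, under the full-rank hypothesis, a unital $*$-subalgebra, and $E=\lim_{N\to\infty}\frac1N\sum_{t=0}^{N-1}\Phi^{\circ t}$ is a conditional expectation onto it. There is a decomposition $\mathcal{H}_B\cong\bigoplus_{i=1}^k\mathcal{H}_{i,1}\otimes\mathcal{H}_{i,2}$ with $\mathrm{Fix}(\Phi)\cong\bigoplus_i\mathcal{B}(\mathcal{H}_{i,1})\otimes1_{\mathcal{H}_{i,2}}$; $d_i=\dim\mathcal{H}_{i,1}$ and $P_i$ is the orthogonal projection of $\mathcal{H}_B$ onto the $i$-th summand $\mathcal{H}_{i,1}\otimes\mathcal{H}_{i,2}$. A measurement $\mathcal{M}_B$ with finite outcome set $\mathcal{Z}$ is given by a POVM $\{M_z\}_{z\in\mathcal{Z}}$ on $\mathcal{H}_B$ and is identified with the quantum-classical channel $X\mapsto\sum_z\mathrm{tr}[M_zX]\,|z\rangle\langle z|$. $\lVert\cdot\rVert_1$ is the trace norm. *)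

theory Defs
  imports
    "Jordan_Normal_Form.Schur_Decomposition"
    "Jordan_Normal_Form.DL_Rank"
begin

text \<open>
  A Hilbert space of dimension n is represented by its coordinate space, so that the bounded
  operators on it are \<^term>\<open>carrier_mat n n :: complex mat set\<close>. A superoperator is a HOL function
  on matrices of which only the restriction to the relevant carrier matters.

  The order on \<^typ>\<open>complex\<close> is that of Complex\_Order: \<^term>\<open>(0::complex) \<le> z\<close> says that z is
  real and nonnegative.
\<close>

definition mat_trace :: "complex mat \<Rightarrow> complex" where
  "mat_trace A = (\<Sum>i<dim_row A. A $$ (i, i))"

definition psd :: "nat \<Rightarrow> complex mat \<Rightarrow> bool" where
  "psd n A \<longleftrightarrow> A \<in> carrier_mat n n \<and> (\<forall>v \<in> carrier_vec n. 0 \<le> (A *\<^sub>v v) \<bullet>c v)"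

text \<open>The operator absolute value: the positive square root of \<open>X\<^sup>* X\<close>.\<close>

definition mat_abs :: "complex mat \<Rightarrow> complex mat" where
  "mat_abs X = (THE P. psd (dim_col X) P \<and> P * P = mat_adjoint X * X)"

definition trace_norm :: "complex mat \<Rightarrow> real" where
  "trace_norm X = Re (mat_trace (mat_abs X))"


subsection \<open>Tensor products\<close>

text \<open>
  The basis vector \<open>e\<^sub>a \<otimes> e\<^sub>b\<close> of a tensor product whose second factor has dimension n is the
  basis vector with number \<open>a * n + b\<close>.
\<close>

definition kron :: "complex mat \<Rightarrow> complex mat \<Rightarrow> complex mat" where
  "kron A B = mat (dim_row A * dim_row B) (dim_col A * dim_col B)
     (\<lambda>(i, j). A $$ (i div dim_row B, j div dim_col B) * B $$ (i mod dim_row B, j mod dim_col B))"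

definition tensor_block :: "nat \<Rightarrow> complex mat \<Rightarrow> nat \<Rightarrow> nat \<Rightarrow> complex mat" where
  "tensor_block n X a a' = mat n n (\<lambda>(b, b'). X $$ (a * n + b, a' * n + b'))"

text \<open>
  \<open>id_tensor r n l F\<close> is \<open>id \<otimes> F\<close> for F mapping n by n to l by l matrices, the first tensor factor
  having dimension r: an operator \<open>\<Sum>\<^sub>a\<^sub>a\<^sub>' |a\<rangle>\<langle>a'| \<otimes> X\<^sub>a\<^sub>a\<^sub>'\<close> goes to \<open>\<Sum>\<^sub>a\<^sub>a\<^sub>' |a\<rangle>\<langle>a'| \<otimes> F X\<^sub>a\<^sub>a\<^sub>'\<close>.
  See lemma \<open>id_tensor_kron\<close> for its values on elementary tensors.
\<close>

definition id_tensor ::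
  "nat \<Rightarrow> nat \<Rightarrow> nat \<Rightarrow> (complex mat \<Rightarrow> complex mat) \<Rightarrow> complex mat \<Rightarrow> complex mat" where
  "id_tensor r n l F X = mat (r * l) (r * l)
     (\<lambda>(i, j). F (tensor_block n X (i div l) (j div l)) $$ (i mod l, j mod l))"


subsection \<open>Channels, duals and the ergodic projection\<close>

definition linear_superop :: "nat \<Rightarrow> (complex mat \<Rightarrow> complex mat) \<Rightarrow> bool" where
  "linear_superop n \<Phi> \<longleftrightarrow>
     (\<forall>X \<in> carrier_mat n n. \<Phi> X \<in> carrier_mat n n) \<and>
     (\<forall>X \<in> carrier_mat n n. \<forall>Y \<in> carrier_mat n n. \<Phi> (X + Y) = \<Phi> X + \<Phi> Y) \<and>
     (\<forall>X \<in> carrier_mat n n. \<forall>c. \<Phi> (c \<cdot>\<^sub>m X) = c \<cdot>\<^sub>m \<Phi> X)"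

definition completely_positive :: "nat \<Rightarrow> (complex mat \<Rightarrow> complex mat) \<Rightarrow> bool" where
  "completely_positive n \<Phi> \<longleftrightarrow>
     linear_superop n \<Phi> \<and> (\<forall>r X. psd (r * n) X \<longrightarrow> psd (r * n) (id_tensor r n n \<Phi> X))"

definition heisenberg_channel :: "nat \<Rightarrow> (complex mat \<Rightarrow> complex mat) \<Rightarrow> bool" where
  "heisenberg_channel n \<Phi> \<longleftrightarrow> completely_positive n \<Phi> \<and> \<Phi> (1\<^sub>m n) = 1\<^sub>m n"

definition hs_dual :: "nat \<Rightarrow> (complex mat \<Rightarrow> complex mat) \<Rightarrow> complex mat \<Rightarrow> complex mat" where
  "hs_dual n \<Phi> \<rho> = (THE \<tau>. \<tau> \<in> carrier_mat n n \<and>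
     (\<forall>a \<in> carrier_mat n n. mat_trace (\<tau> * a) = mat_trace (\<rho> * \<Phi> a)))"

definition Fix :: "nat \<Rightarrow> (complex mat \<Rightarrow> complex mat) \<Rightarrow> complex mat set" where
  "Fix n \<Phi> = {X \<in> carrier_mat n n. \<Phi> X = X}"

text \<open>The matrix type carries no topology, so the limit of the Cesaro means is taken entrywise.\<close>

definition ergodic_proj :: "nat \<Rightarrow> (complex mat \<Rightarrow> complex mat) \<Rightarrow> complex mat \<Rightarrow> complex mat" where
  "ergodic_proj n \<Phi> X =
     mat n n (\<lambda>(i, j). lim (\<lambda>N. (\<Sum>t<N. ((\<Phi> ^^ t) X) $$ (i, j)) / of_nat N))"


subsection \<open>Block decompositions\<close>

text \<open>
  The unitary U identifies \<open>\<Oplus>\<^sub>i \<complex>\<^bsup>d i\<^esup> \<otimes> \<complex>\<^bsup>m i\<^esup>\<close>, i < k, with the whole space, in such a way that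
  \<open>\<Oplus>\<^sub>i B(\<complex>\<^bsup>d i\<^esup>) \<otimes> 1\<close> is carried to the algebra S.
\<close>

definition block_decomposition ::
  "nat \<Rightarrow> complex mat set \<Rightarrow> nat \<Rightarrow> (nat \<Rightarrow> nat) \<Rightarrow> (nat \<Rightarrow> nat) \<Rightarrow> complex mat \<Rightarrow> bool" where
  "block_decomposition n S k d m U \<longleftrightarrow>
     (\<forall>i<k. 0 < d i \<and> 0 < m i) \<and> (\<Sum>i<k. d i * m i) = n \<and>
     U \<in> carrier_mat n n \<and> mat_adjoint U * U = 1\<^sub>m n \<and> U * mat_adjoint U = 1\<^sub>m n \<and>
     S = {U * diag_block_mat (map (\<lambda>i. kron (A i) (1\<^sub>m (m i))) [0..<k]) * mat_adjoint U | A.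
            \<forall>i<k. A i \<in> carrier_mat (d i) (d i)}"

definition block_proj ::
  "nat \<Rightarrow> (nat \<Rightarrow> nat) \<Rightarrow> (nat \<Rightarrow> nat) \<Rightarrow> complex mat \<Rightarrow> nat \<Rightarrow> complex mat" where
  "block_proj k d m U i =
     U * diag_block_mat
           (map (\<lambda>j. if j = i then 1\<^sub>m (d j * m j) else 0\<^sub>m (d j * m j) (d j * m j)) [0..<k])
       * mat_adjoint U"


subsection \<open>Measurements\<close>

text \<open>A POVM with outcome set \<^term>\<open>{..<l::nat}\<close>, and its quantum-classical channel.\<close>

definition povm :: "nat \<Rightarrow> nat \<Rightarrow> (nat \<Rightarrow> complex mat) \<Rightarrow> bool" where
  "povm n l M \<longleftrightarrow>
     (\<forall>z<l. psd n (M z)) \<and> mat n n (\<lambda>(i, j). \<Sum>z<l. M z $$ (i, j)) = 1\<^sub>m n"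

definition qc_channel :: "nat \<Rightarrow> (nat \<Rightarrow> complex mat) \<Rightarrow> complex mat \<Rightarrow> complex mat" where
  "qc_channel l M X = mat l l (\<lambda>(z, w). if z = w then mat_trace (M z * X) else 0)"


subsection \<open>Elementary tensors\<close>

lemma id_tensor_kron:
  assumes A: "A \<in> carrier_mat r r" and B: "B \<in> carrier_mat n n"
    and F: "\<And>X. X \<in> carrier_mat n n \<Longrightarrow> F X \<in> carrier_mat l l"
    and hom: "\<And>c X. X \<in> carrier_mat n n \<Longrightarrow> F (c \<cdot>\<^sub>m X) = c \<cdot>\<^sub>m F X"
  shows "id_tensor r n l F (kron A B) = kron A (F B)"
proof -
  have idx: "a * n + b < r * n" if "a < r" "b < n" for a b
  proof -
    have "a * n + b < Suc a * n" using that by simp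
    also have "\<dots> \<le> r * n" using that by (intro mult_le_mono1) simp
    finally show ?thesis .
  qed
  have blk: "tensor_block n (kron A B) a a' = A $$ (a, a') \<cdot>\<^sub>m B" if "a < r" "a' < r" for a a'
    using that A B idx by (intro eq_matI) (auto simp: tensor_block_def kron_def)
  have FB: "F B \<in> carrier_mat l l" using F B by blast
  show ?thesis
  proof (rule eq_matI)
    fix i j
    assume "i < dim_row (kron A (F B))" "j < dim_col (kron A (F B))"
    then have ij: "i < r * l" "j < r * l" using A FB by (auto simp: kron_def)
    then have "0 < l" by (cases l) auto
    then have "i div l < r" "j div l < r" "i mod l < l" "j mod l < l"
      using ij by (auto simp: less_mult_imp_div_less)
    then show "id_tensor r n l F (kron A B) $$ (i, j) = kron A (F B) $$ (i, j)"
      using ij A FB hom[OF B] by (simp add: id_tensor_def blk) (simp add: kron_def)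
  qed (use A FB in \<open>auto simp: id_tensor_def kron_def\<close>)
qed

end

theory Submission
  imports Defs "Jordan_Normal_Form.Spectral_Radius"
begin

text \<open>
  A weighted 2-design of vectors \<open>\<psi>\<close> in dimension \<open>d\<close> satisfies
  \<open>A = \<Sum> tr(((d + 1) |\<psi>\<rangle>\<langle>\<psi>| - 1) A) w |\<psi>\<rangle>\<langle>\<psi>|\<close> for all d by d matrices A, and
  \<open>(d + 1) |\<psi>\<rangle>\<langle>\<psi>| - 1 = d |\<psi>\<rangle>\<langle>\<psi>| - (1 - |\<psi>\<rangle>\<langle>\<psi>|)\<close> has trace norm \<open>2d - 1\<close>. Measuring in every block
  of the fixed point algebra along such a design gives effects \<open>M\<^sub>z\<close> in the algebra and functionals
  \<open>f\<^sub>z\<close> with \<open>T = \<Sum> f\<^sub>z(T) M\<^sub>z\<close> on the algebra. For a contraction V with \<open>\<parallel>X\<parallel>\<^sub>1 = tr(X V)\<close> the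
  hypothesis \<open>(id \<otimes> E\<^sup>*)(X) = X\<close> replaces V by the contraction \<open>(id \<otimes> E)(V)\<close>, whose blocks lie in the
  algebra; expanding them in the frame turns \<open>tr(X V)\<close> into the pairing of the measured operator with
  \<open>\<Sum> (id \<otimes> f\<^sub>z)((id \<otimes> E)(V)) \<otimes> |z\<rangle>\<langle>z|\<close>, an operator of norm at most \<open>2 d\<^sub>m\<^sub>a\<^sub>x\<close>.
\<close>


section \<open>Sesquilinear forms and the trace norm of Hermitian matrices\<close>

text \<open>Any family of effects spanning the algebra would give an expansion, but the norms of its
  dual functionals would depend on the family. A 2-design makes them explicit: on a block of
  dimension d each one is d times a vector state minus a positive form of mass d - 1, and this
  estimate survives tensoring with the identity on A. Multiplicity spaces cost nothing: the
  functional reads T on one copy of the block, whereas the effect, like T itself, is repeated on all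
  copies. Hence d_max and not dim H_B governs the constant.

  Of the conditional expectation three properties enter: linearity, values in the fixed point set,
  and preservation of contractions under amplification. All three presuppose that the Cesaro limit
  exists, since \<open>lim\<close> says nothing otherwise; power boundedness and compactness provide
  this. Likewise \<open>mat_abs\<close> and \<open>hs_dual\<close> are definite descriptions, so the
  trace norm can be evaluated only after a spectral theorem and the uniqueness of positive square
  roots.\<close>

definition sesq :: "nat \<Rightarrow> complex mat \<Rightarrow> (nat \<Rightarrow> complex) \<Rightarrow> (nat \<Rightarrow> complex) \<Rightarrow> complex" where
  "sesq n X u v = (\<Sum>i<n. \<Sum>j<n. cnj (u i) * X $$ (i, j) * v j)"

text \<open>Here and below vectors are plain functions of which only the first n values count, so
  that slices and tensor products of vectors need no carrier conditions.\<close>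

definition norm_sq :: "nat \<Rightarrow> (nat \<Rightarrow> complex) \<Rightarrow> real" where
  "norm_sq n u = (\<Sum>i<n. (cmod (u i))\<^sup>2)"

text \<open>The operator norm bound by \<open>c\<close>: rescaling \<open>u\<close> and
  \<open>v\<close> against each other recovers |<u, X v>| \<le> c |u| |v|. In this form the
  inequality is linear in \<open>X\<close>, so it passes to averages and limits, and it is the
  positivity of a quadratic form in the pair of \<open>u\<close> and \<open>v\<close>.\<close>

definition op_bounded :: "nat \<Rightarrow> real \<Rightarrow> complex mat \<Rightarrow> bool" where
  "op_bounded n c X \<longleftrightarrow> X \<in> carrier_mat n n \<and>
     (\<forall>u v. 2 * Re (sesq n X u v) \<le> c * (norm_sq n u + norm_sq n v))"

definition mat_apply :: "nat \<Rightarrow> complex mat \<Rightarrow> (nat \<Rightarrow> complex) \<Rightarrow> nat \<Rightarrow> complex" where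
  "mat_apply n A v = (\<lambda>i. \<Sum>j<n. A $$ (i, j) * v j)"

definition onb :: "nat \<Rightarrow> (nat \<Rightarrow> nat \<Rightarrow> complex) \<Rightarrow> bool" where
  "onb n w \<longleftrightarrow>
     (\<forall>j<n. \<forall>k<n. (\<Sum>x<n. cnj (w j x) * w k x) = (if j = k then 1 else 0)) \<and>
     (\<forall>x<n. \<forall>y<n. (\<Sum>j<n. w j x * cnj (w j y)) = (if x = y then 1 else 0))"

text \<open>The operator diagonal in the basis \<open>w\<close> with eigenvalues \<open>f\<close>.
  Varying \<open>f\<close> gives the functional calculus of a Hermitian matrix.\<close>

definition spec_mat :: "nat \<Rightarrow> (nat \<Rightarrow> nat \<Rightarrow> complex) \<Rightarrow> (nat \<Rightarrow> complex) \<Rightarrow> complex mat" where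
  "spec_mat n w f = mat n n (\<lambda>(x, y). \<Sum>j<n. f j * (w j x * cnj (w j y)))"

lemma norm_sq_nonneg: "0 \<le> norm_sq n u"
  unfolding norm_sq_def by (intro sum_nonneg) auto

lemma norm_sq_complex: "complex_of_real (norm_sq n u) = (\<Sum>i<n. cnj (u i) * u i)"
  unfolding norm_sq_def of_real_sum complex_norm_square by (simp add: mult_ac)

lemma norm_sq_eq_0_iff: "norm_sq n u = 0 \<longleftrightarrow> (\<forall>i<n. u i = 0)"
  unfolding norm_sq_def by (subst sum_nonneg_eq_0_iff) auto

lemma norm_sq_scale: "norm_sq n (\<lambda>i. c * u i) = (cmod c)\<^sup>2 * norm_sq n u"
  unfolding norm_sq_def by (simp add: norm_mult power_mult_distrib sum_distrib_left)

lemma sesq_cong: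
  "(\<And>i. i < n \<Longrightarrow> u i = u' i) \<Longrightarrow> (\<And>i. i < n \<Longrightarrow> v i = v' i) \<Longrightarrow>
   (\<And>i j. i < n \<Longrightarrow> j < n \<Longrightarrow> X $$ (i, j) = Y $$ (i, j)) \<Longrightarrow> sesq n X u v = sesq n Y u' v'"
  unfolding sesq_def by (intro sum.cong refl) auto

lemma sesq_scale_left: "sesq n X (\<lambda>i. c * u i) v = cnj c * sesq n X u v"
  unfolding sesq_def by (simp add: sum_distrib_left algebra_simps)

lemma sesq_scale_right: "sesq n X u (\<lambda>i. c * v i) = c * sesq n X u v"
  unfolding sesq_def by (simp add: sum_distrib_left algebra_simps)

lemma sesq_mat_apply: "sesq n X u v = (\<Sum>i<n. cnj (u i) * mat_apply n X v i)"
  unfolding sesq_def mat_apply_def by (simp add: sum_distrib_left algebra_simps)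

lemma psd_iff_sesq: "psd n A \<longleftrightarrow> A \<in> carrier_mat n n \<and> (\<forall>u. 0 \<le> sesq n A u u)"
proof (cases "A \<in> carrier_mat n n")
  case True
  have eq: "(A *\<^sub>v vec n u) \<bullet>c vec n u = sesq n A u u" for u
  proof -
    have "(A *\<^sub>v vec n u) \<bullet>c vec n u = (\<Sum>i<n. (\<Sum>j<n. A $$ (i, j) * u j) * cnj (u i))"
      using True by (simp add: scalar_prod_def atLeast0LessThan)
    also have "\<dots> = sesq n A u u"
      unfolding sesq_def by (simp add: sum_distrib_left sum_distrib_right algebra_simps)
    finally show ?thesis .
  qed
  have "(\<forall>v\<in>carrier_vec n. 0 \<le> (A *\<^sub>v v) \<bullet>c v) \<longleftrightarrow> (\<forall>u. 0 \<le> sesq n A u u)"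
  proof safe
    fix u assume "\<forall>v\<in>carrier_vec n. 0 \<le> (A *\<^sub>v v) \<bullet>c v"
    from bspec[OF this vec_carrier[of n u]] have "0 \<le> (A *\<^sub>v vec n u) \<bullet>c vec n u" .
    then show "0 \<le> sesq n A u u" by (simp add: eq)
  next
    fix v :: "complex vec"
    assume *: "\<forall>u. 0 \<le> sesq n A u u" and v: "v \<in> carrier_vec n"
    have "v = vec n (\<lambda>i. v $ i)" using v by (intro eq_vecI) auto
    then show "0 \<le> (A *\<^sub>v v) \<bullet>c v" using * eq by metis
  qed
  then show ?thesis using True by (simp add: psd_def)
qed (simp add: psd_def)

lemma sesq_sum_units:
  assumes "i < n" "j < n"
  shows "sesq n A (\<lambda>x. if x = i then 1 else 0) (\<lambda>x. if x = j then 1 else 0) = A $$ (i, j)"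
proof -
  have "sesq n A (\<lambda>x. if x = i then 1 else 0) (\<lambda>x. if x = j then 1 else 0) =
    (\<Sum>x<n. \<Sum>y<n. if y = j then (if x = i then A $$ (x, y) else 0) else 0)"
    unfolding sesq_def by (intro sum.cong) auto
  then show ?thesis using assms by simp
qed

lemma sesq_add_left: "sesq n X (\<lambda>i. u i + u' i) v = sesq n X u v + sesq n X u' v"
  unfolding sesq_def by (simp add: algebra_simps sum.distrib)

lemma sesq_add_right: "sesq n X u (\<lambda>i. v i + v' i) = sesq n X u v + sesq n X u v'"
  unfolding sesq_def by (simp add: algebra_simps sum.distrib)

text \<open>Polarization: a form that is real on the diagonal is Hermitian, as testing on u + v and
  on u + i v shows.\<close>

lemma psd_sesq_cnj:
  assumes "psd n A"
  shows "sesq n A u v = cnj (sesq n A v u)"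
proof -
  have pos: "\<And>u. Im (sesq n A u u) = 0"
    using assms unfolding psd_iff_sesq by (auto simp: less_eq_complex_def)
  have "Im (sesq n A u v + sesq n A v u) = 0"
    using pos[of "\<lambda>i. u i + v i"] pos[of u] pos[of v] by (simp add: sesq_add_left sesq_add_right)
  moreover have "Im (sesq n A u (\<lambda>i. \<i> * v i) + sesq n A (\<lambda>i. \<i> * v i) u) = 0"
    using pos[of "\<lambda>i. u i + \<i> * v i"] pos[of u] pos[of "\<lambda>i. \<i> * v i"]
    by (simp add: sesq_add_left sesq_add_right)
  then have "Re (sesq n A u v) - Re (sesq n A v u) = 0"
    by (simp add: sesq_scale_left sesq_scale_right)
  ultimately show ?thesis by (simp add: complex_eq_iff)
qed

lemma psd_hermitian: "psd n A \<Longrightarrow> i < n \<Longrightarrow> j < n \<Longrightarrow> A $$ (i, j) = cnj (A $$ (j, i))"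
  using psd_sesq_cnj[of n A "\<lambda>x. if x = i then 1 else 0" "\<lambda>x. if x = j then 1 else 0"]
  by (simp add: sesq_sum_units)

section \<open>Entries of adjoints, products and traces\<close>

lemma mat_adjoint_dim: "A \<in> carrier_mat r c \<Longrightarrow> mat_adjoint A \<in> carrier_mat c r"
  by (auto simp: mat_adjoint_def)

lemma mat_adjoint_index:
  fixes A :: "complex mat"
  assumes "A \<in> carrier_mat r c" "i < c" "j < r"
  shows "mat_adjoint A $$ (i, j) = cnj (A $$ (j, i))"
  using assms by (auto simp: mat_adjoint_def mat_of_rows_index)

lemma mat_mult_index:
  fixes A B :: "complex mat"
  assumes "A \<in> carrier_mat r n" "B \<in> carrier_mat n c" "i < r" "j < c"
  shows "(A * B) $$ (i, j) = (\<Sum>k<n. A $$ (i, k) * B $$ (k, j))"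
  using assms by (simp add: scalar_prod_def atLeast0LessThan)

lemma mat_trace_mult:
  assumes "A \<in> carrier_mat n n" "B \<in> carrier_mat n n"
  shows "mat_trace (A * B) = (\<Sum>i<n. \<Sum>j<n. A $$ (i, j) * B $$ (j, i))"
  using assms by (simp add: mat_trace_def scalar_prod_def atLeast0LessThan)

lemma mat_apply_diff_scale:
  "mat_apply n A (\<lambda>x. u x - c * v x) i = mat_apply n A u i - c * mat_apply n A v i"
  unfolding mat_apply_def by (simp add: algebra_simps sum_subtractf sum_distrib_left)

lemma mat_apply_mult:
  assumes "A \<in> carrier_mat n n" "B \<in> carrier_mat n n" "i < n"
  shows "mat_apply n (A * B) v i = mat_apply n A (mat_apply n B v) i"
proof -
  have "mat_apply n (A * B) v i = (\<Sum>j<n. \<Sum>k<n. A $$ (i, k) * B $$ (k, j) * v j)"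
    unfolding mat_apply_def using assms
    by (intro sum.cong) (auto simp: mat_mult_index[OF assms(1,2)] sum_distrib_right simp del: index_mult_mat)
  also have "\<dots> = (\<Sum>k<n. \<Sum>j<n. A $$ (i, k) * B $$ (k, j) * v j)" by (rule sum.swap)
  also have "\<dots> = mat_apply n A (mat_apply n B v) i"
    unfolding mat_apply_def by (simp add: sum_distrib_left algebra_simps)
  finally show ?thesis .
qed

section \<open>Functional calculus in an orthonormal basis\<close>

lemma spec_mat_carrier [simp]: "spec_mat n w f \<in> carrier_mat n n"
  by (simp add: spec_mat_def)

lemma spec_mat_index:
  "x < n \<Longrightarrow> y < n \<Longrightarrow> spec_mat n w f $$ (x, y) = (\<Sum>j<n. f j * (w j x * cnj (w j y)))"
  by (simp add: spec_mat_def)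

lemma mat_apply_spec_mat:
  assumes "x < n"
  shows "mat_apply n (spec_mat n w f) v x = (\<Sum>j<n. f j * (\<Sum>y<n. cnj (w j y) * v y) * w j x)"
proof -
  have "mat_apply n (spec_mat n w f) v x = (\<Sum>y<n. \<Sum>j<n. f j * (w j x * cnj (w j y)) * v y)"
    unfolding mat_apply_def using assms
    by (intro sum.cong) (auto simp: spec_mat_index sum_distrib_right)
  also have "\<dots> = (\<Sum>j<n. \<Sum>y<n. f j * (w j x * cnj (w j y)) * v y)" by (rule sum.swap)
  also have "\<dots> = (\<Sum>j<n. f j * (\<Sum>y<n. cnj (w j y) * v y) * w j x)"
    by (simp add: sum_distrib_left sum_distrib_right algebra_simps)
  finally show ?thesis .
qed

lemma mat_apply_spec_mat_onb:
  assumes "onb n w" "k < n" "x < n"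
  shows "mat_apply n (spec_mat n w f) (w k) x = f k * w k x"
proof -
  have "mat_apply n (spec_mat n w f) (w k) x = (\<Sum>j<n. if j = k then f k * w k x else 0)"
    unfolding mat_apply_spec_mat[OF assms(3)] using assms
    by (intro sum.cong) (auto simp: onb_def)
  then show ?thesis using assms by simp
qed

lemma spec_mat_mult:
  assumes "onb n w"
  shows "spec_mat n w f * spec_mat n w g = spec_mat n w (\<lambda>j. f j * g j)"
proof (rule eq_matI)
  fix x y assume "x < dim_row (spec_mat n w (\<lambda>j. f j * g j))" "y < dim_col (spec_mat n w (\<lambda>j. f j * g j))"
  then have xy: "x < n" "y < n" by (auto simp: spec_mat_def)
  have "(spec_mat n w f * spec_mat n w g) $$ (x, y) =
      (\<Sum>z<n. \<Sum>j<n. spec_mat n w f $$ (x, z) * w j z * (g j * cnj (w j y)))"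
    by (subst mat_mult_index[of _ n n _ n])
       (auto simp: xy spec_mat_index[of _ n y] sum_distrib_left mult_ac intro!: sum.cong)
  also have "\<dots> = (\<Sum>j<n. \<Sum>z<n. spec_mat n w f $$ (x, z) * w j z * (g j * cnj (w j y)))"
    by (rule sum.swap)
  also have "\<dots> = (\<Sum>j<n. mat_apply n (spec_mat n w f) (w j) x * (g j * cnj (w j y)))"
    by (simp add: mat_apply_def sum_distrib_right)
  also have "\<dots> = spec_mat n w (\<lambda>j. f j * g j) $$ (x, y)"
    using xy by (auto simp: mat_apply_spec_mat_onb[OF assms] spec_mat_index mult_ac intro!: sum.cong)
  finally show "(spec_mat n w f * spec_mat n w g) $$ (x, y) = spec_mat n w (\<lambda>j. f j * g j) $$ (x, y)" .
qed (auto simp: spec_mat_def)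

lemma mat_adjoint_spec_mat: "mat_adjoint (spec_mat n w f) = spec_mat n w (\<lambda>j. cnj (f j))"
proof (rule eq_matI)
  fix x y assume "x < dim_row (spec_mat n w (\<lambda>j. cnj (f j)))" "y < dim_col (spec_mat n w (\<lambda>j. cnj (f j)))"
  then have "x < n" "y < n" by (auto simp: spec_mat_def)
  then show "mat_adjoint (spec_mat n w f) $$ (x, y) = spec_mat n w (\<lambda>j. cnj (f j)) $$ (x, y)"
    by (subst mat_adjoint_index[of _ n n]) (auto simp: spec_mat_index mult_ac)
qed (auto simp: spec_mat_def mat_adjoint_def)

lemma sesq_spec_mat:
  "sesq n (spec_mat n w f) u v =
    (\<Sum>j<n. f j * cnj (\<Sum>x<n. cnj (w j x) * u x) * (\<Sum>y<n. cnj (w j y) * v y))"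
proof -
  have "sesq n (spec_mat n w f) u v =
     (\<Sum>x<n. \<Sum>j<n. f j * (cnj (u x) * w j x) * (\<Sum>y<n. cnj (w j y) * v y))"
    unfolding sesq_mat_apply
    by (intro sum.cong) (auto simp: mat_apply_spec_mat sum_distrib_left mult_ac)
  also have "\<dots> = (\<Sum>j<n. \<Sum>x<n. f j * (cnj (u x) * w j x) * (\<Sum>y<n. cnj (w j y) * v y))"
    by (rule sum.swap)
  also have "\<dots> = (\<Sum>j<n. f j * cnj (\<Sum>x<n. cnj (w j x) * u x) * (\<Sum>y<n. cnj (w j y) * v y))"
    by (intro sum.cong refl) (simp add: sum_distrib_left sum_distrib_right mult_ac)
  finally show ?thesis .
qed

lemma spec_mat_one: "onb n w \<Longrightarrow> spec_mat n w (\<lambda>j. 1) = 1\<^sub>m n"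
  by (intro eq_matI) (auto simp: spec_mat_def onb_def)

lemma sesq_one: "sesq n (1\<^sub>m n) u v = (\<Sum>i<n. cnj (u i) * v i)"
proof -
  have "sesq n (1\<^sub>m n) u v = (\<Sum>i<n. \<Sum>j<n. if j = i then cnj (u i) * v i else 0)"
    unfolding sesq_def by (intro sum.cong) auto
  then show ?thesis by simp
qed

lemma onb_parseval:
  assumes "onb n w"
  shows "(\<Sum>j<n. (cmod (\<Sum>x<n. cnj (w j x) * u x))\<^sup>2) = norm_sq n u"
proof -
  have "complex_of_real (\<Sum>j<n. (cmod (\<Sum>x<n. cnj (w j x) * u x))\<^sup>2) = sesq n (spec_mat n w (\<lambda>j. 1)) u u"
    unfolding sesq_spec_mat of_real_sum complex_norm_square by (simp add: mult_ac)
  also have "\<dots> = complex_of_real (norm_sq n u)"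
    unfolding spec_mat_one[OF assms] sesq_one norm_sq_complex ..
  finally show ?thesis using of_real_eq_iff by blast
qed

lemma psd_spec_mat:
  assumes "\<And>j. j < n \<Longrightarrow> 0 \<le> f j"
  shows "psd n (spec_mat n w (\<lambda>j. complex_of_real (f j)))"
  unfolding psd_iff_sesq
proof (intro conjI allI)
  fix u
  have "sesq n (spec_mat n w (\<lambda>j. complex_of_real (f j))) u u =
     complex_of_real (\<Sum>j<n. f j * (cmod (\<Sum>x<n. cnj (w j x) * u x))\<^sup>2)"
    unfolding sesq_spec_mat of_real_sum of_real_mult complex_norm_square by (simp add: mult_ac)
  moreover have "0 \<le> (\<Sum>j<n. f j * (cmod (\<Sum>x<n. cnj (w j x) * u x))\<^sup>2)"
    using assms by (intro sum_nonneg) auto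
  ultimately show "0 \<le> sesq n (spec_mat n w (\<lambda>j. complex_of_real (f j))) u u"
    by (simp add: less_eq_complex_def del: of_real_sum of_real_mult)
qed simp

lemma Re_cnj_mult_le: "2 * \<bar>Re (cnj a * b)\<bar> \<le> (cmod a)\<^sup>2 + (cmod b)\<^sup>2"
proof -
  have "\<bar>Re (cnj a * b)\<bar> \<le> cmod a * cmod b"
    using abs_Re_le_cmod[of "cnj a * b"] by (simp add: norm_mult)
  then show ?thesis using sum_squares_bound[of "cmod a" "cmod b"] by linarith
qed

lemma mult_Re_cnj_le:
  assumes "\<bar>c\<bar> \<le> 1"
  shows "c * (2 * Re (cnj a * b)) \<le> (cmod a)\<^sup>2 + (cmod b)\<^sup>2"
proof -
  have "c * (2 * Re (cnj a * b)) \<le> \<bar>c\<bar> * (2 * \<bar>Re (cnj a * b)\<bar>)"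
    using abs_ge_self[of "c * (2 * Re (cnj a * b))"] by (simp only: abs_mult abs_numeral)
  also have "\<dots> \<le> 1 * (2 * \<bar>Re (cnj a * b)\<bar>)" using assms by (intro mult_right_mono) auto
  finally show ?thesis using Re_cnj_mult_le[of a b] by linarith
qed

lemma op_bounded_spec_mat:
  assumes "onb n w" "\<And>j. j < n \<Longrightarrow> \<bar>f j\<bar> \<le> 1"
  shows "op_bounded n 1 (spec_mat n w (\<lambda>j. complex_of_real (f j)))"
  unfolding op_bounded_def
proof (intro conjI allI)
  fix u v
  let ?a = "\<lambda>u j. \<Sum>x<n. cnj (w j x) * u x"
  have "2 * Re (sesq n (spec_mat n w (\<lambda>j. complex_of_real (f j))) u v) =
     (\<Sum>j<n. f j * (2 * Re (cnj (?a u j) * ?a v j)))"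
    unfolding sesq_spec_mat by (simp add: sum_distrib_left mult.assoc algebra_simps del: cnj_sum)
  also have "\<dots> \<le> (\<Sum>j<n. (cmod (?a u j))\<^sup>2 + (cmod (?a v j))\<^sup>2)"
    using assms(2) by (intro sum_mono mult_Re_cnj_le) auto
  also have "\<dots> = 1 * (norm_sq n u + norm_sq n v)"
    by (simp add: sum.distrib onb_parseval[OF assms(1)])
  finally show "2 * Re (sesq n (spec_mat n w (\<lambda>j. complex_of_real (f j))) u v) \<le> 1 * (norm_sq n u + norm_sq n v)" .
qed simp

lemma mat_trace_mult_spec_mat:
  assumes "G \<in> carrier_mat n n"
  shows "mat_trace (spec_mat n w f * G) = (\<Sum>j<n. f j * sesq n G (w j) (w j))"
proof -
  have "mat_trace (spec_mat n w f * G) = (\<Sum>x<n. \<Sum>y<n. \<Sum>j<n. f j * (w j x * cnj (w j y)) * G $$ (y, x))"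
    unfolding mat_trace_mult[OF spec_mat_carrier assms]
    by (intro sum.cong) (auto simp: spec_mat_index sum_distrib_right)
  also have "\<dots> = (\<Sum>x<n. \<Sum>j<n. \<Sum>y<n. f j * (w j x * cnj (w j y)) * G $$ (y, x))"
    by (intro sum.cong refl sum.swap)
  also have "\<dots> = (\<Sum>j<n. \<Sum>x<n. \<Sum>y<n. f j * (w j x * cnj (w j y)) * G $$ (y, x))"
    by (rule sum.swap)
  also have "\<dots> = (\<Sum>j<n. \<Sum>y<n. \<Sum>x<n. f j * (w j x * cnj (w j y)) * G $$ (y, x))"
    by (intro sum.cong refl sum.swap)
  also have "\<dots> = (\<Sum>j<n. f j * sesq n G (w j) (w j))"
    by (simp add: sesq_def sum_distrib_left mult_ac)
  finally show ?thesis .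
qed

text \<open>For \<open>u = P v - \<mu> v\<close> the hypothesis gives \<open>P u = - \<mu> u\<close>, which positivity of P forbids unless \<open>u = 0\<close>.\<close>

lemma psd_sqrt_eigenvector:
  assumes P: "psd n P" and \<mu>: "0 \<le> \<mu>"
    and sq: "\<And>x. x < n \<Longrightarrow> mat_apply n P (mat_apply n P v) x = (complex_of_real \<mu>)\<^sup>2 * v x"
    and x: "x < n"
  shows "mat_apply n P v x = complex_of_real \<mu> * v x"
proof -
  define u where "u = (\<lambda>x. mat_apply n P v x - complex_of_real \<mu> * v x)"
  have Pu: "mat_apply n P u x = - complex_of_real \<mu> * u x" if "x < n" for x
  proof -
    have "mat_apply n P u x = mat_apply n P (mat_apply n P v) x - complex_of_real \<mu> * mat_apply n P v x"
      unfolding u_def by (rule mat_apply_diff_scale)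
    then show ?thesis using sq[OF that] by (simp add: u_def algebra_simps power2_eq_square)
  qed
  have "norm_sq n u = 0"
  proof (cases "\<mu> = 0")
    \<comment> \<open>For \<mu> = 0 positivity excludes nothing. Here u = P v and P u = 0, so
      Hermitian symmetry gives |u|^2 = <u, P v> = <P u, v> = 0.\<close>
    case True
    have "complex_of_real (norm_sq n u) = sesq n P u v"
      unfolding norm_sq_complex sesq_mat_apply using True by (simp add: u_def)
    also have "\<dots> = cnj (sesq n P v u)" by (rule psd_sesq_cnj[OF P])
    also have "sesq n P v u = 0"
      unfolding sesq_mat_apply using Pu True by simp
    finally show ?thesis by simp
  next
    case False
    have "sesq n P u u = - complex_of_real (\<mu> * norm_sq n u)"
      unfolding sesq_mat_apply of_real_mult norm_sq_complex using Pu
      by (simp add: sum_distrib_left sum_negf mult_ac)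
    moreover have "0 \<le> sesq n P u u" using P unfolding psd_iff_sesq by blast
    ultimately have "\<mu> * norm_sq n u \<le> 0" by (simp add: less_eq_complex_def)
    then show ?thesis using False \<mu> norm_sq_nonneg[of n u]
      by (smt (verit) mult_pos_pos)
  qed
  then show ?thesis using x by (simp add: norm_sq_eq_0_iff u_def)
qed

lemma eq_spec_matI:
  assumes w: "onb n w" and P: "P \<in> carrier_mat n n"
    and ev: "\<And>j x. j < n \<Longrightarrow> x < n \<Longrightarrow> mat_apply n P (w j) x = f j * w j x"
  shows "P = spec_mat n w f"
proof (rule eq_matI)
  fix x y assume "x < dim_row (spec_mat n w f)" "y < dim_col (spec_mat n w f)"
  then have xy: "x < n" "y < n" by (auto simp: spec_mat_def)
  have "P $$ (x, y) = (\<Sum>z<n. if z = y then P $$ (x, z) else 0)" using xy by simp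
  also have "\<dots> = (\<Sum>z<n. P $$ (x, z) * (\<Sum>j<n. w j z * cnj (w j y)))"
    using w xy by (intro sum.cong) (auto simp: onb_def)
  also have "\<dots> = (\<Sum>z<n. \<Sum>j<n. P $$ (x, z) * w j z * cnj (w j y))"
    by (simp add: sum_distrib_left mult_ac)
  also have "\<dots> = (\<Sum>j<n. \<Sum>z<n. P $$ (x, z) * w j z * cnj (w j y))" by (rule sum.swap)
  also have "\<dots> = (\<Sum>j<n. mat_apply n P (w j) x * cnj (w j y))"
    by (simp add: mat_apply_def sum_distrib_right)
  also have "\<dots> = spec_mat n w f $$ (x, y)"
    using xy by (simp add: ev spec_mat_index mult_ac)
  finally show "P $$ (x, y) = spec_mat n w f $$ (x, y)" .
qed (use P in \<open>auto simp: spec_mat_def\<close>)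

text \<open>Every eigenvector of \<open>P * P\<close> is an eigenvector of \<open>P\<close> for the
  nonnegative root, so \<open>P\<close> is determined on the basis \<open>w\<close>. This settles
  the uniqueness in the definite description \<open>mat_abs\<close>.\<close>

lemma psd_sqrt_unique:
  assumes w: "onb n w" and f: "\<And>j. j < n \<Longrightarrow> 0 \<le> f j" and P: "psd n P"
    and sq: "P * P = spec_mat n w (\<lambda>j. (complex_of_real (f j))\<^sup>2)"
  shows "P = spec_mat n w (\<lambda>j. complex_of_real (f j))"
proof (rule eq_spec_matI[OF w])
  show Pc: "P \<in> carrier_mat n n" using P by (simp add: psd_def)
  fix j x assume j: "j < n" "x < n"
  show "mat_apply n P (w j) x = complex_of_real (f j) * w j x"
  proof (rule psd_sqrt_eigenvector[OF P f[OF j(1)] _ j(2)])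
    fix x assume "x < n"
    then show "mat_apply n P (mat_apply n P (w j)) x = (complex_of_real (f j))\<^sup>2 * w j x"
      using mat_apply_mult[OF Pc Pc, of x "w j"] j(1) by (simp add: sq mat_apply_spec_mat_onb[OF w])
  qed
qed

lemma trace_norm_spec_mat:
  assumes w: "onb n w"
  shows "trace_norm (spec_mat n w (\<lambda>j. complex_of_real (f j))) = (\<Sum>j<n. \<bar>f j\<bar>)"
proof -
  let ?X = "spec_mat n w (\<lambda>j. complex_of_real (f j))"
  let ?P = "spec_mat n w (\<lambda>j. complex_of_real \<bar>f j\<bar>)"
  have XX: "mat_adjoint ?X * ?X = spec_mat n w (\<lambda>j. (complex_of_real \<bar>f j\<bar>)\<^sup>2)"
    unfolding mat_adjoint_spec_mat spec_mat_mult[OF w]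
    by (simp add: power2_eq_square flip: of_real_mult)
  have PP: "?P * ?P = spec_mat n w (\<lambda>j. (complex_of_real \<bar>f j\<bar>)\<^sup>2)"
    unfolding spec_mat_mult[OF w] by (simp add: power2_eq_square)
  have "mat_abs ?X = ?P"
    unfolding mat_abs_def XX
  proof (rule the_equality)
    show "psd (dim_col ?X) ?P \<and> ?P * ?P = spec_mat n w (\<lambda>j. (complex_of_real \<bar>f j\<bar>)\<^sup>2)"
      using psd_spec_mat[of n "\<lambda>j. \<bar>f j\<bar>" w] PP by (simp add: spec_mat_def)
  next
    fix P assume "psd (dim_col ?X) P \<and> P * P = spec_mat n w (\<lambda>j. (complex_of_real \<bar>f j\<bar>)\<^sup>2)"
    moreover have "dim_col ?X = n" by (simp add: spec_mat_def)
    ultimately show "P = ?P" using psd_sqrt_unique[OF w, of "\<lambda>j. \<bar>f j\<bar>" P] by auto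
  qed
  moreover have "mat_trace ?P = (\<Sum>j<n. complex_of_real \<bar>f j\<bar>)"
  proof -
    have "mat_trace ?P = mat_trace (?P * 1\<^sub>m n)" by (simp add: right_mult_one_mat[of _ n n])
    also have "\<dots> = (\<Sum>j<n. complex_of_real \<bar>f j\<bar> * (\<Sum>x<n. cnj (w j x) * w j x))"
      by (subst mat_trace_mult_spec_mat) (auto simp: sesq_one)
    also have "\<dots> = (\<Sum>j<n. complex_of_real \<bar>f j\<bar>)" using w by (simp add: onb_def)
    finally show ?thesis .
  qed
  ultimately show ?thesis unfolding trace_norm_def by (simp flip: of_real_sum)
qed

section \<open>Spectral theorem for Hermitian matrices\<close>

text \<open>Completeness is automatic for n orthonormal vectors in dimension n, because a one-sided
  inverse of a square matrix is two-sided.\<close>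

lemma onbI:
  assumes "\<And>j k. j < n \<Longrightarrow> k < n \<Longrightarrow> (\<Sum>x<n. cnj (w j x) * w k x) = (if j = k then 1 else 0)"
  shows "onb n w"
proof -
  define W where "W = mat n n (\<lambda>(x, j). w j x)"
  define V where "V = mat n n (\<lambda>(j, x). cnj (w j x))"
  have c: "W \<in> carrier_mat n n" "V \<in> carrier_mat n n" by (auto simp: W_def V_def)
  have "V * W = 1\<^sub>m n"
  proof (rule eq_matI)
    fix j k assume "j < dim_row (1\<^sub>m n)" "k < dim_col (1\<^sub>m n)"
    then have jk: "j < n" "k < n" by auto
    have "(V * W) $$ (j, k) = (\<Sum>x<n. V $$ (j, x) * W $$ (x, k))"
      using c jk by (intro mat_mult_index)
    also have "\<dots> = 1\<^sub>m n $$ (j, k)" using assms jk by (simp add: V_def W_def)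
    finally show "(V * W) $$ (j, k) = 1\<^sub>m n $$ (j, k)" .
  qed (use c in auto)
  then have WV: "W * V = 1\<^sub>m n" by (rule mat_mult_left_right_inverse[OF c(2,1)])
  have "(\<Sum>j<n. w j x * cnj (w j y)) = (if x = y then 1 else 0)" if "x < n" "y < n" for x y
  proof -
    have "(\<Sum>j<n. w j x * cnj (w j y)) = (W * V) $$ (x, y)"
      using that by (subst mat_mult_index[OF c]) (auto simp: W_def V_def)
    then show ?thesis using WV that by simp
  qed
  then show ?thesis using assms unfolding onb_def by blast
qed

lemma onb_expand:
  assumes "onb n w" "x < n"
  shows "v x = (\<Sum>j<n. (\<Sum>y<n. cnj (w j y) * v y) * w j x)"
proof -
  have "mat_apply n (1\<^sub>m n) v x = (\<Sum>j<n. if j = x then v j else 0)"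
    unfolding mat_apply_def using assms by (intro sum.cong) auto
  then show ?thesis
    using mat_apply_spec_mat[OF assms(2), of w "\<lambda>_. 1" v] assms by (simp add: spec_mat_one)
qed

text \<open>The columns of the reflection \<open>1 - a a\<^sup>* / (1 - r)\<close> along \<open>a = u - e\<^sub>0\<close>. The sign of r keeps the
  denominator positive.\<close>

lemma householder:
  assumes u1: "norm_sq (Suc n) u = 1" and u0: "u 0 = complex_of_real r" "r \<le> 0"
  shows "\<exists>h. onb (Suc n) h \<and> h 0 = u"
proof -
  define a where "a = (\<lambda>x. u x - (if x = 0 then 1 else 0))"
  define s where "s = 1 / (1 - r)"
  define h where "h = (\<lambda>j x. (if x = j then 1 else 0) - complex_of_real s * a x * cnj (a j))"
  have s: "s * (1 - r) = 1" using u0 by (simp add: s_def)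
  have "r\<^sup>2 + (\<Sum>i<n. (cmod (u (Suc i)))\<^sup>2) = 1"
    using u1 u0 by (simp add: norm_sq_def sum.lessThan_Suc_shift del: sum.lessThan_Suc)
  moreover have "a 0 = complex_of_real (r - 1)" by (simp add: a_def u0)
  then have "norm_sq (Suc n) a = (r - 1)\<^sup>2 + (\<Sum>i<n. (cmod (u (Suc i)))\<^sup>2)"
    unfolding norm_sq_def by (simp add: sum.lessThan_Suc_shift a_def norm_of_real del: sum.lessThan_Suc of_real_diff)
  ultimately have na: "norm_sq (Suc n) a = 2 * (1 - r)" by (simp add: power2_eq_square algebra_simps)
  have orth: "(\<Sum>x<Suc n. cnj (h j x) * h k x) = (if j = k then 1 else 0)"
    if "j < Suc n" "k < Suc n" for j k
  proof -
    have "(\<Sum>x<Suc n. cnj (h j x) * h k x) =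
       (\<Sum>x<Suc n. (if x = j then if x = k then 1 else 0 else 0)
          - (if x = j then complex_of_real s * a x * cnj (a k) else 0)
          - (if x = k then complex_of_real s * cnj (a x) * a j else 0)
          + (complex_of_real s)\<^sup>2 * a j * cnj (a k) * (cnj (a x) * a x))"
      unfolding h_def by (intro sum.cong refl) (auto simp: algebra_simps power2_eq_square)
    also have "\<dots> = (if j = k then 1 else 0) - 2 * complex_of_real s * a j * cnj (a k)
       + (complex_of_real s)\<^sup>2 * a j * cnj (a k) * complex_of_real (norm_sq (Suc n) a)"
      unfolding norm_sq_complex sum.distrib sum_subtractf sum_distrib_left[symmetric]
      using that by (simp del: sum.lessThan_Suc)
    \<comment> \<open>Since |a|^2 = 2 (1 - r) and s (1 - r) = 1, the quadratic term cancels the two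
      linear ones.\<close>
    also have "(complex_of_real s)\<^sup>2 * a j * cnj (a k) * complex_of_real (norm_sq (Suc n) a) =
       complex_of_real (s * (1 - r)) * (2 * complex_of_real s * a j * cnj (a k))"
      unfolding na by (simp add: power2_eq_square)
    finally show ?thesis unfolding s by simp
  qed
  have "h 0 x = u x" for x
  proof -
    have "h 0 x = (if x = 0 then 1 else 0) + complex_of_real (s * (1 - r)) * a x"
      unfolding h_def by (simp add: a_def u0 algebra_simps)
    then show ?thesis unfolding s by (simp add: a_def)
  qed
  then show ?thesis using onbI[OF orth] by auto
qed

text \<open>The spectrum of a nonempty matrix is not empty; scaling and a phase then bring an
  eigenvector into the form from which \<open>householder\<close> builds a basis.\<close>

lemma eigenvector_normalized:
  assumes X: "X \<in> carrier_mat (Suc n) (Suc n)"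
  shows "\<exists>e u r. norm_sq (Suc n) u = 1 \<and> u 0 = complex_of_real r \<and> r \<le> 0 \<and>
    (\<forall>x<Suc n. mat_apply (Suc n) X u x = e * u x)"
proof -
  obtain e where "eigenvalue X e"
    using spectrum_non_empty[OF X] by (auto simp: spectrum_def)
  then obtain v where v: "v \<in> carrier_vec (Suc n)" "v \<noteq> 0\<^sub>v (Suc n)" "X *\<^sub>v v = e \<cdot>\<^sub>v v"
    using X by (auto simp: eigenvalue_def eigenvector_def)
  have ev: "mat_apply (Suc n) X (\<lambda>i. v $ i) x = e * v $ x" if "x < Suc n" for x
  proof -
    have "(X *\<^sub>v v) $ x = mat_apply (Suc n) X (\<lambda>i. v $ i) x"
      using X v(1) that by (simp add: scalar_prod_def mat_apply_def atLeast0LessThan del: sum.lessThan_Suc sum.op_ivl_Suc)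
    then show ?thesis using v that by simp
  qed
  define N where "N = norm_sq (Suc n) (\<lambda>i. v $ i)"
  have "N \<noteq> 0"
  proof
    assume "N = 0"
    then have "\<forall>i<Suc n. v $ i = 0" unfolding N_def norm_sq_eq_0_iff .
    then have "v = 0\<^sub>v (Suc n)" using v(1) by (intro eq_vecI) auto
    then show False using v(2) by simp
  qed
  then have N: "0 < N" using norm_sq_nonneg[of "Suc n" "\<lambda>i. v $ i"] by (simp add: N_def)
  \<comment> \<open>The phase turning the first coordinate into a nonpositive real; if that
    coordinate vanishes, any phase does.\<close>
  define t where "t = (if v $ 0 = 0 then 1 else - cnj (v $ 0) / complex_of_real (cmod (v $ 0)))"
  have t: "cmod t = 1" "t * v $ 0 = complex_of_real (- cmod (v $ 0))"
  proof -
    show "cmod t = 1" by (simp add: t_def norm_divide)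
    have "v $ 0 * cnj (v $ 0) = complex_of_real (cmod (v $ 0)) * complex_of_real (cmod (v $ 0))"
      by (simp add: complex_norm_square[symmetric] power2_eq_square[symmetric] flip: of_real_mult)
    then show "t * v $ 0 = complex_of_real (- cmod (v $ 0))" by (simp add: t_def mult.commute)
  qed
  define c where "c = t / complex_of_real (sqrt N)"
  have "norm_sq (Suc n) (\<lambda>i. c * v $ i) = 1"
    unfolding norm_sq_scale N_def[symmetric] using N t by (simp add: c_def norm_divide power_divide)
  moreover have "c * v $ 0 = complex_of_real (- cmod (v $ 0) / sqrt N)"
    using t(2) by (simp add: c_def mult.commute)
  moreover have "- cmod (v $ 0) / sqrt N \<le> 0" using N by simp
  moreover have "mat_apply (Suc n) X (\<lambda>i. c * v $ i) x = e * (c * v $ x)" if "x < Suc n" for x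
  proof -
    have "mat_apply (Suc n) X (\<lambda>i. c * v $ i) x = c * mat_apply (Suc n) X (\<lambda>i. v $ i) x"
      by (simp add: mat_apply_def sum_distrib_left mult_ac del: sum.lessThan_Suc)
    then show ?thesis using ev[OF that] by simp
  qed
  ultimately show ?thesis by blast
qed

lemma hermitian_sesq_cnj:
  assumes "\<And>i j. i < n \<Longrightarrow> j < n \<Longrightarrow> X $$ (i, j) = cnj (X $$ (j, i))"
  shows "sesq n X u v = cnj (sesq n X v u)"
proof -
  have "sesq n X u v = (\<Sum>i<n. \<Sum>j<n. cnj (u i) * cnj (X $$ (j, i)) * v j)"
    unfolding sesq_def by (intro sum.cong refl) (metis assms lessThan_iff)
  also have "\<dots> = (\<Sum>j<n. \<Sum>i<n. cnj (u i) * cnj (X $$ (j, i)) * v j)" by (rule sum.swap)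
  also have "\<dots> = cnj (sesq n X v u)" by (simp add: sesq_def mult_ac)
  finally show ?thesis .
qed

lemma mat_apply_sum_scale:
  "mat_apply n A (\<lambda>x. \<Sum>i\<in>I. c i * w i x) y = (\<Sum>i\<in>I. c i * mat_apply n A (w i) y)"
proof -
  have "mat_apply n A (\<lambda>x. \<Sum>i\<in>I. c i * w i x) y = (\<Sum>x<n. \<Sum>i\<in>I. c i * (A $$ (y, x) * w i x))"
    by (simp add: mat_apply_def sum_distrib_left mult_ac)
  also have "\<dots> = (\<Sum>i\<in>I. \<Sum>x<n. c i * (A $$ (y, x) * w i x))" by (rule sum.swap)
  finally show ?thesis by (simp add: mat_apply_def sum_distrib_left)
qed

text \<open>Deflation: a unit eigenvector is completed to a basis by a Householder reflection, and
  the compression of \<open>X\<close> to its orthogonal complement, of dimension one less, is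
  diagonalized by induction.\<close>

theorem hermitian_spectral:
  assumes "X \<in> carrier_mat n n" "\<And>i j. i < n \<Longrightarrow> j < n \<Longrightarrow> X $$ (i, j) = cnj (X $$ (j, i))"
  shows "\<exists>w f. onb n w \<and> X = spec_mat n w (\<lambda>j. complex_of_real (f j))"
  using assms
proof (induction n arbitrary: X)
  case 0
  then show ?case by (auto simp: onb_def spec_mat_def intro!: eq_matI)
next
  case (Suc n)
  let ?N = "Suc n"
  note [simp del] = sum.lessThan_Suc
  obtain e u r where u: "norm_sq ?N u = 1" "u 0 = complex_of_real r" "r \<le> 0"
    and Xu: "\<And>x. x < ?N \<Longrightarrow> mat_apply ?N X u x = e * u x"
    using eigenvector_normalized[OF Suc.prems(1)] by blast
  obtain h where h: "onb ?N h" "h 0 = u" using householder[OF u] by blast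
  have hh: "(\<Sum>x<?N. cnj (h j x) * h k x) = (if j = k then 1 else 0)" if "j < ?N" "k < ?N" for j k
    using h(1) that by (simp add: onb_def)
  have cnj_sesq: "sesq ?N X u v = cnj (sesq ?N X v u)" for u v
    by (rule hermitian_sesq_cnj) (rule Suc.prems(2))
  have sesq_u: "sesq ?N X v u = e * (\<Sum>x<?N. cnj (v x) * u x)" for v
    unfolding sesq_mat_apply using Xu by (simp add: sum_distrib_left mult_ac)
  have "e = sesq ?N X u u"
    unfolding sesq_u norm_sq_complex[symmetric] u by simp
  then have "cnj e = e" using cnj_sesq[of u u] by simp
  then have e: "e = complex_of_real (Re e)" by (simp add: complex_eq_iff)
  define Y where "Y = mat n n (\<lambda>(i, j). sesq ?N X (h (Suc i)) (h (Suc j)))"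
  have "Y $$ (i, j) = cnj (Y $$ (j, i))" if "i < n" "j < n" for i j
    using that cnj_sesq[of "h (Suc i)" "h (Suc j)"] by (simp add: Y_def)
  from Suc.IH[OF _ this] obtain y f where y: "onb n y" and Y: "Y = spec_mat n y (\<lambda>j. complex_of_real (f j))"
    by (auto simp: Y_def)
  \<comment> \<open>The complement of the eigenvector is invariant: <u, X h> is the conjugate of <h,
    X u> = e <h, u> = 0. So \<open>Y\<close> carries all of \<open>X\<close> on it.\<close>
  have Xh: "mat_apply ?N X (h (Suc j)) x = (\<Sum>i<n. Y $$ (i, j) * h (Suc i) x)" if "j < n" "x < ?N" for j x
  proof -
    have "sesq ?N X (h 0) (h (Suc j)) = cnj (sesq ?N X (h (Suc j)) u)" unfolding h(2) by (rule cnj_sesq)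
    also have "\<dots> = 0" using hh[of "Suc j" 0] that unfolding sesq_u h(2) by simp
    finally have "sesq ?N X (h 0) (h (Suc j)) = 0" .
    moreover have "mat_apply ?N X (h (Suc j)) x = (\<Sum>i<?N. sesq ?N X (h i) (h (Suc j)) * h i x)"
      using onb_expand[OF h(1) that(2), of "mat_apply ?N X (h (Suc j))"] by (simp add: sesq_mat_apply)
    ultimately show ?thesis
      using that by (simp add: sum.lessThan_Suc_shift Y_def)
  qed
  \<comment> \<open>The eigenvectors of \<open>Y\<close> are coordinate vectors with respect to
    \<open>h 1, ..., h n\<close> and are carried back to the full space.\<close>
  define w where "w = (\<lambda>k. case k of 0 \<Rightarrow> u | Suc j \<Rightarrow> (\<lambda>x. \<Sum>i<n. y j i * h (Suc i) x))"
  define g where "g = (\<lambda>k. case k of 0 \<Rightarrow> Re e | Suc j \<Rightarrow> f j)"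
  have ev: "mat_apply ?N X (w k) x = complex_of_real (g k) * w k x" if k: "k < ?N" and x: "x < ?N" for k x
  proof (cases k)
    case 0
    then show ?thesis using Xu[OF x] e by (simp add: w_def g_def)
  next
    case (Suc j)
    then have j: "j < n" using k by simp
    have "mat_apply ?N X (w k) x = (\<Sum>i<n. y j i * (\<Sum>l<n. Y $$ (l, i) * h (Suc l) x))"
      unfolding Suc w_def nat.case mat_apply_sum_scale by (intro sum.cong refl) (simp add: Xh x)
    also have "\<dots> = (\<Sum>i<n. \<Sum>l<n. Y $$ (l, i) * y j i * h (Suc l) x)"
      by (simp add: sum_distrib_left mult_ac)
    also have "\<dots> = (\<Sum>l<n. \<Sum>i<n. Y $$ (l, i) * y j i * h (Suc l) x)" by (rule sum.swap)
    also have "\<dots> = (\<Sum>l<n. mat_apply n Y (y j) l * h (Suc l) x)"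
      by (simp add: mat_apply_def sum_distrib_right)
    also have "\<dots> = complex_of_real (f j) * (\<Sum>l<n. y j l * h (Suc l) x)"
      unfolding Y using j by (simp add: mat_apply_spec_mat_onb[OF y] sum_distrib_left mult_ac)
    finally show ?thesis by (simp add: Suc w_def g_def)
  qed
  have h_w: "(\<Sum>x<?N. cnj (h i x) * w (Suc k) x) = (case i of 0 \<Rightarrow> 0 | Suc l \<Rightarrow> y k l)"
    if "k < n" "i < ?N" for i k
  proof -
    have "(\<Sum>x<?N. cnj (h i x) * w (Suc k) x) = (\<Sum>x<?N. \<Sum>l<n. y k l * (cnj (h i x) * h (Suc l) x))"
      by (simp add: w_def sum_distrib_left mult_ac)
    also have "\<dots> = (\<Sum>l<n. \<Sum>x<?N. y k l * (cnj (h i x) * h (Suc l) x))" by (rule sum.swap)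
    also have "\<dots> = (\<Sum>l<n. if i = Suc l then y k l else 0)"
      using that by (intro sum.cong refl) (simp add: sum_distrib_left[symmetric] hh)
    also have "\<dots> = (case i of 0 \<Rightarrow> 0 | Suc l \<Rightarrow> y k l)"
      using that by (cases i) auto
    finally show ?thesis .
  qed
  have w_w: "(\<Sum>x<?N. cnj (w (Suc j) x) * v x) = (\<Sum>i<n. cnj (y j i) * (\<Sum>x<?N. cnj (h (Suc i) x) * v x))" for j v
  proof -
    have "(\<Sum>x<?N. cnj (w (Suc j) x) * v x) = (\<Sum>x<?N. \<Sum>i<n. cnj (y j i) * (cnj (h (Suc i) x) * v x))"
      by (simp add: w_def sum_distrib_left sum_distrib_right mult_ac)
    also have "\<dots> = (\<Sum>i<n. \<Sum>x<?N. cnj (y j i) * (cnj (h (Suc i) x) * v x))" by (rule sum.swap)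
    finally show ?thesis by (simp add: sum_distrib_left)
  qed
  have "onb ?N w"
  proof (rule onbI)
    fix j k assume "j < ?N" "k < ?N"
    moreover have "w 0 = h 0" by (simp add: w_def h)
    ultimately show "(\<Sum>x<?N. cnj (w j x) * w k x) = (if j = k then 1 else 0)"
    proof (cases j; cases k)
      fix j' k' assume jk: "j = Suc j'" "k = Suc k'" and "j < ?N" "k < ?N"
      then have "j' < n" "k' < n" by auto
      then have "(\<Sum>x<?N. cnj (w j x) * w k x) = (\<Sum>i<n. cnj (y j' i) * y k' i)"
        unfolding jk w_w by (intro sum.cong refl) (simp add: h_w)
      then show ?thesis using y \<open>j' < n\<close> \<open>k' < n\<close> jk by (simp add: onb_def)
    next
      fix j' assume "j = Suc j'" "k = 0" "j < ?N" "w 0 = h 0"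
      then show ?thesis by (simp add: w_w hh)
    next
      fix k' assume "j = 0" "k = Suc k'" "k < ?N" "w 0 = h 0"
      then show ?thesis using h_w[of k' 0] by simp
    qed (simp add: hh)
  qed
  moreover from this have "X = spec_mat ?N w (\<lambda>j. complex_of_real (g j))"
    by (rule eq_spec_matI[OF _ Suc.prems(1)]) (rule ev)
  ultimately show ?case by blast
qed

section \<open>Duality between trace norm and operator norm\<close>

lemma hermitian_index:
  assumes "X \<in> carrier_mat n n" "mat_adjoint X = X" "i < n" "j < n"
  shows "X $$ (i, j) = cnj (X $$ (j, i))"
  using mat_adjoint_index[OF assms(1,3,4)] assms(2) by simp

text \<open>The maximizer is the sign of \<open>X\<close> in the functional calculus; eigenvalue 0
  on the kernel does no harm, as only a contraction is required.\<close>

lemma trace_norm_attained: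
  assumes "X \<in> carrier_mat n n" "mat_adjoint X = X"
  shows "\<exists>V. op_bounded n 1 V \<and> mat_trace (X * V) = complex_of_real (trace_norm X)"
proof -
  obtain w f where w: "onb n w" and X: "X = spec_mat n w (\<lambda>j. complex_of_real (f j))"
    using hermitian_spectral[OF assms(1)] hermitian_index[OF assms] by metis
  let ?V = "spec_mat n w (\<lambda>j. complex_of_real (sgn (f j)))"
  have "op_bounded n 1 ?V" by (rule op_bounded_spec_mat[OF w]) (simp add: sgn_if)
  moreover have "mat_trace (X * ?V) = complex_of_real (trace_norm X)"
  proof -
    have "mat_trace (X * ?V) = (\<Sum>j<n. complex_of_real (f j) * sesq n ?V (w j) (w j))"
      unfolding X by (rule mat_trace_mult_spec_mat) simp
    also have "\<dots> = (\<Sum>j<n. complex_of_real \<bar>f j\<bar>)"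
    proof (intro sum.cong refl)
      fix j assume "j \<in> {..<n}"
      then have "sesq n ?V (w j) (w j) = complex_of_real (sgn (f j)) * (\<Sum>x<n. cnj (w j x) * w j x)"
        unfolding sesq_mat_apply by (simp add: mat_apply_spec_mat_onb[OF w] sum_distrib_left mult_ac)
      also have "\<dots> = complex_of_real (sgn (f j))" using w \<open>j \<in> {..<n}\<close> by (simp add: onb_def)
      finally show "complex_of_real (f j) * sesq n ?V (w j) (w j) = complex_of_real \<bar>f j\<bar>"
        by (simp add: abs_sgn flip: of_real_mult)
    qed
    also have "\<dots> = complex_of_real (trace_norm X)" unfolding X trace_norm_spec_mat[OF w] by simp
    finally show ?thesis .
  qed
  ultimately show ?thesis by blast
qed

text \<open>In an eigenbasis of \<open>Z\<close> the trace sees only the diagonal entries of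
  \<open>G\<close>, weighted by the eigenvalues.\<close>

lemma trace_norm_bound:
  assumes "Z \<in> carrier_mat n n" "mat_adjoint Z = Z" and G: "op_bounded n c G"
  shows "Re (mat_trace (Z * G)) \<le> c * trace_norm Z"
proof -
  obtain w f where w: "onb n w" and Z: "Z = spec_mat n w (\<lambda>j. complex_of_real (f j))"
    using hermitian_spectral[OF assms(1)] hermitian_index[OF assms(1,2)] by metis
  have "mat_trace (Z * G) = (\<Sum>j<n. complex_of_real (f j) * sesq n G (w j) (w j))"
    unfolding Z using G by (intro mat_trace_mult_spec_mat) (simp add: op_bounded_def)
  then have "Re (mat_trace (Z * G)) = (\<Sum>j<n. f j * Re (sesq n G (w j) (w j)))" by simp
  also have "\<dots> \<le> (\<Sum>j<n. c * \<bar>f j\<bar>)"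
  proof (intro sum_mono)
    fix j assume j: "j \<in> {..<n}"
    have "complex_of_real (norm_sq n (w j)) = 1"
      unfolding norm_sq_complex using w j by (simp add: onb_def)
    then have nw: "norm_sq n (w j) = 1" by simp
    \<comment> \<open>The bound on \<open>G\<close> is one-sided. Putting the sign of the eigenvalue
      into the left vector selects the side that is needed.\<close>
    define s where "s = (if f j < 0 then -1 else 1 :: complex)"
    have "2 * Re (sesq n G (\<lambda>x. s * w j x) (w j)) \<le> c * (norm_sq n (\<lambda>x. s * w j x) + norm_sq n (w j))"
      using G unfolding op_bounded_def by blast
    moreover have "cmod s = 1" by (simp add: s_def)
    ultimately have "2 * Re (cnj s * sesq n G (w j) (w j)) \<le> c * 2"
      unfolding norm_sq_scale sesq_scale_left nw by (simp only: power_one mult_1 one_add_one)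
    then have "Re (cnj s * sesq n G (w j) (w j)) \<le> c" by linarith
    then have "\<bar>f j\<bar> * Re (cnj s * sesq n G (w j) (w j)) \<le> \<bar>f j\<bar> * c" by (intro mult_left_mono) auto
    then show "f j * Re (sesq n G (w j) (w j)) \<le> c * \<bar>f j\<bar>"
      by (cases "f j < 0") (simp_all add: s_def mult.commute)
  qed
  also have "\<dots> = c * trace_norm Z" unfolding Z trace_norm_spec_mat[OF w] by (simp add: sum_distrib_left)
  finally show ?thesis .
qed


section \<open>Contractions under unital completely positive maps\<close>

lemma sum_lessThan_add:
  "(\<Sum>i<m + k. g i) = (\<Sum>i<m. g i) + (\<Sum>i<k. g (m + i :: nat) :: 'a :: comm_monoid_add)"
  by (induction k) (auto simp: algebra_simps)

lemma sum_lessThan_mult: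
  "(\<Sum>i<r * n. g i) = (\<Sum>a<r. \<Sum>b<n. g (a * n + b :: nat) :: 'a :: comm_monoid_add)"
proof (induction r)
  case (Suc r)
  then show ?case using sum_lessThan_add[of g "r * n" n] by (simp add: add.commute[of n])
qed simp

lemma mult_add_less: "a < r \<Longrightarrow> b < n \<Longrightarrow> a * n + b < r * (n::nat)"
  by (metis add.commute div_less_iff_less_mult div_mult_self3 div_less add_cancel_left_right less_nat_zero_code not_gr_zero)

lemma tensor_block_carrier [simp]: "tensor_block n X a a' \<in> carrier_mat n n"
  by (simp add: tensor_block_def)

lemma tensor_block_index [simp]:
  "b < n \<Longrightarrow> b' < n \<Longrightarrow> tensor_block n X a a' $$ (b, b') = X $$ (a * n + b, a' * n + b')"
  by (simp add: tensor_block_def)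

lemma id_tensor_carrier [simp]: "id_tensor r n l F X \<in> carrier_mat (r * l) (r * l)"
  by (simp add: id_tensor_def)

lemma id_tensor_index:
  "a < r \<Longrightarrow> a' < r \<Longrightarrow> b < l \<Longrightarrow> b' < l \<Longrightarrow>
   id_tensor r n l F X $$ (a * l + b, a' * l + b') = F (tensor_block n X a a') $$ (b, b')"
  by (simp add: id_tensor_def mult_add_less)

lemma tensor_eqI:
  assumes "A \<in> carrier_mat (r * n) (r * n)" "B \<in> carrier_mat (r * n) (r * n)"
    and "\<And>a a' b b'. a < r \<Longrightarrow> a' < r \<Longrightarrow> b < n \<Longrightarrow> b' < n \<Longrightarrow>
           A $$ (a * n + b, a' * n + b') = B $$ (a * n + b, a' * n + b')"
  shows "A = B"
proof (rule eq_matI)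
  fix i j assume "i < dim_row B" "j < dim_col B"
  then have ij: "i < r * n" "j < r * n" using assms(2) by auto
  then have "0 < n" by (cases n) auto
  then have "A $$ ((i div n) * n + i mod n, (j div n) * n + j mod n) =
      B $$ ((i div n) * n + i mod n, (j div n) * n + j mod n)"
    using ij by (intro assms(3)) (auto simp: less_mult_imp_div_less)
  then show "A $$ (i, j) = B $$ (i, j)" by simp
qed (use assms in auto)

lemma tensor_block_id_tensor:
  assumes "a < r" "a' < r" "F (tensor_block n X a a') \<in> carrier_mat l l"
  shows "tensor_block l (id_tensor r n l F X) a a' = F (tensor_block n X a a')"
  using assms by (intro eq_matI) (auto simp: id_tensor_index carrier_matD[OF tensor_block_carrier])

lemma sesq_tensor:
  "sesq (r * n) X u v =
    (\<Sum>a<r. \<Sum>a'<r. sesq n (tensor_block n X a a') (\<lambda>b. u (a * n + b)) (\<lambda>b. v (a' * n + b)))"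
proof -
  have "sesq (r * n) X u v = (\<Sum>a<r. \<Sum>b<n. \<Sum>a'<r. \<Sum>b'<n.
     cnj (u (a * n + b)) * X $$ (a * n + b, a' * n + b') * v (a' * n + b'))"
    unfolding sesq_def sum_lessThan_mult ..
  also have "\<dots> = (\<Sum>a<r. \<Sum>a'<r. \<Sum>b<n. \<Sum>b'<n.
     cnj (u (a * n + b)) * X $$ (a * n + b, a' * n + b') * v (a' * n + b'))"
    by (intro sum.cong refl sum.swap)
  finally show ?thesis by (simp add: sesq_def)
qed

lemma sesq_four_block:
  assumes "A \<in> carrier_mat m m" "B \<in> carrier_mat m m" "C \<in> carrier_mat m m" "D \<in> carrier_mat m m"
  shows "sesq (m + m) (four_block_mat A B C D) u v =
    sesq m A u v + sesq m B u (\<lambda>i. v (m + i)) +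
    (sesq m C (\<lambda>i. u (m + i)) v + sesq m D (\<lambda>i. u (m + i)) (\<lambda>i. v (m + i)))"
  using assms unfolding sesq_def by (simp add: sum_lessThan_add sum.distrib)

text \<open>The first factor is the slow index, so a two by two block matrix over
  \<open>r * n\<close> is already an operator with first factor of dimension \<open>r + r\<close>,
  without any permutation. Its quadrants are unions of tensor blocks, and the amplification acts on
  them separately.\<close>

lemma id_tensor_four_block:
  assumes c: "A \<in> carrier_mat (r * n) (r * n)" "B \<in> carrier_mat (r * n) (r * n)"
    "C \<in> carrier_mat (r * n) (r * n)" "D \<in> carrier_mat (r * n) (r * n)"
  shows "id_tensor (r + r) n n F (four_block_mat A B C D) =
    four_block_mat (id_tensor r n n F A) (id_tensor r n n F B) (id_tensor r n n F C) (id_tensor r n n F D)"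
    (is "?L = ?R")
proof (rule tensor_eqI[of _ "r + r" n])
  show "?R \<in> carrier_mat ((r + r) * n) ((r + r) * n)"
    unfolding add_mult_distrib by (intro four_block_carrier_mat id_tensor_carrier)
  \<comment> \<open>The half containing the index \<open>x * n + y\<close> depends on
    \<open>x\<close> alone, and within the second half the tensor index is
    \<open>x - r\<close>.\<close>
  have split: "x * n + y < r * n + r * n \<and>
     (if x < r then x * n + y < r * n else \<not> x * n + y < r * n \<and> x * n + y - r * n = (x - r) * n + y \<and> x - r < r)"
    if "x < r + r" "y < n" for x y
  proof (cases "x < r")
    case True
    then show ?thesis using mult_add_less[OF True that(2)] by simp
  next
    case False
    then have le: "r * n \<le> x * n" by simp
    then have "\<not> x * n + y < r * n" "x * n + y - r * n = (x - r) * n + y"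
      unfolding diff_mult_distrib by linarith+
    then show ?thesis using False that mult_add_less[OF that] by (simp add: add_mult_distrib less_diff_conv2)
  qed
  have blk: "tensor_block n (four_block_mat A B C D) a a' =
      (if a < r then if a' < r then tensor_block n A a a' else tensor_block n B a (a' - r)
       else if a' < r then tensor_block n C (a - r) a' else tensor_block n D (a - r) (a' - r))"
    if "a < r + r" "a' < r + r" for a a'
  proof (rule eq_matI)
    fix b b' assume "b < dim_row (if a < r then if a' < r then tensor_block n A a a' else tensor_block n B a (a' - r)
       else if a' < r then tensor_block n C (a - r) a' else tensor_block n D (a - r) (a' - r))"
      "b' < dim_col (if a < r then if a' < r then tensor_block n A a a' else tensor_block n B a (a' - r)
       else if a' < r then tensor_block n C (a - r) a' else tensor_block n D (a - r) (a' - r))"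
    then have b: "b < n" "b' < n" by (auto simp: tensor_block_def split: if_splits)
    show "tensor_block n (four_block_mat A B C D) a a' $$ (b, b') =
      (if a < r then if a' < r then tensor_block n A a a' else tensor_block n B a (a' - r)
       else if a' < r then tensor_block n C (a - r) a' else tensor_block n D (a - r) (a' - r)) $$ (b, b')"
      using b c split[OF that(1) b(1)] split[OF that(2) b(2)] by (auto split: if_splits)
  qed (auto simp: tensor_block_def)
  fix a a' b b' assume ab: "a < r + r" "a' < r + r" "b < n" "b' < n"
  show "?L $$ (a * n + b, a' * n + b') = ?R $$ (a * n + b, a' * n + b')"
    unfolding id_tensor_index[OF ab] blk[OF ab(1,2)]
    using split[OF ab(1,3)] split[OF ab(2,4)] ab
    by (auto simp: id_tensor_index carrier_matD[OF id_tensor_carrier] split: if_splits)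
qed simp

lemma linear_superop_zero:
  assumes "linear_superop n F"
  shows "F (0\<^sub>m n n) = 0\<^sub>m n n"
proof -
  have F: "F (0\<^sub>m n n) \<in> carrier_mat n n" using assms by (simp add: linear_superop_def)
  have "F (0\<^sub>m n n) = F (0 \<cdot>\<^sub>m 0\<^sub>m n n)" by (intro arg_cong[of _ _ F] eq_matI) auto
  also have "\<dots> = 0 \<cdot>\<^sub>m F (0\<^sub>m n n)" using assms unfolding linear_superop_def by (metis zero_carrier_mat)
  also have "\<dots> = 0\<^sub>m n n" using F by (intro eq_matI) auto
  finally show ?thesis .
qed

lemma heisenberg_channel_linear: "heisenberg_channel n \<Phi> \<Longrightarrow> linear_superop n \<Phi>"
  by (simp add: heisenberg_channel_def completely_positive_def)

lemma id_tensor_scalar: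
  assumes "heisenberg_channel n \<Phi>"
  shows "id_tensor r n n \<Phi> (c \<cdot>\<^sub>m 1\<^sub>m (r * n)) = c \<cdot>\<^sub>m 1\<^sub>m (r * n)"
proof (rule tensor_eqI)
  have lin: "linear_superop n \<Phi>" using assms by (rule heisenberg_channel_linear)
  fix a a' b b' assume ab: "a < r" "a' < r" "b < n" "b' < n"
  have inj: "a * n + x = a' * n + y \<longleftrightarrow> a = a' \<and> x = y" if "x < n" "y < n" for x y
  proof
    assume "a * n + x = a' * n + y"
    then have "(a * n + x) div n = (a' * n + y) div n" "(a * n + x) mod n = (a' * n + y) mod n" by simp_all
    then show "a = a' \<and> x = y" using that by simp
  qed simp
  have "tensor_block n (c \<cdot>\<^sub>m 1\<^sub>m (r * n)) a a' = (if a = a' then c \<cdot>\<^sub>m 1\<^sub>m n else 0\<^sub>m n n)"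
    using ab by (intro eq_matI) (auto simp: tensor_block_def mult_add_less inj)
  moreover have "\<Phi> (c \<cdot>\<^sub>m 1\<^sub>m n) = c \<cdot>\<^sub>m 1\<^sub>m n"
    using lin assms unfolding linear_superop_def heisenberg_channel_def by (metis one_carrier_mat)
  ultimately show "id_tensor r n n \<Phi> (c \<cdot>\<^sub>m 1\<^sub>m (r * n)) $$ (a * n + b, a' * n + b') =
      (c \<cdot>\<^sub>m 1\<^sub>m (r * n)) $$ (a * n + b, a' * n + b')"
    unfolding id_tensor_index[OF ab] using ab inj linear_superop_zero[OF lin] by (simp add: mult_add_less)
qed auto

lemma sesq_adjoint:
  assumes "X \<in> carrier_mat n n"
  shows "sesq n (mat_adjoint X) u v = cnj (sesq n X v u)"
proof -
  have "sesq n (mat_adjoint X) u v = (\<Sum>i<n. \<Sum>j<n. cnj (u i) * cnj (X $$ (j, i)) * v j)"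
    unfolding sesq_def by (intro sum.cong refl) (auto simp: mat_adjoint_index[OF assms])
  also have "\<dots> = (\<Sum>j<n. \<Sum>i<n. cnj (u i) * cnj (X $$ (j, i)) * v j)" by (rule sum.swap)
  also have "\<dots> = cnj (sesq n X v u)" by (simp add: sesq_def mult_ac)
  finally show ?thesis .
qed

lemma sesq_scalar:
  "sesq n (complex_of_real c \<cdot>\<^sub>m 1\<^sub>m n) u u = complex_of_real (c * norm_sq n u)"
proof -
  have "sesq n (complex_of_real c \<cdot>\<^sub>m 1\<^sub>m n) u u = complex_of_real c * sesq n (1\<^sub>m n) u u"
    unfolding sesq_def by (auto simp: sum_distrib_left mult_ac intro!: sum.cong)
  then show ?thesis by (simp add: sesq_one norm_sq_complex)
qed

text \<open>X is bounded by c exactly when the block matrix with diagonal \<open>c 1\<close> and off-diagonal blocks X and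
  \<open>X\<^sup>*\<close> is positive, and the channel, amplified by one more qubit, preserves this positivity.\<close>

lemma id_tensor_op_bounded:
  assumes ch: "heisenberg_channel n \<Phi>" and X: "op_bounded (r * n) c X"
  shows "op_bounded (r * n) c (id_tensor r n n \<Phi> X)"
  unfolding op_bounded_def
proof (intro conjI allI)
  let ?m = "r * n" and ?R = "id_tensor r n n \<Phi> X" and ?S = "id_tensor r n n \<Phi> (mat_adjoint X)"
  let ?c = "complex_of_real c \<cdot>\<^sub>m 1\<^sub>m ?m"
  have Xc: "X \<in> carrier_mat ?m ?m" using X by (simp add: op_bounded_def)
  note Xa = mat_adjoint_dim[OF Xc]
  have cc: "?c \<in> carrier_mat ?m ?m" by simp
  let ?B = "four_block_mat ?c X (mat_adjoint X) ?c"
  have "psd (?m + ?m) ?B"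
    unfolding psd_iff_sesq
  proof (intro conjI allI)
    fix w :: "nat \<Rightarrow> complex"
    define v where "v = (\<lambda>i. w (?m + i))"
    define q where "q = sesq ?m X w v"
    \<comment> \<open>The hypothesis bounds the real part from above, positivity of the block matrix
      needs it from below; hence the sign in the first argument.\<close>
    have "2 * Re (sesq ?m X (\<lambda>i. (-1) * w i) v) \<le> c * (norm_sq ?m (\<lambda>i. (-1) * w i) + norm_sq ?m v)"
      using X unfolding op_bounded_def by blast
    then have le: "0 \<le> c * (norm_sq ?m w + norm_sq ?m v) + 2 * Re q"
      unfolding sesq_scale_left norm_sq_scale by (simp add: q_def)
    have "sesq (?m + ?m) ?B w w = complex_of_real (c * norm_sq ?m w) + q +
        (cnj q + complex_of_real (c * norm_sq ?m v))"
      unfolding sesq_four_block[OF cc Xc Xa cc] sesq_adjoint[OF Xc] sesq_scalar v_def[symmetric]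
      by (simp add: q_def)
    then show "0 \<le> sesq (?m + ?m) ?B w w" using le by (simp add: less_eq_complex_def algebra_simps)
  qed (use Xc Xa in auto)
  then have "psd ((r + r) * n) (id_tensor (r + r) n n \<Phi> ?B)"
    using ch unfolding heisenberg_channel_def completely_positive_def add_mult_distrib[symmetric] by blast
  then have P: "psd (?m + ?m) (four_block_mat ?c ?R ?S ?c)"
    unfolding id_tensor_four_block[OF cc Xc Xa cc] id_tensor_scalar[OF ch]
    by (simp add: add_mult_distrib)
  fix u v :: "nat \<Rightarrow> complex"
  \<comment> \<open>Vectors supported in one half each isolate the off-diagonal blocks. Hermitian
    symmetry of the positive matrix then identifies \<open>?S\<close> as the adjoint of
    \<open>?R\<close>, which saves a separate proof that the channel commutes with adjoints.\<close>
  define w1 where "w1 = (\<lambda>i. if i < ?m then - u i else 0)"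
  define w2 where "w2 = (\<lambda>i. if i < ?m then 0 else v (i - ?m))"
  define w where "w = (\<lambda>i. if i < ?m then - u i else v (i - ?m))"
  note four = sesq_four_block[OF cc id_tensor_carrier id_tensor_carrier cc]
  define q where "q = sesq ?m ?R u v"
  have "sesq (?m + ?m) (four_block_mat ?c ?R ?S ?c) w1 w2 = sesq ?m ?R (\<lambda>i. (-1) * u i) v"
    unfolding four by (simp add: w1_def w2_def sesq_def)
  then have q1: "sesq (?m + ?m) (four_block_mat ?c ?R ?S ?c) w1 w2 = - q"
    unfolding sesq_scale_left q_def by simp
  have "sesq (?m + ?m) (four_block_mat ?c ?R ?S ?c) w2 w1 = sesq ?m ?S v (\<lambda>i. (-1) * u i)"
    unfolding four by (simp add: w1_def w2_def sesq_def)
  then have q2: "sesq ?m ?S v (\<lambda>i. (-1) * u i) = - cnj q"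
    using psd_sesq_cnj[OF P, of w2 w1] q1 by simp
  have "sesq (?m + ?m) (four_block_mat ?c ?R ?S ?c) w w =
     sesq ?m ?c (\<lambda>i. (-1) * u i) (\<lambda>i. (-1) * u i) + sesq ?m ?R (\<lambda>i. (-1) * u i) v +
     (sesq ?m ?S v (\<lambda>i. (-1) * u i) + sesq ?m ?c v v)"
    unfolding four by (intro arg_cong2[of _ _ _ _ "(+)"] sesq_cong) (auto simp: w_def)
  then have "sesq (?m + ?m) (four_block_mat ?c ?R ?S ?c) w w =
     complex_of_real (c * norm_sq ?m u) - q + (- cnj q + complex_of_real (c * norm_sq ?m v))"
    unfolding q2 sesq_scalar norm_sq_scale sesq_scale_left[of _ ?R] by (simp add: q_def)
  moreover have "0 \<le> sesq (?m + ?m) (four_block_mat ?c ?R ?S ?c) w w"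
    using P unfolding psd_iff_sesq by blast
  ultimately have "0 \<le> complex_of_real (c * norm_sq ?m u) - q + (- cnj q + complex_of_real (c * norm_sq ?m v))"
    by simp
  then show "2 * Re (sesq ?m ?R u v) \<le> c * (norm_sq ?m u + norm_sq ?m v)"
    by (simp add: less_eq_complex_def q_def algebra_simps)
qed simp

lemma linear_superop_comp:
  "linear_superop n F \<Longrightarrow> linear_superop n G \<Longrightarrow> linear_superop n (\<lambda>X. F (G X))"
  by (auto simp: linear_superop_def)

lemma heisenberg_channel_funpow:
  assumes "heisenberg_channel n \<Phi>"
  shows "heisenberg_channel n (\<Phi> ^^ t)"
proof (induction t)
  case 0
  have "id_tensor r n n (\<lambda>a. a) X = X" if "psd (r * n) X" for r X
    using that by (intro tensor_eqI[of _ r n]) (auto simp: id_tensor_index psd_def)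
  then show ?case by (auto simp: heisenberg_channel_def completely_positive_def linear_superop_def)
next
  case (Suc t)
  have lin: "linear_superop n (\<Phi> ^^ t)" by (rule heisenberg_channel_linear[OF Suc])
  have "id_tensor r n n (\<lambda>X. \<Phi> ((\<Phi> ^^ t) X)) X = id_tensor r n n \<Phi> (id_tensor r n n (\<Phi> ^^ t) X)" for r X
    using lin by (intro tensor_eqI[of _ r n])
      (auto simp: id_tensor_index tensor_block_id_tensor linear_superop_def)
  then show ?case
    using assms Suc linear_superop_comp[OF heisenberg_channel_linear[OF assms] lin]
    by (simp add: heisenberg_channel_def completely_positive_def)
qed


section \<open>The mean ergodic limit\<close>

lemma op_bounded_entry:
  assumes "op_bounded n c X" "i < n" "j < n"
  shows "cmod (X $$ (i, j)) \<le> c"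
proof -
  define z where "z = X $$ (i, j)"
  define t where "t = (if z = 0 then 1 else z / complex_of_real (cmod z))"
  have t: "cmod t = 1" by (simp add: t_def norm_divide)
  have tz: "cnj t * z = complex_of_real (cmod z)"
  proof (cases "z = 0")
    case False
    have "cnj z * z = complex_of_real (cmod z) * complex_of_real (cmod z)"
      using complex_norm_square[of z] by (simp add: power2_eq_square mult.commute)
    then show ?thesis using False by (simp add: t_def)
  qed (simp add: t_def)
  let ?e = "\<lambda>i x. if x = i then 1 else 0 :: complex"
  have n1: "norm_sq n (?e k) = 1" if "k < n" for k
  proof -
    have "norm_sq n (?e k) = (\<Sum>x<n. if x = k then 1 else 0)"
      unfolding norm_sq_def by (intro sum.cong) auto
    then show ?thesis using that by simp
  qed
  have "2 * Re (sesq n X (\<lambda>x. t * ?e i x) (?e j)) \<le> c * (norm_sq n (\<lambda>x. t * ?e i x) + norm_sq n (?e j))"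
    using assms(1) unfolding op_bounded_def by blast
  then have "2 * Re (cnj t * z) \<le> c * 2"
    unfolding sesq_scale_left norm_sq_scale sesq_sum_units[OF assms(2,3)] t n1[OF assms(2)] n1[OF assms(3)] z_def
    by simp
  then show ?thesis unfolding tz by (simp add: z_def)
qed

lemma op_bounded_of_entries:
  assumes "X \<in> carrier_mat n n" "\<And>i j. i < n \<Longrightarrow> j < n \<Longrightarrow> cmod (X $$ (i, j)) \<le> c"
  shows "op_bounded n (real n * c) X"
  unfolding op_bounded_def
proof (intro conjI allI)
  fix u v
  have "2 * Re (sesq n X u v) = (\<Sum>i<n. \<Sum>j<n. 2 * Re (cnj (u i) * X $$ (i, j) * v j))"
    by (simp add: sesq_def sum_distrib_left)
  also have "\<dots> \<le> (\<Sum>i<n. \<Sum>j<n. c * ((cmod (u i))\<^sup>2 + (cmod (v j))\<^sup>2))"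
  proof (intro sum_mono)
    fix i j assume "i \<in> {..<n}" "j \<in> {..<n}"
    then have c: "cmod (X $$ (i, j)) \<le> c" using assms(2) by auto
    have "Re (cnj (u i) * X $$ (i, j) * v j) \<le> cmod (X $$ (i, j)) * (cmod (u i) * cmod (v j))"
      using complex_Re_le_cmod[of "cnj (u i) * X $$ (i, j) * v j"] by (simp add: norm_mult mult_ac)
    also have "\<dots> \<le> c * (cmod (u i) * cmod (v j))" using c by (intro mult_right_mono) auto
    finally have "2 * Re (cnj (u i) * X $$ (i, j) * v j) \<le> c * (2 * cmod (u i) * cmod (v j))" by simp
    also have "\<dots> \<le> c * ((cmod (u i))\<^sup>2 + (cmod (v j))\<^sup>2)"
      using sum_squares_bound[of "cmod (u i)" "cmod (v j)"] order_trans[OF norm_ge_zero c]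
      by (intro mult_left_mono) auto
    finally show "2 * Re (cnj (u i) * X $$ (i, j) * v j) \<le> c * ((cmod (u i))\<^sup>2 + (cmod (v j))\<^sup>2)" .
  qed
  also have "\<dots> = real n * c * (norm_sq n u + norm_sq n v)"
    by (simp add: norm_sq_def sum.distrib sum_distrib_left algebra_simps)
  finally show "2 * Re (sesq n X u v) \<le> real n * c * (norm_sq n u + norm_sq n v)" .
qed (use assms in auto)

text \<open>The factor \<open>real n\<close> is the price of comparing entries with the operator
  norm, which a unital completely positive map does not increase. It is the same for every channel
  and therefore uniform over all powers of one channel.\<close>

lemma channel_entry_bound:
  assumes ch: "heisenberg_channel n \<Phi>" and X: "X \<in> carrier_mat n n"
    and c: "\<And>i j. i < n \<Longrightarrow> j < n \<Longrightarrow> cmod (X $$ (i, j)) \<le> c" and ij: "i < n" "j < n"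
  shows "cmod (\<Phi> X $$ (i, j)) \<le> real n * c"
proof -
  have "op_bounded (1 * n) (real n * c) (id_tensor 1 n n \<Phi> X)"
    using op_bounded_of_entries[OF X c] by (intro id_tensor_op_bounded[OF ch]) auto
  then have "cmod (id_tensor 1 n n \<Phi> X $$ (0 * n + i, 0 * n + j)) \<le> real n * c"
    using ij by (intro op_bounded_entry) auto
  moreover have "tensor_block n X 0 0 = X" using X by (intro eq_matI) (auto simp: tensor_block_def)
  ultimately show ?thesis using ij by (subst (asm) id_tensor_index) auto
qed

section \<open>Compactness and averaging estimates\<close>

text \<open>Bolzano-Weierstrass, one coordinate at a time: a monotone subsequence of a bounded real
  sequence converges, and further thinning preserves the limits already obtained.\<close>

lemma finite_family_convergent_subsequence_real:
  fixes f :: "nat \<Rightarrow> 'i \<Rightarrow> real"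
  assumes "finite I" "\<And>k i. i \<in> I \<Longrightarrow> \<bar>f k i\<bar> \<le> C"
  shows "\<exists>s. strict_mono s \<and> (\<forall>i\<in>I. \<exists>l. (\<lambda>k. f (s k) i) \<longlonglongrightarrow> l)"
  using assms
proof (induction I)
  case empty
  show ?case by (auto intro: strict_mono_id)
next
  case (insert i I)
  then obtain s where s: "strict_mono s" "\<forall>i\<in>I. \<exists>l. (\<lambda>k. f (s k) i) \<longlonglongrightarrow> l" by auto
  obtain r where r: "strict_mono r" "monoseq (\<lambda>k. f (s (r k)) i)"
    using seq_monosub[of "\<lambda>k. f (s k) i"] by blast
  have "Bseq (\<lambda>k. f (s (r k)) i)"
    using insert.prems[of i] by (intro BseqI'[of _ C]) simp
  then have conv: "convergent (\<lambda>k. f (s (r k)) i)" using r(2) by (rule Bseq_monoseq_convergent)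
  have "\<exists>l'. (\<lambda>k. f ((s \<circ> r) k) j) \<longlonglongrightarrow> l'" if "j \<in> insert i I" for j
  proof (cases "j = i")
    case True
    then show ?thesis using conv by (simp add: convergent_def)
  next
    case False
    then have "j \<in> I" using that by simp
    then obtain l' where "(\<lambda>k. f (s k) j) \<longlonglongrightarrow> l'" using s(2) by metis
    from LIMSEQ_subseq_LIMSEQ[OF this r(1)] show ?thesis by (auto simp: o_def)
  qed
  moreover have "strict_mono (s \<circ> r)" using s(1) r(1) by (rule strict_mono_o)
  ultimately show ?case by metis
qed

lemma finite_family_convergent_subsequence:
  fixes f :: "nat \<Rightarrow> 'i \<Rightarrow> complex"
  assumes "finite I" "\<And>k i. i \<in> I \<Longrightarrow> cmod (f k i) \<le> C"
  shows "\<exists>s l. strict_mono s \<and> (\<forall>i\<in>I. (\<lambda>k. f (s k) i) \<longlonglongrightarrow> l i)"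
proof -
  \<comment> \<open>Real and imaginary parts become two real coordinates, told apart by the
    Boolean.\<close>
  define h where "h = (\<lambda>k (i, b). if b then Re (f k i) else Im (f k i))"
  have "\<exists>s. strict_mono s \<and> (\<forall>p\<in>I \<times> UNIV. \<exists>l. (\<lambda>k. h (s k) p) \<longlonglongrightarrow> l)"
  proof (rule finite_family_convergent_subsequence_real)
    show "\<bar>h k p\<bar> \<le> C" if "p \<in> I \<times> UNIV" for k p
      using that assms(2) order_trans[OF abs_Re_le_cmod] order_trans[OF abs_Im_le_cmod]
      by (auto simp: h_def)
  qed (use assms(1) in auto)
  then obtain s l where s: "strict_mono s" and l: "\<forall>p\<in>I \<times> UNIV. (\<lambda>k. h (s k) p) \<longlonglongrightarrow> l p" by metis
  have "(\<lambda>k. f (s k) i) \<longlonglongrightarrow> Complex (l (i, True)) (l (i, False))" if "i \<in> I" for i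
    using bspec[OF l, of "(i, True)"] bspec[OF l, of "(i, False)"] that
    by (simp add: tendsto_complex_iff h_def)
  then show ?thesis using s by (intro exI[of _ s] exI[of _ "\<lambda>i. Complex (l (i, True)) (l (i, False))"]) blast
qed

text \<open>Shifting the summation window by one exchanges two terms only, whatever its length
  \<open>N\<close>; hence t shifts cost at most 2 t C.\<close>

lemma shifted_sum_diff_le:
  fixes g :: "nat \<Rightarrow> complex"
  assumes "\<And>p. cmod (g p) \<le> C"
  shows "cmod ((\<Sum>p<N. g p) - (\<Sum>p<N. g (p + t))) \<le> 2 * real t * C"
proof (induction t)
  case (Suc t)
  have "(\<Sum>p<N. g (p + t)) - (\<Sum>p<N. g (p + Suc t)) = g t - g (N + t)"
    using sum_lessThan_telescope'[of "\<lambda>p. g (p + t)" N] by (simp add: sum_subtractf)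
  then have "cmod ((\<Sum>p<N. g (p + t)) - (\<Sum>p<N. g (p + Suc t))) \<le> 2 * C"
    using norm_triangle_ineq4[of "g t" "g (N + t)"] assms[of t] assms[of "N + t"] by simp
  then have "cmod (((\<Sum>p<N. g p) - (\<Sum>p<N. g (p + t))) + ((\<Sum>p<N. g (p + t)) - (\<Sum>p<N. g (p + Suc t))))
      \<le> 2 * real t * C + 2 * C"
    using Suc by (intro norm_triangle_le) linarith
  then show ?case by (simp add: algebra_simps)
qed simp

text \<open>The error does not depend on \<open>N\<close>, so it disappears once the sums are
  divided by a large \<open>N\<close>.\<close>

lemma double_sum_diff_le:
  fixes g :: "nat \<Rightarrow> complex"
  assumes "\<And>p. cmod (g p) \<le> C"
  shows "cmod (of_nat K * (\<Sum>p<N. g p) - (\<Sum>p<N. \<Sum>t<K. g (p + t))) \<le> 2 * (real K)\<^sup>2 * C"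
proof -
  have C: "0 \<le> C" using assms[of 0] norm_ge_zero order_trans by blast
  have "of_nat K * (\<Sum>p<N. g p) - (\<Sum>p<N. \<Sum>t<K. g (p + t)) =
     (\<Sum>t<K. (\<Sum>p<N. g p) - (\<Sum>p<N. g (p + t)))"
    by (subst sum.swap) (simp add: sum_subtractf)
  also have "cmod \<dots> \<le> (\<Sum>t<K. 2 * real K * C)"
  proof (intro sum_norm_le)
    fix t assume "t \<in> {..<K}"
    then have "2 * real t * C \<le> 2 * real K * C" using C by (intro mult_right_mono) auto
    then show "cmod ((\<Sum>p<N. g p) - (\<Sum>p<N. g (p + t))) \<le> 2 * real K * C"
      using shifted_sum_diff_le[of g C, OF assms, where N = N and t = t] by linarith
  qed
  finally show ?thesis by (simp add: power2_eq_square mult_ac)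
qed

text \<open>A recursion rather than a \<open>sum\<close>, since the zero matrix to start from
  depends on the dimension.\<close>

primrec orbit_sum :: "nat \<Rightarrow> (complex mat \<Rightarrow> complex mat) \<Rightarrow> complex mat \<Rightarrow> nat \<Rightarrow> complex mat" where
  "orbit_sum n \<Phi> X 0 = 0\<^sub>m n n"
| "orbit_sum n \<Phi> X (Suc N) = orbit_sum n \<Phi> X N + (\<Phi> ^^ N) X"

lemma linear_superopD:
  assumes "linear_superop n F" "X \<in> carrier_mat n n"
  shows "F X \<in> carrier_mat n n" "Y \<in> carrier_mat n n \<Longrightarrow> F (X + Y) = F X + F Y" "F (c \<cdot>\<^sub>m X) = c \<cdot>\<^sub>m F X"
  using assms by (auto simp: linear_superop_def)

lemma orbit_sum_image:
  assumes F: "linear_superop n F" and \<Phi>: "\<And>t. linear_superop n (\<Phi> ^^ t)" and X: "X \<in> carrier_mat n n"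
  shows "orbit_sum n \<Phi> X N \<in> carrier_mat n n \<and>
    (\<forall>i<n. \<forall>j<n. F (orbit_sum n \<Phi> X N) $$ (i, j) = (\<Sum>t<N. F ((\<Phi> ^^ t) X) $$ (i, j)))"
proof (induction N)
  case 0
  then show ?case using linear_superop_zero[OF F] by simp
next
  case (Suc N)
  have c: "(\<Phi> ^^ N) X \<in> carrier_mat n n" using \<Phi> X by (rule linear_superopD)
  have s: "orbit_sum n \<Phi> X N \<in> carrier_mat n n" using Suc by blast
  show ?case using linear_superopD(1)[OF F s] linear_superopD(1)[OF F c] Suc c
    by (simp add: linear_superopD(2)[OF F s c])
qed

text \<open>A subsequence of the means \<open>a N\<close> converges to some Y by compactness, and Y is fixed. If \<open>a K\<close> is
  close to Y, so is the image of \<open>a K\<close> under every power of \<open>\<Phi>\<close>, because the powers are uniformly bounded;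
  averaging these images over N powers gives \<open>a N\<close> up to an error of order \<open>K / N\<close>.\<close>

theorem cesaro_means_converge:
  assumes ch: "heisenberg_channel n \<Phi>" and X: "X \<in> carrier_mat n n"
  shows "\<exists>Y \<in> Fix n \<Phi>. \<forall>i<n. \<forall>j<n. (\<lambda>N. (\<Sum>t<N. ((\<Phi> ^^ t) X) $$ (i, j)) / of_nat N) \<longlonglongrightarrow> Y $$ (i, j)"
proof -
  note chp = heisenberg_channel_funpow[OF ch]
  note linp = heisenberg_channel_linear[OF chp]
  note lin = heisenberg_channel_linear[OF ch]
  define g where "g = (\<lambda>i j t. ((\<Phi> ^^ t) X) $$ (i, j))"
  define a where "a = (\<lambda>N i j. (\<Sum>t<N. g i j t) / of_nat N)"
  define C where "C = real n * (\<Sum>i<n. \<Sum>j<n. cmod (X $$ (i, j)))"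
  have g: "cmod (g i j t) \<le> C" if "i < n" "j < n" for i j t
    unfolding g_def C_def
  proof (rule channel_entry_bound[OF chp X _ that])
    fix i j assume ij: "i < n" "j < n"
    have "cmod (X $$ (i, j)) \<le> (\<Sum>j<n. cmod (X $$ (i, j)))" using ij by (intro member_le_sum) auto
    also have "\<dots> \<le> (\<Sum>i<n. \<Sum>j<n. cmod (X $$ (i, j)))"
      using ij by (intro member_le_sum[of i _ "\<lambda>i. \<Sum>j<n. cmod (X $$ (i, j))"]) (auto intro!: sum_nonneg)
    finally show "cmod (X $$ (i, j)) \<le> (\<Sum>i<n. \<Sum>j<n. cmod (X $$ (i, j)))" .
  qed
  have a_le: "cmod (a N i j) \<le> C" if "i < n" "j < n" for N i j
  proof (cases "N = 0")
    case True
    then show ?thesis using order_trans[OF norm_ge_zero g[OF that]] by (simp add: a_def)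
  next
    case False
    have "cmod (\<Sum>t<N. g i j t) \<le> (\<Sum>t<N. C)" by (intro sum_norm_le g that)
    then show ?thesis using False by (simp add: a_def norm_divide divide_le_eq mult.commute)
  qed
  have "\<exists>s l. strict_mono s \<and> (\<forall>p\<in>{..<n} \<times> {..<n}. (\<lambda>k. a (s k) (fst p) (snd p)) \<longlonglongrightarrow> l p)"
    by (rule finite_family_convergent_subsequence[of _ "\<lambda>k p. a k (fst p) (snd p)" C]) (auto simp: a_le)
  then obtain s l where s: "strict_mono s"
    and l: "\<forall>p\<in>{..<n} \<times> {..<n}. (\<lambda>k. a (s k) (fst p) (snd p)) \<longlonglongrightarrow> l p" by blast
  define Y where "Y = mat n n l"
  have Yc: "Y \<in> carrier_mat n n" by (simp add: Y_def)
  \<comment> \<open>Besides closeness, \<open>K\<close> is made large enough for the shift error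
    between the mean \<open>a K\<close> and its image under \<Phi> to be small; that second property
    serves to show that \<open>Y\<close> is fixed.\<close>
  have close: "\<exists>K>0. 2 * C / real K < \<epsilon> \<and> (\<forall>i<n. \<forall>j<n. cmod (a K i j - Y $$ (i, j)) \<le> \<epsilon>)" if "0 < \<epsilon>" for \<epsilon>
  proof -
    have "\<forall>\<^sub>F k in sequentially. \<forall>p\<in>{..<n} \<times> {..<n}. dist (a (s k) (fst p) (snd p)) (l p) < \<epsilon>"
      using l that by (intro eventually_ball_finite) (auto simp: tendsto_iff)
    moreover have "\<forall>\<^sub>F k in sequentially. 2 * C / real (s k) < \<epsilon>"
    proof -
      have "(\<lambda>k. 2 * C / real (s k)) \<longlonglongrightarrow> 0"
        using LIMSEQ_subseq_LIMSEQ[OF lim_const_over_n[of "2 * C"] s] by (simp add: o_def)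
      then show ?thesis using that by (auto dest!: order_tendstoD(2))
    qed
    moreover have "\<forall>\<^sub>F k in sequentially. 0 < k" by (rule eventually_gt_at_top)
    ultimately have "\<forall>\<^sub>F k in sequentially. (\<forall>p\<in>{..<n} \<times> {..<n}. dist (a (s k) (fst p) (snd p)) (l p) < \<epsilon>) \<and>
       2 * C / real (s k) < \<epsilon> \<and> 0 < k" by eventually_elim auto
    then obtain k where k: "\<forall>p\<in>{..<n} \<times> {..<n}. dist (a (s k) (fst p) (snd p)) (l p) < \<epsilon>"
       "2 * C / real (s k) < \<epsilon>" "0 < k" unfolding eventually_sequentially by blast
    have "0 < s k" using seq_suble[OF s, of k] k(3) by simp
    moreover have "cmod (a (s k) i j - Y $$ (i, j)) \<le> \<epsilon>" if "i < n" "j < n" for i j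
      using bspec[OF k(1), of "(i, j)"] that by (simp add: dist_norm Y_def less_imp_le)
    ultimately show ?thesis using k(2) by blast
  qed
  \<comment> \<open>The power \<open>p\<close> of \<Phi> applied to \<open>a K\<close> is the mean
    over the window from \<open>p\<close> to \<open>p + K - 1\<close>. The difference
    \<open>D\<close> has entries at most \<epsilon>, which the power enlarges by the factor
    \<open>real n\<close> at most.\<close>
  have image: "cmod ((\<Sum>t<K. g i j (p + t)) / of_nat K - (\<Phi> ^^ p) Y $$ (i, j)) \<le> real n * \<epsilon>"
    if K: "\<forall>i<n. \<forall>j<n. cmod (a K i j - Y $$ (i, j)) \<le> \<epsilon>" and ij: "i < n" "j < n" for p K \<epsilon> i j
  proof -
    define A where "A = orbit_sum n \<Phi> X K"
    note oi = orbit_sum_image[where \<Phi> = \<Phi> and N = K and X = X and n = n, OF _ linp X, folded A_def]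
    have Ac: "A \<in> carrier_mat n n" using oi[OF linp[of 0]] by blast
    have Ae: "A $$ (i, j) = (\<Sum>t<K. g i j t)" if "i < n" "j < n" for i j
      using oi[OF linp[of 0]] that by (simp add: g_def)
    define D where "D = (1 / of_nat K) \<cdot>\<^sub>m A + (-1) \<cdot>\<^sub>m Y"
    have Dc: "D \<in> carrier_mat n n" using Ac Yc by (simp add: D_def)
    have "cmod (D $$ (i, j)) \<le> \<epsilon>" if "i < n" "j < n" for i j
      using K that Ac Yc by (simp add: D_def Ae a_def)
    then have le: "cmod ((\<Phi> ^^ p) D $$ (i, j)) \<le> real n * \<epsilon>"
      by (rule channel_entry_bound[OF chp Dc _ ij])
    have "(\<Phi> ^^ p) D = (1 / of_nat K) \<cdot>\<^sub>m (\<Phi> ^^ p) A + (-1) \<cdot>\<^sub>m (\<Phi> ^^ p) Y"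
      unfolding D_def using Ac Yc linear_superopD[OF linp] by simp
    moreover have "(\<Phi> ^^ p) A $$ (i, j) = (\<Sum>t<K. g i j (p + t))"
      using oi[OF linp[of p]] ij by (simp add: g_def funpow_add)
    ultimately have "(\<Phi> ^^ p) D $$ (i, j) = (\<Sum>t<K. g i j (p + t)) / of_nat K - (\<Phi> ^^ p) Y $$ (i, j)"
      using linear_superopD(1)[OF linp[of p] Ac] linear_superopD(1)[OF linp[of p] Yc] ij by simp
    then show ?thesis using le by simp
  qed
  have "\<Phi> Y = Y"
  proof (rule eq_matI)
    fix i j assume "i < dim_row Y" "j < dim_col Y"
    then have ij: "i < n" "j < n" using Yc by auto
    have "cmod (\<Phi> Y $$ (i, j) - Y $$ (i, j)) \<le> 0 + e" if "0 < e" for e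
    proof -
      \<comment> \<open>The chain from \<Phi> Y through \<Phi> (a K) and \<open>a K\<close> to
        \<open>Y\<close> costs n \<epsilon>, \<epsilon> and \<epsilon>.\<close>
      define \<epsilon> where "\<epsilon> = e / (real n + 2)"
      have \<epsilon>_eq: "\<epsilon> * (real n + 2) = e" by (simp add: \<epsilon>_def)
      have "0 < \<epsilon>" using that by (simp add: \<epsilon>_def)
      then obtain K where K: "0 < K" "2 * C / real K < \<epsilon>" "\<forall>i<n. \<forall>j<n. cmod (a K i j - Y $$ (i, j)) \<le> \<epsilon>"
        using close by blast
      have 1: "cmod ((\<Sum>t<K. g i j (1 + t)) / of_nat K - \<Phi> Y $$ (i, j)) \<le> real n * \<epsilon>"
        using image[OF K(3) ij, of 1] by simp
      have "cmod ((\<Sum>t<K. g i j t) - (\<Sum>t<K. g i j (t + 1))) \<le> 2 * real 1 * C"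
        by (rule shifted_sum_diff_le) (rule g[OF ij])
      then have "cmod (((\<Sum>t<K. g i j t) - (\<Sum>t<K. g i j (1 + t))) / of_nat K) \<le> 2 * C / real K"
        by (simp add: norm_divide divide_right_mono)
      then have 2: "cmod (a K i j - (\<Sum>t<K. g i j (1 + t)) / of_nat K) \<le> \<epsilon>"
        using K(2) unfolding a_def diff_divide_distrib[symmetric] by linarith
      have 3: "cmod (a K i j - Y $$ (i, j)) \<le> \<epsilon>" using K(3) ij by blast
      have "cmod (\<Phi> Y $$ (i, j) - Y $$ (i, j)) \<le> real n * \<epsilon> + (\<epsilon> + \<epsilon>)"
        using norm_diff_triangle_le[OF 1[unfolded norm_minus_commute[of "_ / _"]]
            norm_diff_triangle_le[OF 2[unfolded norm_minus_commute[of "a K i j"]] 3]] .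
      also have "\<dots> = e" using \<epsilon>_eq by (simp add: algebra_simps)
      finally show ?thesis by simp
    qed
    then have "cmod (\<Phi> Y $$ (i, j) - Y $$ (i, j)) \<le> 0" by (rule field_le_epsilon)
    then show "\<Phi> Y $$ (i, j) = Y $$ (i, j)" by simp
  qed (use linear_superopD(1)[OF lin Yc] Yc in auto)
  then have Yfix: "Y \<in> Fix n \<Phi>" and Yp: "(\<Phi> ^^ p) Y = Y" for p
    using Yc by (auto simp: Fix_def) (induction p; simp)
  have "(\<lambda>N. a N i j) \<longlonglongrightarrow> Y $$ (i, j)" if ij: "i < n" "j < n" for i j
  proof (rule LIMSEQ_I)
    fix e :: real assume e: "0 < e"
    define \<epsilon> where "\<epsilon> = e / (real n + 2)"
    have \<epsilon>_eq: "\<epsilon> * (real n + 2) = e" by (simp add: \<epsilon>_def)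
    have \<epsilon>: "0 < \<epsilon>" using e by (simp add: \<epsilon>_def)
    then obtain K where K: "0 < K" "\<forall>i<n. \<forall>j<n. cmod (a K i j - Y $$ (i, j)) \<le> \<epsilon>"
      using close by blast
    obtain N0 where N0: "2 * real K * C / \<epsilon> < real N0" using reals_Archimedean2 by blast
    have "cmod (a N i j - Y $$ (i, j)) < e" if N: "N \<ge> Suc N0" for N
    proof -
      let ?G = "\<Sum>p<N. \<Sum>t<K. g i j (p + t)" and ?y = "Y $$ (i, j)"
      have N': "0 < real N" "2 * real K * C / \<epsilon> < real N" using N N0 by linarith+
      then have bN: "2 * real K * C / real N < \<epsilon>" using \<epsilon> by (simp add: field_simps)
      \<comment> \<open>The means over the windows starting at \<open>p < N\<close> are all within n
        \<epsilon> of \<open>Y\<close>. Replacing their sum by the plain orbit sum costs 2 K C, and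
        division by \<open>N\<close> makes this smaller than \<epsilon>.\<close>
      have "cmod (\<Sum>p<N. (\<Sum>t<K. g i j (p + t)) / of_nat K - ?y) \<le> (\<Sum>p<N. real n * \<epsilon>)"
        using image[OF K(2) ij] by (intro sum_norm_le) (simp add: Yp)
      then have 1: "cmod (?G / of_nat K - of_nat N * ?y) \<le> real N * (real n * \<epsilon>)"
        by (simp add: sum_subtractf sum_divide_distrib)
      have "cmod ((of_nat K * (\<Sum>p<N. g i j p) - ?G) / of_nat K) \<le> 2 * (real K)\<^sup>2 * C / real K"
        using double_sum_diff_le[of "g i j" C, OF g[OF ij], where K = K and N = N] K(1)
        by (simp add: norm_divide divide_right_mono)
      moreover have "(of_nat K * (\<Sum>p<N. g i j p) - ?G) / of_nat K = (\<Sum>p<N. g i j p) - ?G / of_nat K"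
        using K(1) by (simp add: diff_divide_distrib)
      moreover have "2 * (real K)\<^sup>2 * C / real K = 2 * real K * C"
        using K(1) by (simp add: power2_eq_square)
      ultimately have "cmod ((\<Sum>p<N. g i j p) - ?G / of_nat K) \<le> 2 * real K * C" by simp
      then have "cmod ((\<Sum>p<N. g i j p) - of_nat N * ?y) \<le> real N * (real n * \<epsilon>) + 2 * real K * C"
        by (subst add.commute) (rule norm_diff_triangle_le[OF _ 1])
      then have "cmod (((\<Sum>p<N. g i j p) - of_nat N * ?y) / of_nat N) \<le> (real N * (real n * \<epsilon>) + 2 * real K * C) / real N"
        by (simp add: norm_divide divide_right_mono)
      also have "((\<Sum>p<N. g i j p) - of_nat N * ?y) / of_nat N = a N i j - ?y"
        using N'(1) by (simp add: a_def diff_divide_distrib)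
      also have "(real N * (real n * \<epsilon>) + 2 * real K * C) / real N = real n * \<epsilon> + 2 * real K * C / real N"
        using N'(1) by (simp add: field_simps)
      also have "\<dots> < real n * \<epsilon> + 2 * \<epsilon>" using bN \<epsilon> by simp
      also have "\<dots> = e" using \<epsilon>_eq by (simp add: algebra_simps)
      finally show ?thesis .
    qed
    then show "\<exists>N0. \<forall>N\<ge>N0. norm (a N i j - Y $$ (i, j)) < e" by blast
  qed
  then show ?thesis using Yfix unfolding a_def g_def by blast
qed

section \<open>Properties of the ergodic projection\<close>

lemma ergodic_proj_carrier [simp]: "ergodic_proj n \<Phi> X \<in> carrier_mat n n"
  by (simp add: ergodic_proj_def)

text \<open>Turns \<open>lim\<close> into actual convergence, the form in which linearity and norm
  bounds can be passed to the limit.\<close>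

lemma ergodic_proj_limit:
  assumes "heisenberg_channel n \<Phi>" "X \<in> carrier_mat n n" "i < n" "j < n"
  shows "(\<lambda>N. (\<Sum>t<N. ((\<Phi> ^^ t) X) $$ (i, j)) / of_nat N) \<longlonglongrightarrow> ergodic_proj n \<Phi> X $$ (i, j)"
proof -
  obtain Y where "(\<lambda>N. (\<Sum>t<N. ((\<Phi> ^^ t) X) $$ (i, j)) / of_nat N) \<longlonglongrightarrow> Y $$ (i, j)"
    using cesaro_means_converge[OF assms(1,2)] assms(3,4) by blast
  then show ?thesis using assms(3,4) by (simp add: ergodic_proj_def limI)
qed

lemma ergodic_proj_in_Fix:
  assumes "heisenberg_channel n \<Phi>" "X \<in> carrier_mat n n"
  shows "ergodic_proj n \<Phi> X \<in> Fix n \<Phi>"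
proof -
  obtain Y where Y: "Y \<in> Fix n \<Phi>"
    "\<forall>i<n. \<forall>j<n. (\<lambda>N. (\<Sum>t<N. ((\<Phi> ^^ t) X) $$ (i, j)) / of_nat N) \<longlonglongrightarrow> Y $$ (i, j)"
    using cesaro_means_converge[OF assms] by blast
  have "ergodic_proj n \<Phi> X = Y"
  proof (rule eq_matI)
    fix i j assume "i < dim_row Y" "j < dim_col Y"
    then have ij: "i < n" "j < n" using Y(1) by (auto simp: Fix_def)
    then show "ergodic_proj n \<Phi> X $$ (i, j) = Y $$ (i, j)"
      using Y(2) LIMSEQ_unique[OF ergodic_proj_limit[OF assms ij]] by blast
  qed (use Y(1) in \<open>auto simp: Fix_def carrier_matD[OF ergodic_proj_carrier]\<close>)
  then show ?thesis using Y by simp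
qed

lemma ergodic_proj_linear:
  assumes ch: "heisenberg_channel n \<Phi>"
  shows "linear_superop n (ergodic_proj n \<Phi>)"
  unfolding linear_superop_def
proof (intro conjI ballI allI)
  note linp = linear_superopD[OF heisenberg_channel_linear[OF heisenberg_channel_funpow[OF ch]]]
  fix X :: "complex mat" assume X: "X \<in> carrier_mat n n"
  show "ergodic_proj n \<Phi> (X + Y) = ergodic_proj n \<Phi> X + ergodic_proj n \<Phi> Y" if Y: "Y \<in> carrier_mat n n" for Y
  proof (rule eq_matI)
    fix i j assume "i < dim_row (ergodic_proj n \<Phi> X + ergodic_proj n \<Phi> Y)" "j < dim_col (ergodic_proj n \<Phi> X + ergodic_proj n \<Phi> Y)"
    then have ij: "i < n" "j < n" by (auto simp: ergodic_proj_def)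
    have "((\<Phi> ^^ t) (X + Y)) $$ (i, j) = ((\<Phi> ^^ t) X) $$ (i, j) + ((\<Phi> ^^ t) Y) $$ (i, j)" for t
      using linp(2)[OF X Y, of t] linp(1)[OF X, of t] linp(1)[OF Y, of t] ij by simp
    then have "(\<lambda>N. (\<Sum>t<N. ((\<Phi> ^^ t) (X + Y)) $$ (i, j)) / of_nat N) \<longlonglongrightarrow>
        ergodic_proj n \<Phi> X $$ (i, j) + ergodic_proj n \<Phi> Y $$ (i, j)"
      using tendsto_add[OF ergodic_proj_limit[OF ch X ij] ergodic_proj_limit[OF ch Y ij]]
      by (simp add: sum.distrib add_divide_distrib)
    from LIMSEQ_unique[OF ergodic_proj_limit[OF ch _ ij] this]
    show "ergodic_proj n \<Phi> (X + Y) $$ (i, j) = (ergodic_proj n \<Phi> X + ergodic_proj n \<Phi> Y) $$ (i, j)"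
      using X Y ij by (simp add: carrier_matD[OF ergodic_proj_carrier])
  qed (auto simp: ergodic_proj_def)
  show "ergodic_proj n \<Phi> (c \<cdot>\<^sub>m X) = c \<cdot>\<^sub>m ergodic_proj n \<Phi> X" for c
  proof (rule eq_matI)
    fix i j assume "i < dim_row (c \<cdot>\<^sub>m ergodic_proj n \<Phi> X)" "j < dim_col (c \<cdot>\<^sub>m ergodic_proj n \<Phi> X)"
    then have ij: "i < n" "j < n" by (auto simp: ergodic_proj_def)
    have "((\<Phi> ^^ t) (c \<cdot>\<^sub>m X)) $$ (i, j) = c * ((\<Phi> ^^ t) X) $$ (i, j)" for t
      using linp(3)[OF X, of t] linp(1)[OF X, of t] ij by simp
    then have "(\<lambda>N. (\<Sum>t<N. ((\<Phi> ^^ t) (c \<cdot>\<^sub>m X)) $$ (i, j)) / of_nat N) \<longlonglongrightarrow>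
        c * ergodic_proj n \<Phi> X $$ (i, j)"
      using tendsto_mult_left[OF ergodic_proj_limit[OF ch X ij], of c] by (simp add: sum_distrib_left)
    from LIMSEQ_unique[OF ergodic_proj_limit[OF ch _ ij] this]
    show "ergodic_proj n \<Phi> (c \<cdot>\<^sub>m X) $$ (i, j) = (c \<cdot>\<^sub>m ergodic_proj n \<Phi> X) $$ (i, j)"
      using X ij by (simp add: carrier_matD[OF ergodic_proj_carrier])
  qed (auto simp: ergodic_proj_def)
qed simp

text \<open>For fixed \<open>u\<close> and \<open>v\<close> the bound is a closed condition linear
  in the matrix: it holds for each amplified power, hence for their means, hence for the
  limit.\<close>

lemma id_tensor_ergodic_proj_op_bounded:
  assumes ch: "heisenberg_channel n \<Phi>" and V: "op_bounded (r * n) c V"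
  shows "op_bounded (r * n) c (id_tensor r n n (ergodic_proj n \<Phi>) V)"
  unfolding op_bounded_def
proof (intro conjI allI)
  let ?E = "id_tensor r n n (ergodic_proj n \<Phi>) V" and ?T = "\<lambda>t. id_tensor r n n (\<Phi> ^^ t) V"
  have lim: "(\<lambda>N. (\<Sum>t<N. ?T t $$ (i, j)) / of_nat N) \<longlonglongrightarrow> ?E $$ (i, j)" if "i < r * n" "j < r * n" for i j
  proof -
    have "0 < n" using that by (cases n) auto
    then show ?thesis using that by (simp add: id_tensor_def ergodic_proj_limit[OF ch])
  qed
  fix u v
  have "(\<lambda>N. sesq (r * n) (mat (r * n) (r * n) (\<lambda>(i, j). (\<Sum>t<N. ?T t $$ (i, j)) / of_nat N)) u v)
      \<longlonglongrightarrow> sesq (r * n) ?E u v"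
    unfolding sesq_def by (intro tendsto_sum tendsto_mult tendsto_const) (simp add: lim)
  then have "(\<lambda>N. 2 * Re (sesq (r * n) (mat (r * n) (r * n) (\<lambda>(i, j). (\<Sum>t<N. ?T t $$ (i, j)) / of_nat N)) u v))
      \<longlonglongrightarrow> 2 * Re (sesq (r * n) ?E u v)"
    by (intro tendsto_mult_left tendsto_Re)
  moreover have "2 * Re (sesq (r * n) (mat (r * n) (r * n) (\<lambda>(i, j). (\<Sum>t<N. ?T t $$ (i, j)) / of_nat N)) u v)
      \<le> c * (norm_sq (r * n) u + norm_sq (r * n) v)" if "1 \<le> N" for N
  proof -
    have "sesq (r * n) (mat (r * n) (r * n) (\<lambda>(i, j). (\<Sum>t<N. ?T t $$ (i, j)) / of_nat N)) u v =
       (\<Sum>i<r * n. \<Sum>j<r * n. \<Sum>t<N. cnj (u i) * ?T t $$ (i, j) * v j) / of_nat N"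
      by (simp add: sesq_def sum_distrib_left sum_distrib_right sum_divide_distrib)
    also have "(\<Sum>i<r * n. \<Sum>j<r * n. \<Sum>t<N. cnj (u i) * ?T t $$ (i, j) * v j) =
       (\<Sum>i<r * n. \<Sum>t<N. \<Sum>j<r * n. cnj (u i) * ?T t $$ (i, j) * v j)"
      by (intro sum.cong refl sum.swap)
    also have "\<dots> = (\<Sum>t<N. sesq (r * n) (?T t) u v)"
      unfolding sesq_def by (rule sum.swap)
    finally have avg: "sesq (r * n) (mat (r * n) (r * n) (\<lambda>(i, j). (\<Sum>t<N. ?T t $$ (i, j)) / of_nat N)) u v =
       (\<Sum>t<N. sesq (r * n) (?T t) u v) / of_nat N" .
    have "2 * Re (sesq (r * n) (mat (r * n) (r * n) (\<lambda>(i, j). (\<Sum>t<N. ?T t $$ (i, j)) / of_nat N)) u v)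
       = (\<Sum>t<N. 2 * Re (sesq (r * n) (?T t) u v)) / real N"
      unfolding avg by (simp add: sum_distrib_left)
    also have "\<dots> \<le> (\<Sum>t<N. c * (norm_sq (r * n) u + norm_sq (r * n) v)) / real N"
      using id_tensor_op_bounded[OF heisenberg_channel_funpow[OF ch] V]
      by (intro divide_right_mono sum_mono) (auto simp: op_bounded_def)
    also have "\<dots> = c * (norm_sq (r * n) u + norm_sq (r * n) v)" using that by simp
    finally show ?thesis .
  qed
  ultimately show "2 * Re (sesq (r * n) ?E u v) \<le> c * (norm_sq (r * n) u + norm_sq (r * n) v)"
    by (intro LIMSEQ_le_const2) blast+
qed simp

section \<open>Trace pairing and Hilbert-Schmidt duals\<close>

lemma mat_trace_tensor:
  assumes "X \<in> carrier_mat (r * n) (r * n)" "Y \<in> carrier_mat (r * n) (r * n)"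
  shows "mat_trace (X * Y) = (\<Sum>a<r. \<Sum>a'<r. mat_trace (tensor_block n X a a' * tensor_block n Y a' a))"
proof -
  have "mat_trace (X * Y) = (\<Sum>a<r. \<Sum>b<n. \<Sum>a'<r. \<Sum>b'<n.
     X $$ (a * n + b, a' * n + b') * Y $$ (a' * n + b', a * n + b))"
    unfolding mat_trace_mult[OF assms] sum_lessThan_mult ..
  also have "\<dots> = (\<Sum>a<r. \<Sum>a'<r. \<Sum>b<n. \<Sum>b'<n.
     X $$ (a * n + b, a' * n + b') * Y $$ (a' * n + b', a * n + b))"
    by (intro sum.cong refl sum.swap)
  finally show ?thesis by (simp add: mat_trace_mult[OF tensor_block_carrier tensor_block_carrier])
qed

lemma mat_trace_right_cancel:
  assumes "\<sigma> \<in> carrier_mat n n" "\<tau> \<in> carrier_mat n n"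
    and "\<And>a. a \<in> carrier_mat n n \<Longrightarrow> mat_trace (\<sigma> * a) = mat_trace (\<tau> * a)"
  shows "\<sigma> = \<tau>"
proof (rule eq_matI)
  fix i j assume "i < dim_row \<tau>" "j < dim_col \<tau>"
  then have ij: "i < n" "j < n" using assms by auto
  define a :: "complex mat" where "a = mat n n (\<lambda>(x, y). if x = j then if y = i then 1 else 0 else 0)"
  have a: "a \<in> carrier_mat n n" by (simp add: a_def)
  have "mat_trace (\<rho> * a) = \<rho> $$ (i, j)" if "\<rho> \<in> carrier_mat n n" for \<rho>
  proof -
    have "mat_trace (\<rho> * a) = (\<Sum>x<n. \<Sum>y<n. if y = j then (if x = i then \<rho> $$ (x, y) else 0) else 0)"
      unfolding mat_trace_mult[OF that a] by (intro sum.cong) (auto simp: a_def)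
    then show ?thesis using ij by simp
  qed
  then show "\<sigma> $$ (i, j) = \<tau> $$ (i, j)" using assms a by metis
qed (use assms in auto)

text \<open>Discharges the definite description: existence by reading the entries off matrix units,
  uniqueness by nondegeneracy of the trace pairing.\<close>

lemma hs_dual_trace:
  assumes F: "linear_superop n F" and \<rho>: "\<rho> \<in> carrier_mat n n"
  shows "hs_dual n F \<rho> \<in> carrier_mat n n"
    and "a \<in> carrier_mat n n \<Longrightarrow> mat_trace (hs_dual n F \<rho> * a) = mat_trace (\<rho> * F a)"
proof -
  define e :: "nat \<Rightarrow> nat \<Rightarrow> complex mat"
    where "e = (\<lambda>i j. mat n n (\<lambda>(x, y). if x = i then if y = j then 1 else 0 else 0))"
  have e: "e i j \<in> carrier_mat n n" for i j by (simp add: e_def)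
  \<comment> \<open>The indices are exchanged because pairing with the unit at position
    \<open>(j, i)\<close> extracts the entry at \<open>(i, j)\<close>.\<close>
  define \<tau> where "\<tau> = mat n n (\<lambda>(i, j). mat_trace (\<rho> * F (e j i)))"
  have \<tau>c: "\<tau> \<in> carrier_mat n n" by (simp add: \<tau>_def)
  define L where "L = (\<lambda>a. mat_trace (\<rho> * F a))"
  have L_add: "L (a + b) = L a + L b" if "a \<in> carrier_mat n n" "b \<in> carrier_mat n n" for a b
  proof -
    have "F a \<in> carrier_mat n n" "F b \<in> carrier_mat n n" using that linear_superopD(1)[OF F] by auto
    then show ?thesis unfolding L_def linear_superopD(2)[OF F that]
      using mat_trace_mult[OF \<rho>, of "F a + F b"] mat_trace_mult[OF \<rho>, of "F a"] mat_trace_mult[OF \<rho>, of "F b"]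
      by (simp add: sum.distrib algebra_simps)
  qed
  have L_smult: "L (c \<cdot>\<^sub>m a) = c * L a" if "a \<in> carrier_mat n n" for a c
  proof -
    have "F a \<in> carrier_mat n n" using that linear_superopD(1)[OF F] by auto
    then show ?thesis unfolding L_def linear_superopD(3)[OF F that]
      using mat_trace_mult[OF \<rho>, of "c \<cdot>\<^sub>m F a"] mat_trace_mult[OF \<rho>, of "F a"]
      by (simp add: sum_distrib_left mult_ac)
  qed
  \<comment> \<open>Linearity extended to the expansion in matrix units, by induction on the set of
    positions filled so far.\<close>
  have expand: "L (mat n n (\<lambda>(x, y). if (x, y) \<in> S then a $$ (x, y) else 0)) =
      (\<Sum>(x, y)\<in>S. a $$ (x, y) * L (e x y))"
    if "finite S" "S \<subseteq> {..<n} \<times> {..<n}" for S and a :: "complex mat"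
    using that
  proof (induction S)
    case empty
    have "mat n n (\<lambda>_. 0) = 0 \<cdot>\<^sub>m (1\<^sub>m n :: complex mat)" by (intro eq_matI) auto
    then show ?case using L_smult[of "1\<^sub>m n" 0] by simp
  next
    case (insert p S)
    obtain x y where p: "p = (x, y)" by force
    have "mat n n (\<lambda>(x, y). if (x, y) \<in> insert p S then a $$ (x, y) else 0) =
       a $$ (x, y) \<cdot>\<^sub>m e x y + mat n n (\<lambda>(x, y). if (x, y) \<in> S then a $$ (x, y) else 0)"
      using insert(2) by (intro eq_matI) (auto simp: e_def p)
    then have "L (mat n n (\<lambda>(x, y). if (x, y) \<in> insert p S then a $$ (x, y) else 0)) =
       a $$ (x, y) * L (e x y) + L (mat n n (\<lambda>(x, y). if (x, y) \<in> S then a $$ (x, y) else 0))"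
      using L_add[of "a $$ (x, y) \<cdot>\<^sub>m e x y"] L_smult[OF e] e by simp
    moreover have "L (mat n n (\<lambda>(x, y). if (x, y) \<in> S then a $$ (x, y) else 0)) =
      (\<Sum>(x, y)\<in>S. a $$ (x, y) * L (e x y))" using insert.IH insert.prems by blast
    ultimately show ?case using insert.hyps by (simp only: p sum.insert prod.case not_False_eq_True)
  qed
  have \<tau>: "mat_trace (\<tau> * a) = mat_trace (\<rho> * F a)" if a: "a \<in> carrier_mat n n" for a
  proof -
    have "mat n n (\<lambda>(x, y). if (x, y) \<in> {..<n} \<times> {..<n} then a $$ (x, y) else 0) = a"
      using a by (intro eq_matI) auto
    then have "L a = (\<Sum>(x, y)\<in>{..<n} \<times> {..<n}. a $$ (x, y) * L (e x y))"
      using expand[of "{..<n} \<times> {..<n}" a] by simp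
    also have "\<dots> = (\<Sum>x<n. \<Sum>y<n. a $$ (x, y) * L (e x y))" by (rule sum.cartesian_product[symmetric])
    also have "\<dots> = (\<Sum>y<n. \<Sum>x<n. a $$ (x, y) * L (e x y))" by (rule sum.swap)
    also have "\<dots> = mat_trace (\<tau> * a)"
      unfolding mat_trace_mult[OF \<tau>c a] by (intro sum.cong refl) (auto simp: \<tau>_def L_def)
    finally show ?thesis by (simp add: L_def)
  qed
  have "hs_dual n F \<rho> = \<tau>"
    unfolding hs_dual_def
  proof (rule the_equality)
    fix \<sigma> assume "\<sigma> \<in> carrier_mat n n \<and> (\<forall>a\<in>carrier_mat n n. mat_trace (\<sigma> * a) = mat_trace (\<rho> * F a))"
    then show "\<sigma> = \<tau>" using \<tau> \<tau>c by (intro mat_trace_right_cancel[of _ n]) auto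
  qed (use \<tau> \<tau>c in auto)
  then show "hs_dual n F \<rho> \<in> carrier_mat n n"
    and "a \<in> carrier_mat n n \<Longrightarrow> mat_trace (hs_dual n F \<rho> * a) = mat_trace (\<rho> * F a)"
    using \<tau> \<tau>c by auto
qed

lemma mat_trace_id_tensor_dual:
  assumes F: "linear_superop n F"
    and X: "X \<in> carrier_mat (r * n) (r * n)" and V: "V \<in> carrier_mat (r * n) (r * n)"
  shows "mat_trace (id_tensor r n n (hs_dual n F) X * V) = mat_trace (X * id_tensor r n n F V)"
  unfolding mat_trace_tensor[OF id_tensor_carrier V] mat_trace_tensor[OF X id_tensor_carrier]
  using linear_superopD(1)[OF F] hs_dual_trace[OF F]
  by (intro sum.cong refl) (simp add: tensor_block_id_tensor)


section \<open>Weighted complex projective 2-designs\<close>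

text \<open>In base 3 a sum of two powers has digits at most 2, so no carry occurs. Modulo 3 the two
  sides must have equally many zero exponents; these cancel, and otherwise a factor 3 does.\<close>

lemma power3_sidon:
  assumes "(3::nat) ^ i + 3 ^ j = 3 ^ k + 3 ^ l"
  shows "(i = k \<and> j = l) \<or> (i = l \<and> j = k)"
  using assms
proof (induction i arbitrary: j k l)
  case 0
  have mod3: "(3::nat) ^ x mod 3 = (if x = 0 then 1 else 0)" for x by (cases x) auto
  have "(3 ^ 0 + 3 ^ j) mod 3 = (3 ^ k + 3 ^ l) mod (3::nat)" using 0 by simp
  then have "k = 0 \<or> l = 0"
    unfolding mod_add_eq[of "3 ^ 0", symmetric] mod_add_eq[of "3 ^ k", symmetric] mod3
    by (auto split: if_splits)
  then show ?case using 0 by auto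
next
  case (Suc i)
  have mod3: "(3::nat) ^ x mod 3 = (if x = 0 then 1 else 0)" for x by (cases x) auto
  have m: "(3 ^ Suc i + 3 ^ j) mod 3 = (3 ^ k + 3 ^ l) mod (3::nat)" using Suc.prems by simp
  then have "(if j = 0 then 1 else 0) mod 3 = ((if k = 0 then 1 else 0) + (if l = 0 then 1 else 0)) mod (3::nat)"
    unfolding mod_add_eq[of "3 ^ Suc i", symmetric] mod_add_eq[of "3 ^ k", symmetric] mod3 by simp
  then have *: "j = 0 \<and> k = 0 \<or> j = 0 \<and> l = 0 \<or> (\<exists>j' k' l'. j = Suc j' \<and> k = Suc k' \<and> l = Suc l')"
    by (cases j; cases k; cases l) auto
  have inj: "(3::nat) ^ a = 3 ^ b \<longleftrightarrow> a = b" for a b by (rule power_inject_exp) simp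
  from * consider "j = 0" "k = 0" | "j = 0" "l = 0" | j' k' l' where "j = Suc j'" "k = Suc k'" "l = Suc l'"
    by blast
  then show ?case
  proof cases
    case 1
    then have "(3::nat) ^ Suc i = 3 ^ l" using Suc.prems by (simp del: power_Suc)
    then show ?thesis using 1 unfolding inj by simp
  next
    case 2
    then have "(3::nat) ^ Suc i = 3 ^ k" using Suc.prems by (simp del: power_Suc)
    then show ?thesis using 2 unfolding inj by simp
  next
    case 3
    then show ?thesis using Suc.IH[of j' k' l'] Suc.prems by simp
  qed
qed

lemma sum_roots_of_unity:
  fixes m :: int
  assumes "\<bar>m\<bar> < int N"
  shows "(\<Sum>t<N. cis (real t * (2 * pi * real_of_int m / real N))) = (if m = 0 then of_nat N else 0)"
proof (cases "m = 0")
  case False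
  let ?x = "cis (2 * pi * real_of_int m / real N)"
  have N: "0 < real N" using assms by (cases N) auto
  have "?x \<noteq> 1"
  proof
    assume "?x = 1"
    then have "cos (2 * pi * real_of_int m / real N) = 1" by (simp add: complex_eq_iff)
    then obtain a :: int where "2 * pi * real_of_int m / real N = of_int a * 2 * pi"
      unfolding cos_one_2pi_int by blast
    then have "real_of_int m = real_of_int (a * int N)" using N by (simp add: field_simps)
    then have m: "m = a * int N" using of_int_eq_iff by blast
    then have "a \<noteq> 0" using False by auto
    then have "int N * 1 \<le> int N * \<bar>a\<bar>" by (intro mult_left_mono) auto
    then show False using assms m by (simp add: abs_mult mult.commute)
  qed
  moreover have "?x ^ N = 1"
    using N by (simp add: DeMoivre)
  ultimately have "(\<Sum>t<N. ?x ^ t) = 0" by (simp add: geometric_sum)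
  then show ?thesis using False by (simp add: DeMoivre)
qed simp

text \<open>The powers of 3 form a Sidon set, so averaging over t keeps exactly the terms with
  \<open>{p, s} = {p', s'}\<close>.\<close>

lemma phase_vectors_moments:
  fixes d :: nat
  defines "N \<equiv> 2 * 3 ^ d + 1"
  defines "\<theta> \<equiv> \<lambda>p. 2 * pi * 3 ^ p / real N"
  assumes "p < d" "p' < d" "s < d" "s' < d"
  shows "(\<Sum>t<N. cis (real t * \<theta> p) * cnj (cis (real t * \<theta> p')) * cis (real t * \<theta> s) * cnj (cis (real t * \<theta> s')))
    = (if (p = p' \<and> s = s') \<or> (p = s' \<and> s = p') then of_nat N else 0)"
proof -
  define m :: int where "m = 3 ^ p + 3 ^ s - (3 ^ p' + 3 ^ s')"
  have lt: "(3::int) ^ x \<le> 3 ^ d" if "x < d" for x using that by (intro power_increasing) auto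
  have pos: "(0::int) < 3 ^ x" for x by simp
  \<comment> \<open>With this \<open>N\<close> the frequency difference \<open>m\<close> is smaller
    than \<open>N\<close> in absolute value, so that it vanishes modulo \<open>N\<close> only if it
    is zero.\<close>
  have "int N = 2 * 3 ^ d + 1" by (simp add: N_def)
  then have m_less: "\<bar>m\<bar> < int N"
    using lt[OF assms(3)] lt[OF assms(4)] lt[OF assms(5)] lt[OF assms(6)]
      pos[of p] pos[of p'] pos[of s] pos[of s'] unfolding m_def by linarith
  have "(\<Sum>t<N. cis (real t * \<theta> p) * cnj (cis (real t * \<theta> p')) * cis (real t * \<theta> s) * cnj (cis (real t * \<theta> s')))
     = (\<Sum>t<N. cis (real t * (2 * pi * real_of_int m / real N)))"
  proof (intro sum.cong refl)
    fix t
    have "real t * \<theta> p + - (real t * \<theta> p') + real t * \<theta> s + - (real t * \<theta> s')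
        = real t * (2 * pi * real_of_int m / real N)"
      by (simp add: \<theta>_def m_def algebra_simps add_divide_distrib diff_divide_distrib)
    then show "cis (real t * \<theta> p) * cnj (cis (real t * \<theta> p')) * cis (real t * \<theta> s) * cnj (cis (real t * \<theta> s'))
        = cis (real t * (2 * pi * real_of_int m / real N))"
      by (simp only: cis_cnj cis_mult)
  qed
  also have "\<dots> = (if m = 0 then of_nat N else 0)" by (rule sum_roots_of_unity[OF m_less])
  also have "m = 0 \<longleftrightarrow> (p = p' \<and> s = s') \<or> (p = s' \<and> s = p')"
  proof
    assume "m = 0"
    then have "int (3 ^ p + 3 ^ s) = int (3 ^ p' + 3 ^ s')" by (simp add: m_def)
    then have "(3::nat) ^ p + 3 ^ s = 3 ^ p' + 3 ^ s'" by (simp only: of_nat_eq_iff)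
    then show "(p = p' \<and> s = s') \<or> (p = s' \<and> s = p')" by (rule power3_sidon)
  qed (auto simp: m_def)
  finally show ?thesis .
qed

text \<open>In operator form the second moment \<Sum> w |\<psi>\<rangle>\<langle>\<psi>| \<otimes>
  |\<psi>\<rangle>\<langle>\<psi>| equals (1 + swap) / (d + 1). The normalization makes the weights
  sum to d, as for a resolution of the identity by rank-one projections.\<close>

definition weighted_2_design :: "nat \<Rightarrow> nat \<Rightarrow> (nat \<Rightarrow> real) \<Rightarrow> (nat \<Rightarrow> nat \<Rightarrow> complex) \<Rightarrow> bool" where
  "weighted_2_design d L w \<psi> \<longleftrightarrow> (\<forall>z<L. 0 \<le> w z \<and> norm_sq d (\<psi> z) = 1) \<and>
     (\<forall>p<d. \<forall>p'<d. \<forall>s<d. \<forall>s'<d.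
        (\<Sum>z<L. complex_of_real (w z) * (\<psi> z p * cnj (\<psi> z p') * \<psi> z s * cnj (\<psi> z s'))) =
        ((if p = p' \<and> s = s' then 1 else 0) + (if p = s' \<and> s = p' then 1 else 0)) / of_nat (d + 1))"

text \<open>The phase vectors contribute the diagonal terms \<open>p = p' = s = s'\<close> once, whereas a 2-design needs them
  twice; the standard basis supplies the missing part.\<close>

theorem weighted_2_design_exists:
  assumes d: "0 < d"
  shows "\<exists>L w \<psi>. weighted_2_design d L w \<psi>"
proof -
  define N :: nat where "N = 2 * 3 ^ d + 1"
  define \<theta> where "\<theta> = (\<lambda>p. 2 * pi * 3 ^ p / real N)"
  define \<psi> where "\<psi> = (\<lambda>z p. if z < d then (if p = z then 1 else 0)
      else cis (real (z - d) * \<theta> p) / complex_of_real (sqrt (real d)))"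
  \<comment> \<open>Phase vectors have entries of modulus 1 / sqrt d, so each surviving average of
    four of them is 1 / d^2. The weight turns this into 1 / (d + 1), the amount a basis vector adds
    on the diagonal.\<close>
  define w where "w = (\<lambda>z. if z < d then 1 / real (d + 1) else (real d)\<^sup>2 / (real (d + 1) * real N))"
  have N: "0 < real N" unfolding N_def of_nat_0_less_iff by simp
  have "norm_sq d (\<psi> z) = 1" for z
  proof (cases "z < d")
    case True
    then have "norm_sq d (\<psi> z) = (\<Sum>p<d. if p = z then 1 else 0)"
      unfolding norm_sq_def by (intro sum.cong) (auto simp: \<psi>_def)
    then show ?thesis using True by simp
  next
    case False
    then have "norm_sq d (\<psi> z) = (\<Sum>p<d. 1 / real d)"
      unfolding norm_sq_def by (intro sum.cong) (auto simp: \<psi>_def norm_divide power_divide)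
    then show ?thesis using d by simp
  qed
  moreover have "0 \<le> w z" for z by (simp add: w_def)
  moreover have "(\<Sum>z<d + N. complex_of_real (w z) * (\<psi> z p * cnj (\<psi> z p') * \<psi> z s * cnj (\<psi> z s'))) =
        ((if p = p' \<and> s = s' then 1 else 0) + (if p = s' \<and> s = p' then 1 else 0)) / of_nat (d + 1)"
    if p: "p < d" "p' < d" "s < d" "s' < d" for p p' s s'
  proof -
    let ?f = "\<lambda>z. complex_of_real (w z) * (\<psi> z p * cnj (\<psi> z p') * \<psi> z s * cnj (\<psi> z s'))"
    have split: "(\<Sum>z<d + M. ?f z) = (\<Sum>z<d. ?f z) + (\<Sum>t<M. ?f (d + t))" for M
      by (induction M) (auto simp: algebra_simps)
    have "(\<Sum>z<d. ?f z) = (\<Sum>z<d. if z = p then (if p = p' \<and> p = s \<and> p = s' then 1 / of_nat (d + 1) else 0) else 0)"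
      by (intro sum.cong) (auto simp: w_def \<psi>_def)
    then have 1: "(\<Sum>z<d. ?f z) = (if p = p' \<and> p = s \<and> p = s' then 1 / of_nat (d + 1) else 0)" using p by simp
    have sq: "complex_of_real (sqrt (real d)) * complex_of_real (sqrt (real d)) = of_nat d"
      by (simp flip: of_real_mult)
    have "(\<Sum>t<N. ?f (d + t)) = (\<Sum>t<N. 1 / (of_nat (d + 1) * of_nat N) *
        (cis (real t * \<theta> p) * cnj (cis (real t * \<theta> p')) * cis (real t * \<theta> s) * cnj (cis (real t * \<theta> s'))))"
    proof (intro sum.cong refl)
      fix t
      have "?f (d + t) = complex_of_real (w (d + t)) /
         ((complex_of_real (sqrt (real d)) * complex_of_real (sqrt (real d))) *
          (complex_of_real (sqrt (real d)) * complex_of_real (sqrt (real d)))) *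
        (cis (real t * \<theta> p) * cnj (cis (real t * \<theta> p')) * cis (real t * \<theta> s) * cnj (cis (real t * \<theta> s')))"
        by (simp add: \<psi>_def)
      also have "\<dots> = 1 / (of_nat (d + 1) * of_nat N) *
        (cis (real t * \<theta> p) * cnj (cis (real t * \<theta> p')) * cis (real t * \<theta> s) * cnj (cis (real t * \<theta> s')))"
        unfolding sq using d by (simp add: w_def power2_eq_square)
      finally show "?f (d + t) = 1 / (of_nat (d + 1) * of_nat N) *
        (cis (real t * \<theta> p) * cnj (cis (real t * \<theta> p')) * cis (real t * \<theta> s) * cnj (cis (real t * \<theta> s')))" .
    qed
    also have "\<dots> = 1 / (of_nat (d + 1) * of_nat N) *
        (if (p = p' \<and> s = s') \<or> (p = s' \<and> s = p') then of_nat N else 0)"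
      unfolding sum_distrib_left[symmetric] using phase_vectors_moments[OF p] unfolding N_def \<theta>_def by simp
    finally have 2: "(\<Sum>t<N. ?f (d + t)) = (if (p = p' \<and> s = s') \<or> (p = s' \<and> s = p') then 1 / of_nat (d + 1) else 0)"
      using N by simp
    show ?thesis unfolding split[of N] 1 2 add_divide_distrib
      by (cases "p = p'"; cases "s = s'"; cases "p = s'"; cases "s = p'")
         (simp_all del: of_nat_add of_nat_Suc)
  qed
  ultimately show ?thesis unfolding weighted_2_design_def by blast
qed

text \<open>The partial trace of the second moment: over unit vectors the sum on p = p' is 1, while
  the right-hand side gives (d + 1) / (d + 1) on the diagonal.\<close>

lemma weighted_2_design_resolution:
  assumes D: "weighted_2_design d L w \<psi>" and s: "s < d" "s' < d"
  shows "(\<Sum>z<L. complex_of_real (w z) * (\<psi> z s * cnj (\<psi> z s'))) = (if s = s' then 1 else 0)"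
proof -
  have n1: "(\<Sum>p<d. \<psi> z p * cnj (\<psi> z p)) = 1" if "z < L" for z
    using D that norm_sq_complex[of d "\<psi> z"] by (simp add: weighted_2_design_def mult.commute)
  have "(\<Sum>z<L. complex_of_real (w z) * (\<psi> z s * cnj (\<psi> z s'))) =
     (\<Sum>z<L. \<Sum>p<d. complex_of_real (w z) * (\<psi> z p * cnj (\<psi> z p) * \<psi> z s * cnj (\<psi> z s')))"
  proof (intro sum.cong refl)
    fix z assume "z \<in> {..<L}"
    then have "complex_of_real (w z) * (\<psi> z s * cnj (\<psi> z s')) =
       complex_of_real (w z) * ((\<Sum>p<d. \<psi> z p * cnj (\<psi> z p)) * (\<psi> z s * cnj (\<psi> z s')))" using n1 by simp
    then show "complex_of_real (w z) * (\<psi> z s * cnj (\<psi> z s')) =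
       (\<Sum>p<d. complex_of_real (w z) * (\<psi> z p * cnj (\<psi> z p) * \<psi> z s * cnj (\<psi> z s')))"
      by (simp add: sum_distrib_left sum_distrib_right mult_ac)
  qed
  also have "\<dots> = (\<Sum>p<d. \<Sum>z<L. complex_of_real (w z) * (\<psi> z p * cnj (\<psi> z p) * \<psi> z s * cnj (\<psi> z s')))"
    by (rule sum.swap)
  also have "\<dots> = (\<Sum>p<d. ((if s = s' then 1 else 0) + (if p = s then (if s = s' then 1 else 0) else 0)) / of_nat (d + 1))"
    using D s unfolding weighted_2_design_def by (intro sum.cong refl) auto
  also have "\<dots> = (if s = s' then 1 else 0)"
    unfolding sum_divide_distrib[symmetric] sum.distrib using s of_nat_neq_0[of d, where 'a = complex]
    by (auto simp: add.commute)
  finally show ?thesis .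
qed

text \<open>Contracting the second moment with \<open>A\<close> yields (tr A 1 + A) / (d + 1).
  Multiplication by d + 1 and subtraction of tr A times the resolution of the identity leave
  \<open>A\<close>.\<close>

lemma weighted_2_design_frame:
  assumes D: "weighted_2_design d L w \<psi>" and s: "s < d" "s' < d"
  shows "(\<Sum>z<L. (of_nat (d + 1) * (\<Sum>p<d. \<Sum>p'<d. cnj (\<psi> z p) * A p p' * \<psi> z p') - (\<Sum>p<d. A p p)) *
      (complex_of_real (w z) * (\<psi> z s * cnj (\<psi> z s')))) = A s s'"
proof -
  have "(\<Sum>z<L. (\<Sum>p<d. \<Sum>p'<d. cnj (\<psi> z p) * A p p' * \<psi> z p') * (complex_of_real (w z) * (\<psi> z s * cnj (\<psi> z s'))))
    = (\<Sum>z<L. \<Sum>p<d. \<Sum>p'<d. A p p' * (complex_of_real (w z) * (\<psi> z p' * cnj (\<psi> z p) * \<psi> z s * cnj (\<psi> z s'))))"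
    by (simp add: sum_distrib_left sum_distrib_right mult_ac)
  also have "\<dots> = (\<Sum>p<d. \<Sum>z<L. \<Sum>p'<d. A p p' * (complex_of_real (w z) * (\<psi> z p' * cnj (\<psi> z p) * \<psi> z s * cnj (\<psi> z s'))))"
    by (rule sum.swap)
  also have "\<dots> = (\<Sum>p<d. \<Sum>p'<d. \<Sum>z<L. A p p' * (complex_of_real (w z) * (\<psi> z p' * cnj (\<psi> z p) * \<psi> z s * cnj (\<psi> z s'))))"
    by (intro sum.cong refl sum.swap)
  also have "\<dots> = (\<Sum>p<d. \<Sum>p'<d. ((if p' = p then (if s = s' then A p p else 0) else 0) +
      (if p' = s' then (if p = s then A s s' else 0) else 0)) / of_nat (d + 1))"
    unfolding sum_distrib_left[symmetric] using D s unfolding weighted_2_design_def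
    by (intro sum.cong refl) (auto simp del: of_nat_add of_nat_Suc)
  also have "\<dots> = ((if s = s' then (\<Sum>p<d. A p p) else 0) + A s s') / of_nat (d + 1)"
    unfolding sum_divide_distrib[symmetric] sum.distrib using s by simp
  finally have *: "of_nat (d + 1) * (\<Sum>z<L. (\<Sum>p<d. \<Sum>p'<d. cnj (\<psi> z p) * A p p' * \<psi> z p') *
      (complex_of_real (w z) * (\<psi> z s * cnj (\<psi> z s')))) = (if s = s' then (\<Sum>p<d. A p p) else 0) + A s s'"
    by (simp del: of_nat_add of_nat_Suc)
  have affine: "(\<Sum>z<L. (a * f z - b) * g z) = a * (\<Sum>z<L. f z * g z) - b * (\<Sum>z<L. g z)"
    for a b :: complex and f g by (simp add: algebra_simps sum_subtractf sum_distrib_left)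
  have "(\<Sum>z<L. (of_nat (d + 1) * (\<Sum>p<d. \<Sum>p'<d. cnj (\<psi> z p) * A p p' * \<psi> z p') - (\<Sum>p<d. A p p)) *
      (complex_of_real (w z) * (\<psi> z s * cnj (\<psi> z s')))) =
     of_nat (d + 1) * (\<Sum>z<L. (\<Sum>p<d. \<Sum>p'<d. cnj (\<psi> z p) * A p p' * \<psi> z p') *
      (complex_of_real (w z) * (\<psi> z s * cnj (\<psi> z s'))))
     - (\<Sum>p<d. A p p) * (\<Sum>z<L. complex_of_real (w z) * (\<psi> z s * cnj (\<psi> z s')))"
    by (rule affine)
  then show ?thesis unfolding * weighted_2_design_resolution[OF D s] by simp
qed


section \<open>Coordinates of the block algebra\<close>

lemma diag_block_mat_blocks:
  fixes F :: "nat \<Rightarrow> complex mat"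
  assumes "\<And>i. i < k \<Longrightarrow> F i \<in> carrier_mat (s i) (s i)"
  shows "diag_block_mat (map F [0..<k]) \<in> carrier_mat (\<Sum>i<k. s i) (\<Sum>i<k. s i) \<and>
    (\<forall>i<k. \<forall>i'<k. \<forall>x<s i. \<forall>x'<s i'.
      diag_block_mat (map F [0..<k]) $$ ((\<Sum>j<i. s j) + x, (\<Sum>j<i'. s j) + x') =
        (if i = i' then F i $$ (x, x') else 0))"
  using assms
proof (induction k)
  case (Suc k)
  let ?D = "diag_block_mat (map F [0..<k])" and ?o = "\<lambda>i. \<Sum>j<i. s j"
  have IH: "?D \<in> carrier_mat (?o k) (?o k)"
    "\<And>i i' x x'. i < k \<Longrightarrow> i' < k \<Longrightarrow> x < s i \<Longrightarrow> x' < s i' \<Longrightarrow>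
       ?D $$ (?o i + x, ?o i' + x') = (if i = i' then F i $$ (x, x') else 0)"
    using Suc by auto
  have Fk: "F k \<in> carrier_mat (s k) (s k)" using Suc.prems by simp
  have eq: "diag_block_mat (map F [0..<Suc k]) =
      four_block_mat ?D (0\<^sub>m (?o k) (s k)) (0\<^sub>m (s k) (?o k)) (F k)"
    using IH(1) Fk by (simp add: diag_block_mat_last Let_def)
  have less: "?o i + x < ?o k" if "i < k" "x < s i" for i x
  proof -
    have "?o i + x < ?o (Suc i)" using that by simp
    also have "\<dots> \<le> ?o k" using that by (intro sum_mono2) auto
    finally show ?thesis .
  qed
  show ?case
  proof (intro conjI allI impI)
    show "diag_block_mat (map F [0..<Suc k]) \<in> carrier_mat (?o (Suc k)) (?o (Suc k))"
      unfolding eq using IH(1) Fk by (simp add: four_block_carrier_mat)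
    fix i i' x x' assume *: "i < Suc k" "i' < Suc k" "x < s i" "x' < s i'"
    then consider "i < k" "i' < k" | "i < k" "i' = k" | "i = k" "i' < k" | "i = k" "i' = k" by linarith
    then show "diag_block_mat (map F [0..<Suc k]) $$ (?o i + x, ?o i' + x') = (if i = i' then F i $$ (x, x') else 0)"
      unfolding eq
      by cases (use * IH Fk less[of i x] less[of i' x'] in auto)
  qed
qed simp

lemma sum_lessThan_blocks:
  fixes s :: "nat \<Rightarrow> nat"
  shows "(\<Sum>c<(\<Sum>i<k. s i). g c) = (\<Sum>i<k. \<Sum>x<s i. g ((\<Sum>j<i. s j) + x) :: complex)"
  by (induction k) (auto simp: sum_lessThan_add)

text \<open>The image under \<open>U\<close> of the basis vector with index \<open>p\<close> in the
  algebra factor and \<open>q\<close> in the multiplicity factor of summand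
  \<open>i\<close>.\<close>

definition block_vec :: "(nat \<Rightarrow> nat) \<Rightarrow> (nat \<Rightarrow> nat) \<Rightarrow> complex mat \<Rightarrow> nat \<Rightarrow> nat \<Rightarrow> nat \<Rightarrow> nat \<Rightarrow> complex" where
  "block_vec d m U i p q x = U $$ (x, (\<Sum>j<i. d j * m j) + (p * m i + q))"

lemma block_index_less:
  fixes d m :: "nat \<Rightarrow> nat"
  assumes "i < k" "p < d i" "q < m i"
  shows "(\<Sum>j<i. d j * m j) + (p * m i + q) < (\<Sum>i<k. d i * (m i :: nat))"
proof -
  have "(\<Sum>j<i. d j * m j) + (p * m i + q) < (\<Sum>j<Suc i. d j * m j)"
    using mult_add_less[OF assms(2,3)] by simp
  also have "\<dots> \<le> (\<Sum>i<k. d i * m i)" using assms by (intro sum_mono2) auto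
  finally show ?thesis .
qed

lemma block_vec_resolution:
  assumes "block_decomposition n S k d m U" "x < n" "y < n"
  shows "(\<Sum>i<k. \<Sum>p<d i. \<Sum>q<m i. block_vec d m U i p q x * cnj (block_vec d m U i p q y)) =
    (if x = y then 1 else 0)"
proof -
  have n: "(\<Sum>i<k. d i * m i) = n" and U: "U \<in> carrier_mat n n" and UU: "U * mat_adjoint U = 1\<^sub>m n"
    using assms(1) by (auto simp: block_decomposition_def)
  have "(U * mat_adjoint U) $$ (x, y) = (\<Sum>c<n. U $$ (x, c) * cnj (U $$ (y, c)))"
    using assms(2,3) by (subst mat_mult_index[OF U mat_adjoint_dim[OF U]]) (auto simp: mat_adjoint_index[OF U])
  also have "\<dots> = (\<Sum>i<k. \<Sum>p<d i. \<Sum>q<m i. block_vec d m U i p q x * cnj (block_vec d m U i p q y))"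
    unfolding n[symmetric] sum_lessThan_blocks sum_lessThan_mult block_vec_def ..
  finally show ?thesis using UU assms(2,3) by simp
qed

lemma block_vec_orthonormal:
  assumes "block_decomposition n S k d m U" "i < k" "p < d i" "p' < d i"
  shows "(\<Sum>x<n. cnj (block_vec d m U i p 0 x) * block_vec d m U i p' 0 x) = (if p = p' then 1 else 0)"
proof -
  have n: "(\<Sum>i<k. d i * m i) = n" and U: "U \<in> carrier_mat n n" and UU: "mat_adjoint U * U = 1\<^sub>m n"
    and m: "0 < m i"
    using assms(1,2) by (auto simp: block_decomposition_def)
  let ?c = "\<lambda>p. (\<Sum>j<i. d j * m j) + (p * m i + 0)"
  have c: "?c p < n" "?c p' < n" using block_index_less[OF assms(2)] assms(3,4) m n by blast+
  have "(\<Sum>x<n. cnj (block_vec d m U i p 0 x) * block_vec d m U i p' 0 x) = (mat_adjoint U * U) $$ (?c p, ?c p')"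
    using c by (subst mat_mult_index[OF mat_adjoint_dim[OF U] U]) (auto simp: mat_adjoint_index[OF U] block_vec_def)
  then show ?thesis using UU c m by auto
qed

text \<open>\<open>T\<close> acts by one and the same matrix on all \<open>m i\<close> copies, so
  its form on the copy \<open>q = 0\<close> determines it. The expansion thus depends on
  \<open>T\<close> alone and no longer on a chosen representation as an element of
  \<open>S\<close>.\<close>

lemma block_algebra_expand:
  assumes bd: "block_decomposition n S k d m U" and T: "T \<in> S" and xy: "x < n" "y < n"
  shows "T $$ (x, y) = (\<Sum>i<k. \<Sum>p<d i. \<Sum>q<m i. \<Sum>p'<d i.
    block_vec d m U i p q x * sesq n T (block_vec d m U i p 0) (block_vec d m U i p' 0) *
    cnj (block_vec d m U i p' q y))"
proof -
  have n: "(\<Sum>i<k. d i * m i) = n" and U: "U \<in> carrier_mat n n"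
    and UU: "mat_adjoint U * U = 1\<^sub>m n"
    and m: "\<And>i. i < k \<Longrightarrow> 0 < m i"
    using bd by (auto simp: block_decomposition_def)
  note Ua = mat_adjoint_dim[OF U]
  obtain A where A: "\<forall>i<k. A i \<in> carrier_mat (d i) (d i)"
    and TA: "T = U * diag_block_mat (map (\<lambda>i. kron (A i) (1\<^sub>m (m i))) [0..<k]) * mat_adjoint U"
    using bd T by (auto simp: block_decomposition_def)
  define D where "D = diag_block_mat (map (\<lambda>i. kron (A i) (1\<^sub>m (m i))) [0..<k])"
  let ?o = "\<lambda>i. \<Sum>j<i. d j * m j"
  have kc: "kron (A i) (1\<^sub>m (m i)) \<in> carrier_mat (d i * m i) (d i * m i)" if "i < k" for i
    using A that by (auto simp: kron_def)
  note blocks = diag_block_mat_blocks[of k "\<lambda>i. kron (A i) (1\<^sub>m (m i))" "\<lambda>i. d i * m i", OF kc, folded D_def]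
  have Dc: "D \<in> carrier_mat n n" using blocks n by simp
  have De: "D $$ (?o i + (p * m i + q), ?o i' + (p' * m i' + q')) =
      (if i = i' then if q = q' then A i $$ (p, p') else 0 else 0)"
    if "i < k" "i' < k" "p < d i" "p' < d i'" "q < m i" "q' < m i'" for i i' p p' q q'
    using blocks that A mult_add_less[OF that(3,5)] mult_add_less[OF that(4,6)] by (auto simp: kron_def)
  have TD: "T = U * D * mat_adjoint U" by (simp add: TA D_def)
  have Tc: "T \<in> carrier_mat n n" using TD U Dc Ua by simp
  have "mat_adjoint U * T * U = (mat_adjoint U * U) * D * (mat_adjoint U * U)"
    unfolding TD using U Ua Dc by (simp add: assoc_mult_mat[of _ n n _ n _ n])
  then have UTU: "mat_adjoint U * T * U = D" using Dc UU by simp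
  have sesq_D: "sesq n T (\<lambda>x. U $$ (x, c)) (\<lambda>x. U $$ (x, c')) = D $$ (c, c')" if "c < n" "c' < n" for c c'
  proof -
    have "D $$ (c, c') = (\<Sum>y<n. (\<Sum>x<n. cnj (U $$ (x, c)) * T $$ (x, y)) * U $$ (y, c'))"
      unfolding UTU[symmetric] using that Tc Ua U
      by (subst mat_mult_index[of _ n n _ n]) (auto simp: mat_mult_index[OF Ua Tc] mat_adjoint_index[OF U] simp del: index_mult_mat)
    also have "\<dots> = (\<Sum>y<n. \<Sum>x<n. cnj (U $$ (x, c)) * T $$ (x, y) * U $$ (y, c'))"
      by (simp add: sum_distrib_right)
    also have "\<dots> = sesq n T (\<lambda>x. U $$ (x, c)) (\<lambda>x. U $$ (x, c'))"
      unfolding sesq_def by (rule sum.swap)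
    finally show ?thesis by simp
  qed
  \<comment> \<open>The copy \<open>q = 0\<close> exists because \<open>0 < m i\<close>.\<close>
  have Aeq: "sesq n T (block_vec d m U i p 0) (block_vec d m U i p' 0) = A i $$ (p, p')"
    if "i < k" "p < d i" "p' < d i" for i p p'
    using sesq_D[of "?o i + (p * m i + 0)" "?o i + (p' * m i + 0)"] De[of i i p p' 0 0] that m
      block_index_less[of i k p d 0 m] block_index_less[of i k p' d 0 m] n
    by (simp add: block_vec_def[abs_def])
  have "T $$ (x, y) = (\<Sum>c'<n. (\<Sum>c<n. U $$ (x, c) * D $$ (c, c')) * cnj (U $$ (y, c')))"
    unfolding TD using xy Dc Ua U
    by (subst mat_mult_index[of _ n n _ n]) (auto simp: mat_mult_index[OF U Dc] mat_adjoint_index[OF U] simp del: index_mult_mat)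
  also have "\<dots> = (\<Sum>c<n. \<Sum>c'<n. U $$ (x, c) * D $$ (c, c') * cnj (U $$ (y, c')))"
    by (subst sum.swap) (simp add: sum_distrib_right)
  also have "\<dots> = (\<Sum>i<k. \<Sum>p<d i. \<Sum>q<m i. \<Sum>i'<k. \<Sum>p'<d i'. \<Sum>q'<m i'.
     block_vec d m U i p q x * D $$ (?o i + (p * m i + q), ?o i' + (p' * m i' + q')) * cnj (block_vec d m U i' p' q' y))"
    unfolding n[symmetric] sum_lessThan_blocks sum_lessThan_mult block_vec_def ..
  also have "\<dots> = (\<Sum>i<k. \<Sum>p<d i. \<Sum>q<m i. \<Sum>i'<k. \<Sum>p'<d i'. \<Sum>q'<m i'.
     if q' = q then if i' = i then block_vec d m U i p q x * A i $$ (p, p') * cnj (block_vec d m U i p' q y) else 0 else 0)"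
    by (intro sum.cong refl) (auto simp: De)
  also have "\<dots> = (\<Sum>i<k. \<Sum>p<d i. \<Sum>q<m i. \<Sum>i'<k. if i' = i then (\<Sum>p'<d i.
     block_vec d m U i p q x * A i $$ (p, p') * cnj (block_vec d m U i p' q y)) else 0)"
    by (intro sum.cong refl) auto
  also have "\<dots> = (\<Sum>i<k. \<Sum>p<d i. \<Sum>q<m i. \<Sum>p'<d i.
     block_vec d m U i p q x * A i $$ (p, p') * cnj (block_vec d m U i p' q y))" by simp
  finally show ?thesis by (simp add: Aeq)
qed


section \<open>The measurement and its reconstruction frame\<close>

lemma sesq_sum_left:
  "sesq n T (\<lambda>x. \<Sum>p\<in>I. c p * u p x) v = (\<Sum>p\<in>I. cnj (c p) * sesq n T (u p) v)"
proof -
  have "sesq n T (\<lambda>x. \<Sum>p\<in>I. c p * u p x) v =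
      (\<Sum>x<n. \<Sum>p\<in>I. cnj (c p) * (cnj (u p x) * mat_apply n T v x))"
    by (simp add: sesq_mat_apply sum_distrib_left sum_distrib_right mult_ac)
  also have "\<dots> = (\<Sum>p\<in>I. \<Sum>x<n. cnj (c p) * (cnj (u p x) * mat_apply n T v x))" by (rule sum.swap)
  finally show ?thesis by (simp add: sesq_mat_apply sum_distrib_left)
qed

lemma sesq_sum_right:
  "sesq n T v (\<lambda>x. \<Sum>p\<in>I. c p * u p x) = (\<Sum>p\<in>I. c p * sesq n T v (u p))"
proof -
  have "sesq n T v (\<lambda>x. \<Sum>p\<in>I. c p * u p x) = (\<Sum>x<n. \<Sum>p\<in>I. c p * (cnj (v x) * mat_apply n T (u p) x))"
    unfolding sesq_mat_apply mat_apply_sum_scale by (simp add: sum_distrib_left mult_ac)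
  also have "\<dots> = (\<Sum>p\<in>I. \<Sum>x<n. c p * (cnj (v x) * mat_apply n T (u p) x))" by (rule sum.swap)
  finally show ?thesis by (simp add: sesq_mat_apply sum_distrib_left)
qed

text \<open>The coefficient functional of \<open>weighted_2_design_frame\<close>, applied to the
  matrix of \<open>T\<close> with respect to the vectors \<open>b\<close>.\<close>

definition frame_coeff :: "nat \<Rightarrow> nat \<Rightarrow> (nat \<Rightarrow> complex) \<Rightarrow> (nat \<Rightarrow> nat \<Rightarrow> complex) \<Rightarrow> complex mat \<Rightarrow> complex" where
  "frame_coeff n \<delta> \<psi> b T =
    of_nat (\<delta> + 1) * sesq n T (\<lambda>x. \<Sum>p<\<delta>. \<psi> p * b p x) (\<lambda>x. \<Sum>p<\<delta>. \<psi> p * b p x)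
    - (\<Sum>p<\<delta>. sesq n T (b p) (b p))"

text \<open>With b orthonormal, the vectors \<open>b p - cnj (\<psi> p) g\<close> are the images of the b p under the projection
  onto the complement of the unit vector g in their span.\<close>

lemma sum_sesq_complement:
  fixes b :: "nat \<Rightarrow> nat \<Rightarrow> complex"
  assumes "norm_sq \<delta> \<psi> = 1"
  defines "g \<equiv> \<lambda>x. \<Sum>p<\<delta>. \<psi> p * b p x"
  shows "(\<Sum>p<\<delta>. sesq n T (\<lambda>x. b p x + - cnj (\<psi> p) * g x) (\<lambda>x. b p x + - cnj (\<psi> p) * g x)) =
    (\<Sum>p<\<delta>. sesq n T (b p) (b p)) - sesq n T g g"
proof -
  have "sesq n T (\<lambda>x. b p x + - cnj (\<psi> p) * g x) (\<lambda>x. b p x + - cnj (\<psi> p) * g x) =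
     sesq n T (b p) (b p) - cnj (\<psi> p) * sesq n T (b p) g - \<psi> p * sesq n T g (b p)
       + cnj (\<psi> p) * \<psi> p * sesq n T g g" for p
    unfolding sesq_add_left sesq_add_right sesq_scale_left sesq_scale_right by (simp add: algebra_simps)
  then have "(\<Sum>p<\<delta>. sesq n T (\<lambda>x. b p x + - cnj (\<psi> p) * g x) (\<lambda>x. b p x + - cnj (\<psi> p) * g x)) =
     (\<Sum>p<\<delta>. sesq n T (b p) (b p)) - (\<Sum>p<\<delta>. cnj (\<psi> p) * sesq n T (b p) g) - (\<Sum>p<\<delta>. \<psi> p * sesq n T g (b p))
       + (\<Sum>p<\<delta>. cnj (\<psi> p) * \<psi> p) * sesq n T g g"
    by (simp only: sum.distrib sum_subtractf sum_distrib_right)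
  also have "(\<Sum>p<\<delta>. cnj (\<psi> p) * sesq n T (b p) g) = sesq n T g g"
    using sesq_sum_left[where I = "{..<\<delta>}" and c = \<psi> and u = b] by (simp add: g_def)
  also have "(\<Sum>p<\<delta>. \<psi> p * sesq n T g (b p)) = sesq n T g g"
    using sesq_sum_right[where I = "{..<\<delta>}" and c = \<psi> and u = b] by (simp add: g_def)
  also have "(\<Sum>p<\<delta>. cnj (\<psi> p) * \<psi> p) = 1"
    using assms(1) norm_sq_complex[of \<delta> \<psi>] by simp
  finally show ?thesis by simp
qed

lemma norm_sq_tensor:
  "norm_sq (r * n) (\<lambda>i. u (i div n) * g (i mod n)) = norm_sq r u * norm_sq n g"
proof -
  have "norm_sq (r * n) (\<lambda>i. u (i div n) * g (i mod n)) = (\<Sum>a<r. \<Sum>b<n. (cmod (u a))\<^sup>2 * (cmod (g b))\<^sup>2)"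
    unfolding norm_sq_def sum_lessThan_mult
    by (intro sum.cong refl) (auto simp: norm_mult power_mult_distrib)
  then show ?thesis unfolding norm_sq_def[of r] norm_sq_def[of n] sum_product .
qed

text \<open>\<open>H g\<close> is the form of \<open>V\<close> at the product vectors of
  \<open>u\<close> and \<open>v\<close> with \<open>g\<close>, whose norms factorize.\<close>

lemma slice_bound:
  fixes u v :: "nat \<Rightarrow> complex"
  assumes V: "op_bounded (r * n) 1 V"
  defines "H \<equiv> \<lambda>g. \<Sum>a<r. \<Sum>a'<r. cnj (u a) * sesq n (tensor_block n V a a') g g * v a'"
  shows "\<bar>2 * Re (H g)\<bar> \<le> norm_sq n g * (norm_sq r u + norm_sq r v)"
proof -
  let ?t = "\<lambda>u i. u (i div n) * g (i mod n)"
  have H: "H g = sesq (r * n) V (?t u) (?t v)"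
  proof -
    have "sesq n T (\<lambda>b. ?t u (a * n + b)) (\<lambda>b. ?t v (a' * n + b)) = cnj (u a) * sesq n T g g * v a'" for T a a'
    proof -
      have slice: "sesq n T (\<lambda>b. ?t u (a * n + b)) (\<lambda>b. ?t v (a' * n + b)) = sesq n T (\<lambda>b. u a * g b) (\<lambda>b. v a' * g b)"
        by (intro sesq_cong) auto
      show ?thesis unfolding slice sesq_scale_left sesq_scale_right by (simp only: mult_ac)
    qed
    then show ?thesis unfolding H_def sesq_tensor by simp
  qed
  \<comment> \<open>The values 1 and -1 of \<open>c\<close> give the two sides of the absolute
    value.\<close>
  have "2 * Re (sesq (r * n) V (\<lambda>i. c * ?t u i) (?t v)) \<le>
      1 * (norm_sq (r * n) (\<lambda>i. c * ?t u i) + norm_sq (r * n) (?t v))" for c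
    using V unfolding op_bounded_def by blast
  from this[of 1] this[of "-1"] show ?thesis
    unfolding sesq_scale_left norm_sq_scale norm_sq_tensor H[symmetric]
    by (simp add: algebra_simps abs_le_iff)
qed

text \<open>Splitting the span of \<open>b\<close> into \<open>g\<close> and its complement, the
  functional is \<delta> times the slice along \<open>g\<close> minus slices of total mass \<delta>
  - 1. The two masses add up to 2 \<delta> - 1.\<close>

lemma frame_coeff_bound:
  assumes V: "op_bounded (r * n) 1 V" and \<psi>: "norm_sq \<delta> \<psi> = 1"
    and b: "\<And>p p'. p < \<delta> \<Longrightarrow> p' < \<delta> \<Longrightarrow> (\<Sum>x<n. cnj (b p x) * b p' x) = (if p = p' then 1 else 0)"
  shows "2 * Re (\<Sum>a<r. \<Sum>a'<r. cnj (u a) * frame_coeff n \<delta> \<psi> b (tensor_block n V a a') * v a') \<le>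
    2 * real \<delta> * (norm_sq r u + norm_sq r v)"
proof -
  define g where "g = (\<lambda>x. \<Sum>p<\<delta>. \<psi> p * b p x)"
  define \<kappa> where "\<kappa> = (\<lambda>p x. b p x + - cnj (\<psi> p) * g x)"
  define H where "H = (\<lambda>g. \<Sum>a<r. \<Sum>a'<r. cnj (u a) * sesq n (tensor_block n V a a') g g * v a')"
  let ?N = "norm_sq r u + norm_sq r v"
  have fc: "frame_coeff n \<delta> \<psi> b T = of_nat \<delta> * sesq n T g g - (\<Sum>p<\<delta>. sesq n T (\<kappa> p) (\<kappa> p))" for T
    unfolding \<kappa>_def g_def sum_sesq_complement[OF \<psi>] frame_coeff_def by (simp add: algebra_simps)
  have ns: "complex_of_real (norm_sq n f) = sesq n (1\<^sub>m n) f f" for f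
    by (simp add: norm_sq_complex sesq_one)
  have "sesq n (1\<^sub>m n) g g = (\<Sum>p<\<delta>. \<Sum>p'<\<delta>. if p' = p then cnj (\<psi> p) * \<psi> p else 0)"
    unfolding g_def sesq_sum_left sesq_sum_right sesq_one sum_distrib_left
    by (intro sum.cong refl) (auto simp: b sum_distrib_left[symmetric])
  also have "\<dots> = 1" using \<psi> norm_sq_complex[of \<delta> \<psi>] by simp
  finally have g1: "sesq n (1\<^sub>m n) g g = 1" .
  then have ng: "norm_sq n g = 1" using ns[of g] by simp
  \<comment> \<open>The total mass is the trace of the projection onto the complement of
    \<open>g\<close>, obtained from \<open>sum_sesq_complement\<close> at the identity
    matrix.\<close>
  have "complex_of_real (\<Sum>p<\<delta>. norm_sq n (\<kappa> p)) = (\<Sum>p<\<delta>. sesq n (1\<^sub>m n) (b p) (b p)) - 1"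
    unfolding of_real_sum ns unfolding \<kappa>_def g_def sum_sesq_complement[OF \<psi>] unfolding g_def[symmetric] g1 ..
  also have "\<dots> = complex_of_real (real \<delta> - 1)" by (simp add: sesq_one b)
  finally have nk: "(\<Sum>p<\<delta>. norm_sq n (\<kappa> p)) = real \<delta> - 1" using of_real_eq_iff by blast
  have "(\<Sum>a<r. \<Sum>a'<r. cnj (u a) * frame_coeff n \<delta> \<psi> b (tensor_block n V a a') * v a') =
     of_nat \<delta> * H g - (\<Sum>a<r. \<Sum>a'<r. \<Sum>p<\<delta>. cnj (u a) * sesq n (tensor_block n V a a') (\<kappa> p) (\<kappa> p) * v a')"
    unfolding fc H_def
    by (simp add: sum_distrib_left sum_distrib_right sum_subtractf left_diff_distrib right_diff_distrib mult_ac)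
  also have "(\<Sum>a<r. \<Sum>a'<r. \<Sum>p<\<delta>. cnj (u a) * sesq n (tensor_block n V a a') (\<kappa> p) (\<kappa> p) * v a') =
     (\<Sum>a<r. \<Sum>p<\<delta>. \<Sum>a'<r. cnj (u a) * sesq n (tensor_block n V a a') (\<kappa> p) (\<kappa> p) * v a')"
    by (intro sum.cong refl sum.swap)
  also have "\<dots> = (\<Sum>p<\<delta>. H (\<kappa> p))" unfolding H_def by (rule sum.swap)
  finally have sum_eq: "(\<Sum>a<r. \<Sum>a'<r. cnj (u a) * frame_coeff n \<delta> \<psi> b (tensor_block n V a a') * v a') =
     of_nat \<delta> * H g - (\<Sum>p<\<delta>. H (\<kappa> p))" .
  have "2 * Re (\<Sum>a<r. \<Sum>a'<r. cnj (u a) * frame_coeff n \<delta> \<psi> b (tensor_block n V a a') * v a') =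
     real \<delta> * (2 * Re (H g)) - (\<Sum>p<\<delta>. 2 * Re (H (\<kappa> p)))"
    unfolding sum_eq by (simp add: sum_distrib_left algebra_simps)
  also have "\<dots> = real \<delta> * (2 * Re (H g)) + (\<Sum>p<\<delta>. - (2 * Re (H (\<kappa> p))))"
    by (simp add: sum_negf)
  also have "\<dots> \<le> real \<delta> * (norm_sq n g * ?N) + (\<Sum>p<\<delta>. norm_sq n (\<kappa> p) * ?N)"
  proof (intro add_mono mult_left_mono sum_mono)
    show "2 * Re (H g) \<le> norm_sq n g * ?N"
      using slice_bound[OF V, where u = u and v = v and g = g] unfolding H_def by linarith
    show "- (2 * Re (H (\<kappa> p))) \<le> norm_sq n (\<kappa> p) * ?N" for p
      using slice_bound[OF V, where u = u and v = v and g = "\<kappa> p"] unfolding H_def by linarith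
  qed simp
  also have "\<dots> = (2 * real \<delta> - 1) * ?N"
    unfolding ng sum_distrib_right[symmetric] nk by (simp add: algebra_simps)
  also have "\<dots> \<le> 2 * real \<delta> * ?N"
    using norm_sq_nonneg[of r u] norm_sq_nonneg[of r v] by (intro mult_right_mono) auto
  finally show ?thesis .
qed

section \<open>The measurement along designs in the blocks\<close>

text \<open>The projection onto \<psi>, weighted by \<open>w\<close> and tensored with the identity
  of the multiplicity space, in the coordinates \<open>b\<close>. Repetition over all
  \<open>q\<close> is what lets data read on one copy restore the whole block.\<close>

definition block_effect ::
  "nat \<Rightarrow> nat \<Rightarrow> nat \<Rightarrow> real \<Rightarrow> (nat \<Rightarrow> complex) \<Rightarrow> (nat \<Rightarrow> nat \<Rightarrow> nat \<Rightarrow> complex) \<Rightarrow> complex mat" where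
  "block_effect n \<delta> \<mu> w \<psi> b = mat n n (\<lambda>(x, y). complex_of_real w *
     (\<Sum>q<\<mu>. (\<Sum>p<\<delta>. \<psi> p * b p q x) * cnj (\<Sum>p<\<delta>. \<psi> p * b p q y)))"

lemma psd_block_effect:
  assumes "0 \<le> w"
  shows "psd n (block_effect n \<delta> \<mu> w \<psi> b)"
  unfolding psd_iff_sesq
proof (intro conjI allI)
  fix u
  define g where "g = (\<lambda>q x. \<Sum>p<\<delta>. \<psi> p * b p q x)"
  have index: "block_effect n \<delta> \<mu> w \<psi> b $$ (x, y) = complex_of_real w * (\<Sum>q<\<mu>. g q x * cnj (g q y))"
    if "x < n" "y < n" for x y
    using that by (simp add: block_effect_def g_def)
  have "sesq n (block_effect n \<delta> \<mu> w \<psi> b) u u =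
     (\<Sum>x<n. \<Sum>y<n. \<Sum>q<\<mu>. complex_of_real w * (cnj (u x) * g q x * (cnj (g q y) * u y)))"
    unfolding sesq_def by (intro sum.cong refl) (simp add: index sum_distrib_left sum_distrib_right mult_ac)
  also have "\<dots> = (\<Sum>x<n. \<Sum>q<\<mu>. \<Sum>y<n. complex_of_real w * (cnj (u x) * g q x * (cnj (g q y) * u y)))"
    by (intro sum.cong refl sum.swap)
  also have "\<dots> = (\<Sum>q<\<mu>. \<Sum>x<n. \<Sum>y<n. complex_of_real w * (cnj (u x) * g q x * (cnj (g q y) * u y)))"
    by (rule sum.swap)
  also have "\<dots> = (\<Sum>q<\<mu>. complex_of_real w * ((\<Sum>x<n. cnj (u x) * g q x) * cnj (\<Sum>x<n. cnj (u x) * g q x)))"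
    by (simp add: sum_distrib_left sum_distrib_right mult_ac)
  also have "\<dots> = complex_of_real (\<Sum>q<\<mu>. w * (cmod (\<Sum>x<n. cnj (u x) * g q x))\<^sup>2)"
    unfolding of_real_sum of_real_mult complex_norm_square ..
  finally have "sesq n (block_effect n \<delta> \<mu> w \<psi> b) u u =
     complex_of_real (\<Sum>q<\<mu>. w * (cmod (\<Sum>x<n. cnj (u x) * g q x))\<^sup>2)" .
  moreover have "0 \<le> (\<Sum>q<\<mu>. w * (cmod (\<Sum>x<n. cnj (u x) * g q x))\<^sup>2)"
    using assms by (intro sum_nonneg) auto
  ultimately show "0 \<le> sesq n (block_effect n \<delta> \<mu> w \<psi> b) u u"
    by (simp add: less_eq_complex_def del: of_real_sum of_real_mult)
qed (simp add: block_effect_def)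

text \<open>Lifts an identity between \<delta> by \<delta> matrices to the whole space. It serves
  twice: with \<open>c = 1\<close> for completeness of the measurement, and with the frame
  coefficients for reconstruction.\<close>

lemma sum_block_effects:
  assumes xy: "x < n" "y < n"
    and A: "\<And>p p'. p < \<delta> \<Longrightarrow> p' < \<delta> \<Longrightarrow>
      (\<Sum>z<L. c z * (complex_of_real (w z) * (\<psi> z p * cnj (\<psi> z p')))) = A p p'"
  shows "(\<Sum>z<L. c z * block_effect n \<delta> \<mu> (w z) (\<psi> z) b $$ (x, y)) =
    (\<Sum>p<\<delta>. \<Sum>q<\<mu>. \<Sum>p'<\<delta>. b p q x * A p p' * cnj (b p' q y))"
proof -
  let ?F = "\<lambda>z q p p'. c z * (complex_of_real (w z) * (\<psi> z p * cnj (\<psi> z p'))) * (b p q x * cnj (b p' q y))"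
  have "(\<Sum>z<L. c z * block_effect n \<delta> \<mu> (w z) (\<psi> z) b $$ (x, y)) =
    (\<Sum>z<L. \<Sum>q<\<mu>. \<Sum>p<\<delta>. \<Sum>p'<\<delta>. ?F z q p p')"
  proof (intro sum.cong refl)
    fix z
    have "(\<Sum>p<\<delta>. \<psi> z p * b p q x) * cnj (\<Sum>p<\<delta>. \<psi> z p * b p q y) =
       (\<Sum>p<\<delta>. \<Sum>p'<\<delta>. (\<psi> z p * cnj (\<psi> z p')) * (b p q x * cnj (b p' q y)))" for q
      unfolding cnj_sum sum_product by (intro sum.cong refl) simp
    then show "c z * block_effect n \<delta> \<mu> (w z) (\<psi> z) b $$ (x, y) = (\<Sum>q<\<mu>. \<Sum>p<\<delta>. \<Sum>p'<\<delta>. ?F z q p p')"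
      using xy by (simp only: block_effect_def index_mat prod.case) (simp add: sum_distrib_left mult.assoc)
  qed
  also have "\<dots> = (\<Sum>q<\<mu>. \<Sum>z<L. \<Sum>p<\<delta>. \<Sum>p'<\<delta>. ?F z q p p')" by (rule sum.swap)
  also have "\<dots> = (\<Sum>q<\<mu>. \<Sum>p<\<delta>. \<Sum>z<L. \<Sum>p'<\<delta>. ?F z q p p')" by (intro sum.cong refl sum.swap)
  also have "\<dots> = (\<Sum>q<\<mu>. \<Sum>p<\<delta>. \<Sum>p'<\<delta>. \<Sum>z<L. ?F z q p p')" by (intro sum.cong refl sum.swap)
  also have "\<dots> = (\<Sum>q<\<mu>. \<Sum>p<\<delta>. \<Sum>p'<\<delta>. b p q x * A p p' * cnj (b p' q y))"
    unfolding sum_distrib_right[symmetric] using A by (intro sum.cong refl) auto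
  also have "\<dots> = (\<Sum>p<\<delta>. \<Sum>q<\<mu>. \<Sum>p'<\<delta>. b p q x * A p p' * cnj (b p' q y))" by (rule sum.swap)
  finally show ?thesis .
qed

lemma block_measurement_frame:
  assumes bd: "block_decomposition n S k d m U" and Dd: "\<And>i. i < k \<Longrightarrow> d i \<le> D"
  shows "\<exists>l M f. povm n l M \<and>
    (\<forall>T\<in>S. \<forall>x<n. \<forall>y<n. T $$ (x, y) = (\<Sum>z<l. f z T * M z $$ (x, y))) \<and>
    (\<forall>r V z u v. op_bounded (r * n) 1 V \<longrightarrow> z < l \<longrightarrow>
      2 * Re (\<Sum>a<r. \<Sum>a'<r. cnj (u a) * f z (tensor_block n V a a') * v a')
        \<le> 2 * real D * (norm_sq r u + norm_sq r v))"
proof -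
  let ?b = "block_vec d m U"
  have "\<forall>i<k. \<exists>L w \<psi>. weighted_2_design (d i) L w \<psi>"
    using bd weighted_2_design_exists by (auto simp: block_decomposition_def)
  then obtain L w \<psi> where des: "\<And>i. i < k \<Longrightarrow> weighted_2_design (d i) (L i) (w i) (\<psi> i)" by metis
  \<comment> \<open>An outcome is a block together with a design vector in it; \<open>h\<close>
    numbers these pairs, since outcomes are initial segments of the naturals.\<close>
  define J where "J = Sigma {..<k} (\<lambda>i. {..<L i})"
  have "finite J" by (simp add: J_def)
  then obtain h where h: "bij_betw h {0..<card J} J" using ex_bij_betw_nat_finite by blast
  define l where "l = card J"
  define N where "N = (\<lambda>(i, z). block_effect n (d i) (m i) (w i z) (\<psi> i z) (?b i))"
  define c where "c = (\<lambda>(i, z). frame_coeff n (d i) (\<psi> i z) (\<lambda>p. ?b i p 0))"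
  have reindex: "(\<Sum>z<l. g (h z)) = (\<Sum>i<k. \<Sum>z<L i. g (i, z) :: complex)" for g
  proof -
    have "(\<Sum>z<l. g (h z)) = sum g J"
      using sum.reindex_bij_betw[OF h, of g] by (simp add: l_def atLeast0LessThan)
    then show ?thesis unfolding J_def by (simp add: sum.Sigma)
  qed
  have hJ: "fst (h z) < k" "snd (h z) < L (fst (h z))" if "z < l" for z
  proof -
    have "h z \<in> J" using h that by (auto simp: bij_betw_def l_def)
    then show "fst (h z) < k" "snd (h z) < L (fst (h z))" by (auto simp: J_def)
  qed
  have "povm n l (\<lambda>z. N (h z))"
    unfolding povm_def
  proof (intro conjI allI impI)
    fix z assume "z < l"
    then show "psd n (N (h z))"
      using hJ[of z] des[of "fst (h z)"]
      by (auto simp: N_def weighted_2_design_def case_prod_beta intro!: psd_block_effect)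
  next
    show "mat n n (\<lambda>(x, y). \<Sum>z<l. N (h z) $$ (x, y)) = 1\<^sub>m n"
    proof (rule eq_matI)
      fix x y assume "x < dim_row (1\<^sub>m n)" "y < dim_col (1\<^sub>m n)"
      then have xy: "x < n" "y < n" by auto
      have "(\<Sum>z<l. N (h z) $$ (x, y)) = (\<Sum>i<k. \<Sum>z<L i. 1 * block_effect n (d i) (m i) (w i z) (\<psi> i z) (?b i) $$ (x, y))"
        unfolding reindex[of "\<lambda>j. N j $$ (x, y)"] by (simp add: N_def)
      also have "\<dots> = (\<Sum>i<k. \<Sum>p<d i. \<Sum>q<m i. \<Sum>p'<d i. ?b i p q x * (if p = p' then 1 else 0) * cnj (?b i p' q y))"
        using weighted_2_design_resolution[OF des]
        by (intro sum.cong[OF refl] sum_block_effects[OF xy]) auto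
      also have "\<dots> = (\<Sum>i<k. \<Sum>p<d i. \<Sum>q<m i. \<Sum>p'<d i. if p' = p then ?b i p q x * cnj (?b i p q y) else 0)"
        by (intro sum.cong refl) auto
      also have "\<dots> = (if x = y then 1 else 0)"
        using block_vec_resolution[OF bd xy] by simp
      finally show "mat n n (\<lambda>(x, y). \<Sum>z<l. N (h z) $$ (x, y)) $$ (x, y) = 1\<^sub>m n $$ (x, y)"
        using xy by simp
    qed auto
  qed
  moreover have "T $$ (x, y) = (\<Sum>z<l. c (h z) T * N (h z) $$ (x, y))"
    if T: "T \<in> S" and xy: "x < n" "y < n" for T x y
  proof -
    have "(\<Sum>z<l. c (h z) T * N (h z) $$ (x, y)) =
      (\<Sum>i<k. \<Sum>z<L i. frame_coeff n (d i) (\<psi> i z) (\<lambda>p. ?b i p 0) T *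
         block_effect n (d i) (m i) (w i z) (\<psi> i z) (?b i) $$ (x, y))"
      unfolding reindex[of "\<lambda>j. c j T * N j $$ (x, y)"] by (simp add: N_def c_def)
    also have "\<dots> = (\<Sum>i<k. \<Sum>p<d i. \<Sum>q<m i. \<Sum>p'<d i.
        ?b i p q x * sesq n T (?b i p 0) (?b i p' 0) * cnj (?b i p' q y))"
    proof (intro sum.cong[OF refl] sum_block_effects[OF xy])
      fix i p p' assume i: "i \<in> {..<k}" and p: "p < d i" "p' < d i"
      have "frame_coeff n (d i) (\<psi> i z) (\<lambda>p. ?b i p 0) T = of_nat (d i + 1) *
          (\<Sum>p<d i. \<Sum>p'<d i. cnj (\<psi> i z p) * sesq n T (?b i p 0) (?b i p' 0) * \<psi> i z p')
          - (\<Sum>p<d i. sesq n T (?b i p 0) (?b i p 0))" for z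
        unfolding frame_coeff_def sesq_sum_left sesq_sum_right by (simp add: sum_distrib_left mult_ac)
      then show "(\<Sum>z<L i. frame_coeff n (d i) (\<psi> i z) (\<lambda>p. ?b i p 0) T *
          (complex_of_real (w i z) * (\<psi> i z p * cnj (\<psi> i z p')))) = sesq n T (?b i p 0) (?b i p' 0)"
        using weighted_2_design_frame[OF des p, of "\<lambda>p p'. sesq n T (?b i p 0) (?b i p' 0)"] i by simp
    qed
    also have "\<dots> = T $$ (x, y)" by (rule block_algebra_expand[OF bd T xy, symmetric])
    finally show ?thesis by simp
  qed
  moreover have "2 * Re (\<Sum>a<r. \<Sum>a'<r. cnj (u a) * c (h z) (tensor_block n V a a') * v a')
        \<le> 2 * real D * (norm_sq r u + norm_sq r v)"
    if V: "op_bounded (r * n) 1 V" and z: "z < l" for r V z u v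
  proof -
    obtain i y where hz: "h z = (i, y)" by force
    have i: "i < k" "y < L i" using hJ[OF z] by (auto simp: hz)
    have "2 * Re (\<Sum>a<r. \<Sum>a'<r. cnj (u a) * c (h z) (tensor_block n V a a') * v a')
        \<le> 2 * real (d i) * (norm_sq r u + norm_sq r v)"
      unfolding hz c_def prod.case
      using des[OF i(1)] i block_vec_orthonormal[OF bd i(1)]
      by (intro frame_coeff_bound[OF V]) (auto simp: weighted_2_design_def)
    also have "\<dots> \<le> 2 * real D * (norm_sq r u + norm_sq r v)"
      using Dd[OF i(1)] norm_sq_nonneg[of r u] norm_sq_nonneg[of r v] by (intro mult_right_mono) auto
    finally show ?thesis .
  qed
  ultimately show ?thesis by (intro exI[of _ l] exI[of _ "\<lambda>z. N (h z)"] exI[of _ "\<lambda>z. c (h z)"]) blast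
qed

section \<open>Trace pairing with the measured operator\<close>

lemma mat_trace_comm:
  assumes "A \<in> carrier_mat n n" "B \<in> carrier_mat n n"
  shows "mat_trace (A * B) = mat_trace (B * A)"
  unfolding mat_trace_mult[OF assms] mat_trace_mult[OF assms(2,1)]
  by (subst sum.swap) (simp add: mult.commute)

text \<open>Makes \<open>trace_norm_bound\<close> applicable to the measured operator.\<close>

lemma qc_output_hermitian:
  assumes X: "X \<in> carrier_mat (r * n) (r * n)" "mat_adjoint X = X" and M: "\<And>z. z < l \<Longrightarrow> psd n (M z)"
  shows "mat_adjoint (id_tensor r n l (qc_channel l M) X) = id_tensor r n l (qc_channel l M) X"
proof (rule tensor_eqI)
  note Zc = id_tensor_carrier[of r n l "qc_channel l M" X]
  show "mat_adjoint (id_tensor r n l (qc_channel l M) X) \<in> carrier_mat (r * l) (r * l)"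
    by (rule mat_adjoint_dim[OF Zc])
  fix a a' z z' assume az: "a < r" "a' < r" "z < l" "z' < l"
  have "cnj (mat_trace (M z * tensor_block n X a' a)) = mat_trace (M z * tensor_block n X a a')"
  proof -
    have Mc: "M z \<in> carrier_mat n n" using M[OF az(3)] by (simp add: psd_def)
    have Xh: "cnj (X $$ (a' * n + i, a * n + j)) = X $$ (a * n + j, a' * n + i)" if "i < n" "j < n" for i j
      using hermitian_index[OF X, of "a * n + j" "a' * n + i"] that az by (simp add: mult_add_less)
    have "cnj (mat_trace (M z * tensor_block n X a' a)) =
       (\<Sum>i<n. \<Sum>j<n. M z $$ (j, i) * X $$ (a * n + i, a' * n + j))"
      unfolding mat_trace_mult[OF Mc tensor_block_carrier] cnj_sum
      by (intro sum.cong refl) (auto simp: Xh psd_hermitian[OF M[OF az(3)], symmetric])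
    also have "\<dots> = mat_trace (M z * tensor_block n X a a')"
      unfolding mat_trace_mult[OF Mc tensor_block_carrier] by (subst sum.swap) simp
    finally show ?thesis .
  qed
  then show "mat_adjoint (id_tensor r n l (qc_channel l M) X) $$ (a * l + z, a' * l + z') =
      id_tensor r n l (qc_channel l M) X $$ (a * l + z, a' * l + z')"
    using az by (subst mat_adjoint_index[OF Zc]) (auto simp: mult_add_less id_tensor_index qc_channel_def)
qed simp

text \<open>The coefficients are moved from the effects to the other side of the pairing. The
  measured operator is diagonal in the outcome, so they may be placed on the outcome diagonal, where
  the norm is a maximum over outcomes.\<close>

lemma mat_trace_measured:
  assumes X: "X \<in> carrier_mat (r * n) (r * n)" and M: "\<And>z. z < l \<Longrightarrow> M z \<in> carrier_mat n n"
    and W: "W \<in> carrier_mat (r * n) (r * n)"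
    and WM: "\<And>a a' x y. a < r \<Longrightarrow> a' < r \<Longrightarrow> x < n \<Longrightarrow> y < n \<Longrightarrow>
      tensor_block n W a a' $$ (x, y) = (\<Sum>z<l. G z a a' * M z $$ (x, y))"
  shows "mat_trace (X * W) = mat_trace (id_tensor r n l (qc_channel l M) X *
    mat (r * l) (r * l) (\<lambda>(i, j). if i mod l = j mod l then G (i mod l) (i div l) (j div l) else 0))"
    (is "_ = mat_trace (?Z * ?G)")
proof -
  have Gc: "?G \<in> carrier_mat (r * l) (r * l)" by simp
  show ?thesis
    unfolding mat_trace_tensor[OF X W] mat_trace_tensor[OF id_tensor_carrier Gc]
  proof (intro sum.cong refl)
    fix a a' assume "a \<in> {..<r}" "a' \<in> {..<r}"
    then have a: "a < r" "a' < r" by auto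
    have "mat_trace (tensor_block l ?Z a a' * tensor_block l ?G a' a) =
       (\<Sum>z<l. \<Sum>z'<l. if z' = z then mat_trace (M z * tensor_block n X a a') * G z a' a else 0)"
      unfolding mat_trace_mult[OF tensor_block_carrier tensor_block_carrier]
      using a by (intro sum.cong refl) (auto simp: id_tensor_index qc_channel_def mult_add_less)
    also have "\<dots> = (\<Sum>z<l. \<Sum>x<n. \<Sum>y<n. tensor_block n X a a' $$ (x, y) * (G z a' a * M z $$ (y, x)))"
      by (simp add: mat_trace_comm[OF M tensor_block_carrier] mat_trace_mult[OF tensor_block_carrier M]
          sum_distrib_left sum_distrib_right mult_ac)
    also have "\<dots> = (\<Sum>x<n. \<Sum>z<l. \<Sum>y<n. tensor_block n X a a' $$ (x, y) * (G z a' a * M z $$ (y, x)))"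
      by (rule sum.swap)
    also have "\<dots> = (\<Sum>x<n. \<Sum>y<n. \<Sum>z<l. tensor_block n X a a' $$ (x, y) * (G z a' a * M z $$ (y, x)))"
      by (intro sum.cong refl sum.swap)
    also have "\<dots> = mat_trace (tensor_block n X a a' * tensor_block n W a' a)"
      unfolding mat_trace_mult[OF tensor_block_carrier tensor_block_carrier] sum_distrib_left[symmetric]
      using WM a by (intro sum.cong refl) auto
    finally show "mat_trace (tensor_block n X a a' * tensor_block n W a' a) =
      mat_trace (tensor_block l ?Z a a' * tensor_block l ?G a' a)" by simp
  qed
qed

text \<open>A vector splits into one slice per outcome, and the squared norms of the slices add
  up.\<close>

lemma op_bounded_diagonal_blocks:
  assumes "\<And>z u v. z < l \<Longrightarrow> 2 * Re (\<Sum>a<r. \<Sum>a'<r. cnj (u a) * G z a a' * v a') \<le> c * (norm_sq r u + norm_sq r v)"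
  shows "op_bounded (r * l) c
    (mat (r * l) (r * l) (\<lambda>(i, j). if i mod l = j mod l then G (i mod l) (i div l) (j div l) else 0))"
    (is "op_bounded _ _ ?G")
  unfolding op_bounded_def
proof (intro conjI allI)
  fix u v :: "nat \<Rightarrow> complex"
  have "sesq (r * l) ?G u v = (\<Sum>a<r. \<Sum>a'<r. \<Sum>z<l. \<Sum>z'<l.
     if z' = z then cnj (u (a * l + z)) * G z a a' * v (a' * l + z) else 0)"
    unfolding sesq_tensor unfolding sesq_def
    by (intro sum.cong refl) (auto simp: mult_add_less)
  also have "\<dots> = (\<Sum>a<r. \<Sum>a'<r. \<Sum>z<l. cnj (u (a * l + z)) * G z a a' * v (a' * l + z))" by simp
  also have "\<dots> = (\<Sum>a<r. \<Sum>z<l. \<Sum>a'<r. cnj (u (a * l + z)) * G z a a' * v (a' * l + z))"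
    by (intro sum.cong refl sum.swap)
  also have "\<dots> = (\<Sum>z<l. \<Sum>a<r. \<Sum>a'<r. cnj (u (a * l + z)) * G z a a' * v (a' * l + z))"
    by (rule sum.swap)
  finally have "2 * Re (sesq (r * l) ?G u v) =
     (\<Sum>z<l. 2 * Re (\<Sum>a<r. \<Sum>a'<r. cnj (u (a * l + z)) * G z a a' * v (a' * l + z)))"
    by (simp only: Re_sum sum_distrib_left)
  also have "\<dots> \<le> (\<Sum>z<l. c * (norm_sq r (\<lambda>a. u (a * l + z)) + norm_sq r (\<lambda>a. v (a * l + z))))"
    using assms by (intro sum_mono) auto
  also have "\<dots> = c * (norm_sq (r * l) u + norm_sq (r * l) v)"
  proof -
    have "norm_sq (r * l) f = (\<Sum>z<l. norm_sq r (\<lambda>a. f (a * l + z)))" for f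
      unfolding norm_sq_def sum_lessThan_mult by (rule sum.swap)
    then show ?thesis by (simp only: sum.distrib sum_distrib_left distrib_left)
  qed
  finally show "2 * Re (sesq (r * l) ?G u v) \<le> c * (norm_sq (r * l) u + norm_sq (r * l) v)" .
qed simp

section \<open>The trace norm comparison\<close>

theorem proposition4p9:
  fixes dA dB k :: nat
    and \<Phi> :: "complex mat \<Rightarrow> complex mat"
    and \<rho> U :: "complex mat"
    and d m :: "nat \<Rightarrow> nat"
  assumes channel: "heisenberg_channel dB \<Phi>"
    and full_rank_fixed_point:
      "\<rho> \<in> carrier_mat dB dB" "hs_dual dB \<Phi> \<rho> = \<rho>" "vec_space.rank dB \<rho> = dB"
    and blocks: "block_decomposition dB (Fix dB \<Phi>) k d m U"
  shows "\<exists>l M. povm dB l M \<and>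
    (\<forall>X \<in> carrier_mat (dA * dB) (dA * dB).
       mat_adjoint X = X \<longrightarrow>
       id_tensor dA dB dB (hs_dual dB (ergodic_proj dB \<Phi>)) X = X \<longrightarrow>
       (\<forall>i<k. mat_trace (kron (1\<^sub>m dA) (block_proj k d m U i) * X) = 0) \<longrightarrow>
       trace_norm X \<le>
         2 * real (Max (d ` {..<k})) * trace_norm (id_tensor dA dB l (qc_channel l M) X))"
proof -
  let ?D = "Max (d ` {..<k})" and ?E = "ergodic_proj dB \<Phi>"
  \<comment> \<open>If \<open>dB = 0\<close> there is no block and \<open>Max\<close> is taken of
    the empty set; the frame bound then has no block to compare.\<close>
  have "d i \<le> ?D" if "i < k" for i using that by simp
  then obtain l M f where M: "povm dB l M"
    and frame: "\<forall>T\<in>Fix dB \<Phi>. \<forall>x<dB. \<forall>y<dB. T $$ (x, y) = (\<Sum>z<l. f z T * M z $$ (x, y))"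
    and bound: "\<forall>r V z u v. op_bounded (r * dB) 1 V \<longrightarrow> z < l \<longrightarrow>
      2 * Re (\<Sum>a<r. \<Sum>a'<r. cnj (u a) * f z (tensor_block dB V a a') * v a')
        \<le> 2 * real ?D * (norm_sq r u + norm_sq r v)"
    using block_measurement_frame[OF blocks, of ?D] by blast
  have psdM: "psd dB (M z)" if "z < l" for z using M that by (simp add: povm_def)
  have Mc: "M z \<in> carrier_mat dB dB" if "z < l" for z using psdM[OF that] by (simp add: psd_def)
  have "trace_norm X \<le> 2 * real ?D * trace_norm (id_tensor dA dB l (qc_channel l M) X)"
    if X: "X \<in> carrier_mat (dA * dB) (dA * dB)" "mat_adjoint X = X"
      and EX: "id_tensor dA dB dB (hs_dual dB ?E) X = X" for X
  proof -
    let ?Z = "id_tensor dA dB l (qc_channel l M) X"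
    obtain V where V: "op_bounded (dA * dB) 1 V" and XV: "mat_trace (X * V) = complex_of_real (trace_norm X)"
      using trace_norm_attained[OF X] by blast
    define W where "W = id_tensor dA dB dB ?E V"
    have Vc: "V \<in> carrier_mat (dA * dB) (dA * dB)" using V by (simp add: op_bounded_def)
    have W: "op_bounded (dA * dB) 1 W"
      unfolding W_def by (rule id_tensor_ergodic_proj_op_bounded[OF channel V])
    have XW: "mat_trace (X * W) = mat_trace (X * V)"
      using mat_trace_id_tensor_dual[OF ergodic_proj_linear[OF channel] X(1) Vc] by (simp add: EX W_def)
    define G where "G = (\<lambda>z a a'. f z (tensor_block dB W a a'))"
    let ?G = "mat (dA * l) (dA * l) (\<lambda>(i, j). if i mod l = j mod l then G (i mod l) (i div l) (j div l) else 0)"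
    have W_frame: "tensor_block dB W a a' $$ (x, y) = (\<Sum>z<l. G z a a' * M z $$ (x, y))"
      if "a < dA" "a' < dA" "x < dB" "y < dB" for a a' x y
    proof -
      have "tensor_block dB W a a' = ?E (tensor_block dB V a a')"
        unfolding W_def using that by (intro tensor_block_id_tensor) auto
      then have "tensor_block dB W a a' \<in> Fix dB \<Phi>" by (simp add: ergodic_proj_in_Fix[OF channel])
      then show ?thesis using frame that(3,4) by (simp add: G_def)
    qed
    have "complex_of_real (trace_norm X) = mat_trace (?Z * ?G)"
      unfolding XV[symmetric] XW[symmetric]
      by (rule mat_trace_measured[OF X(1) Mc]) (use W W_frame in \<open>auto simp: op_bounded_def\<close>)
    then have "trace_norm X = Re (mat_trace (?Z * ?G))" by (metis Re_complex_of_real)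
    also have "\<dots> \<le> 2 * real ?D * trace_norm ?Z"
    proof (rule trace_norm_bound[OF id_tensor_carrier qc_output_hermitian[OF X psdM]])
      show "op_bounded (dA * l) (2 * real ?D) ?G"
        by (rule op_bounded_diagonal_blocks) (use bound W in \<open>simp add: G_def\<close>)
    qed
    finally show ?thesis .
  qed
  then show ?thesis using M by blast
qed

end
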